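(* Let $V$ be a finite-dimensional vector space over a field $\mathbf{k}$ of characteristic zero and let $A=\mathrm{End}(V)$ with the trace form $\langle x,y\rangle=\mathrm{tr}(xy)$. Let $P\in\mathcal{C}^p_{dL}(V)$ and $Q\in\mathcal{C}^q_{dL}(V)$, $p,q\ge0$. Then $$\Psi_{p+q}\bigl([P,Q]_{dL}\bigr)=[\Psi_p(P),\Psi_q(Q)]_{rb}.$$ Consequently, $\Psi=(\Psi_p)_{p\ge0}:(\mathcal{C}^\bullet_{dL}(V),[\cdot,\cdot]_{dL})\to(\mathrm{C}^\bullet_{rb}(A),[\cdot,\cdot]_{rb})$ is an isomorphism of graded Lie algebras.
   Context: **Double Lie side.** $\sigma_n(a_1\otimes\cdots\otimes a_n)=a_n\otimes a_1\otimes\cdots\otimes a_{n-1}$ on $V^{\otimes n}$. For $p\ge0$, $\mathcal{C}^p_{dL}(V):=\{P\in\mathrm{End}(V^{\otimes(p+1)})\mid\sigma_{p+1}P\sigma_{p+1}^{-1}=(-1)^pP\}$ (degree $p$); $P\diamond Q:=(P\otimes\mathrm{id}^{\otimes q})\circ(\mathrm{id}^{\otimes p}\otimes Q)$; $P\,\square\, Q:=\sum_{s=0}^{p+q}(-1)^{(p+q)s}\sigma_{p+q+1}^{s}(P\diamond Q)\sigma_{p+q+1}^{-s}$; $[P,Q]_{dL}:=P\,\square\, Q-(-1)^{pq}Q\,\square\, P$. This makes $\mathcal C^\bullet_{dL}(V)=\bigoplus_{p\ge 0}\mathcal C^p_{dL}(V)$ a graded Lie algebra. **Rota-Baxter side.**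 For $p\ge0$ (with $\mathrm{Hom}(A^{\otimes0},A)=A$), $\mathrm{C}^p_{rb}(A)$ is the space of $F\in\mathrm{Hom}(A^{\otimes p},A)$ with $\langle F(x_1,\dots,x_p),x_0\rangle=(-1)^p\langle F(x_0,\dots,x_{p-1}),x_p\rangle$ for all $x_i\in A$ (degree $p$); $\mathrm{C}^\bullet_{rb}(A)=\bigoplus_{p\ge0}\mathrm{C}^p_{rb}(A)$. For $F,G$ of degrees $p,q\ge1$, $[F,G]_{rb}:=F\circledcirc G-(-1)^{pq}G\circledcirc F$, where $$\begin{aligned}(F\circledcirc G)(x_1,\dots,x_{p+q})=&\sum_{i=1}^p(-1)^{(i-1)q}F(x_1,\dots,x_{i-1},G(x_i,\dots,x_{i+q-1})x_{i+q},x_{i+q+1},\dots,x_{p+q})\\&-\sum_{i=1}^p(-1)^{iq}F(x_1,\dots,x_{i-1},x_iG(x_{i+1},\dots,x_{i+q}),x_{i+q+1},\dots,x_{p+q})\\&+(-1)^{pq}F(x_1,\dots,x_p)G(x_{p+1},\dots,x_{p+q}).\end{aligned}$$ For $a\in A$ and $F$ of degree $p\ge1$, $[F,a]_{rb}(x_1,\dots,x_p)=\sum_{i=1}^pF(x_1,\dots,ax_i-x_ia,\dots,x_p)+F(x_1,\dots,x_p)a-aF(x_1,\dots,x_p)$ (with $ax_i-x_ia$ in position $i$), $[a,F]_{rb}=-[F,a]_{rb}$; $[a,b]_{rb}=ab-ba$ for $a,b\in A$. **The map $\Psi$.** Let $\rho_m:A^{\otimes m}\to\mathrm{End}(V^{\otimes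 m})$ be the canonical isomorphism $\rho_m(a_1\otimes\cdots\otimes a_m)(v_1\otimes\cdots\otimes v_m)=a_1(v_1)\otimes\cdots\otimes a_m(v_m)$. For $P\in\mathrm{End}(V^{\otimes(p+1)})$ write $\widetilde P=\rho_{p+1}^{-1}(P)=\sum_\alpha P_0^\alpha\otimes\cdots\otimes P_p^\alpha$ and set $$\Psi_p(P)(x_1,\dots,x_p):=\sum_\alpha\langle P_{p-1}^\alpha,x_1\rangle\langle P_{p-2}^\alpha,x_2\rangle\cdots\langle P_0^\alpha,x_p\rangle P_p^\alpha,$$ with $\Psi_0(P)=P$. *)

theory Defs
  imports Complex_Main "HOL-Library.Function_Algebras"
begin

section \<open>Linear and multilinear maps on subspaces\<close>

text \<open>A vector space is a subset \<open>S\<close> of a type together with a scalar multiplication \<open>s\<close>.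
  Maps defined on a subset are extended by zero, so that equality of maps is HOL equality; addition
  and subtraction of maps are those of \<open>HOL-Library.Function_Algebras\<close>.\<close>

definition pointwise :: "('k \<Rightarrow> 'b \<Rightarrow> 'b) \<Rightarrow> 'k \<Rightarrow> ('a \<Rightarrow> 'b) \<Rightarrow> 'a \<Rightarrow> 'b" where
  "pointwise s c f = (\<lambda>x. s c (f x))"

definition words :: "'a set \<Rightarrow> nat \<Rightarrow> 'a list set" where
  "words S n = {xs. length xs = n \<and> set xs \<subseteq> S}"

definition lin_maps ::
  "('k \<Rightarrow> 'a \<Rightarrow> 'a) \<Rightarrow> 'a set \<Rightarrow> ('k \<Rightarrow> 'b \<Rightarrow> 'b) \<Rightarrow> 'b set \<Rightarrow> ('a::ab_group_add \<Rightarrow> 'b::ab_group_add) set"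
  where
  "lin_maps s S s' S' = {f.
     (\<forall>x\<in>S. f x \<in> S') \<and>
     (\<forall>x\<in>S. \<forall>y\<in>S. f (x + y) = f x + f y) \<and>
     (\<forall>c. \<forall>x\<in>S. f (s c x) = s' c (f x)) \<and>
     (\<forall>x. x \<notin> S \<longrightarrow> f x = 0)}"

definition multilin_maps ::
  "('k \<Rightarrow> 'a \<Rightarrow> 'a) \<Rightarrow> 'a set \<Rightarrow> nat \<Rightarrow> ('k \<Rightarrow> 'b \<Rightarrow> 'b) \<Rightarrow> 'b set \<Rightarrow>
     ('a::ab_group_add list \<Rightarrow> 'b::ab_group_add) set"
  where
  "multilin_maps s S n s' S' = {f.
     (\<forall>xs\<in>words S n. f xs \<in> S') \<and>
     (\<forall>xs\<in>words S n. \<forall>i<n. \<forall>x\<in>S. \<forall>y\<in>S. f (xs[i := x + y]) = f (xs[i := x]) + f (xs[i := y])) \<and>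
     (\<forall>xs\<in>words S n. \<forall>i<n. \<forall>c. \<forall>x\<in>S. f (xs[i := s c x]) = s' c (f (xs[i := x]))) \<and>
     (\<forall>xs. xs \<notin> words S n \<longrightarrow> f xs = 0)}"

section \<open>Tensor powers of a finite-dimensional vector space\<close>

text \<open>For finite-dimensional \<open>S\<close>, the tensor power \<open>S\<^sup>\<otimes>\<^sup>n\<close> is realised as the space of \<open>n\<close>-linear
  forms on the dual of \<open>S\<close>: the pure tensor of \<open>a\<^sub>1, \<dots>, a\<^sub>n\<close> is the form sending \<open>\<phi>\<^sub>1, \<dots>, \<phi>\<^sub>n\<close> to
  \<open>\<phi>\<^sub>1(a\<^sub>1) \<cdots> \<phi>\<^sub>n(a\<^sub>n)\<close>.\<close>

type_synonym ('a, 'k) tensor = "('a \<Rightarrow> 'k) list \<Rightarrow> 'k"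
type_synonym ('a, 'k) tensor_op = "('a, 'k) tensor \<Rightarrow> ('a, 'k) tensor"

abbreviation tscale :: "'k::field \<Rightarrow> ('a, 'k) tensor \<Rightarrow> ('a, 'k) tensor" where
  "tscale \<equiv> pointwise (*)"

definition dual :: "('k::field \<Rightarrow> 'a \<Rightarrow> 'a) \<Rightarrow> 'a::ab_group_add set \<Rightarrow> ('a \<Rightarrow> 'k) set" where
  "dual s S = lin_maps s S (*) UNIV"

definition tensor_power ::
  "('k::field \<Rightarrow> 'a \<Rightarrow> 'a) \<Rightarrow> 'a::ab_group_add set \<Rightarrow> nat \<Rightarrow> ('a, 'k) tensor set" where
  "tensor_power s S n = multilin_maps (pointwise (*)) (dual s S) n (*) UNIV"

definition pure_tensor ::
  "('k::field \<Rightarrow> 'a \<Rightarrow> 'a) \<Rightarrow> 'a::ab_group_add set \<Rightarrow> 'a list \<Rightarrow> ('a, 'k) tensor" where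
  "pure_tensor s S as =
     (\<lambda>\<phi>s. if \<phi>s \<in> words (dual s S) (length as) then \<Prod>i<length as. (\<phi>s ! i) (as ! i) else 0)"

text \<open>The universal property: \<open>tensor_lift s S n s' f\<close> is the linear map on \<open>S\<^sup>\<otimes>\<^sup>n\<close> that sends the
  pure tensor of \<open>as\<close> to \<open>f as\<close>. It is only used for multilinear \<open>f\<close>, for which it exists and is
  unique.\<close>

definition tensor_lift ::
  "('k::field \<Rightarrow> 'a \<Rightarrow> 'a) \<Rightarrow> 'a::ab_group_add set \<Rightarrow> nat \<Rightarrow> ('k \<Rightarrow> 'b \<Rightarrow> 'b) \<Rightarrow>
     ('a list \<Rightarrow> 'b::ab_group_add) \<Rightarrow> ('a, 'k) tensor \<Rightarrow> 'b" where
  "tensor_lift s S n s' f =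
     (THE g. g \<in> lin_maps tscale (tensor_power s S n) s' UNIV \<and>
             (\<forall>as\<in>words S n. g (pure_tensor s S as) = f as))"

text \<open>The product \<open>S\<^sup>\<otimes>\<^sup>m \<times> S\<^sup>\<otimes>\<^sup>n \<rightarrow> S\<^sup>\<otimes>\<^sup>m\<^sup>+\<^sup>n\<close>.\<close>

definition tensor_append :: "nat \<Rightarrow> ('a, 'k::field) tensor \<Rightarrow> ('a, 'k) tensor \<Rightarrow> ('a, 'k) tensor" where
  "tensor_append m T U = (\<lambda>\<phi>s. T (take m \<phi>s) * U (drop m \<phi>s))"

section \<open>Graded Lie algebras\<close>

text \<open>A graded vector space is given by its homogeneous components \<open>L p\<close>, all inside one ambient
  type; as these may overlap there, the bracket takes the degrees of its arguments as
  parameters.\<close>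

definition graded_lie_algebra ::
  "('k::field_char_0 \<Rightarrow> 'b \<Rightarrow> 'b) \<Rightarrow> (nat \<Rightarrow> 'b::ab_group_add set) \<Rightarrow>
     (nat \<Rightarrow> nat \<Rightarrow> 'b \<Rightarrow> 'b \<Rightarrow> 'b) \<Rightarrow> bool" where
  "graded_lie_algebra s L br \<longleftrightarrow>
     vector_space s \<and>
     (\<forall>p. module.subspace s (L p)) \<and>
     (\<forall>p q. \<forall>x\<in>L p. \<forall>y\<in>L q. br p q x y \<in> L (p + q)) \<and>
     (\<forall>p q. \<forall>x\<in>L p. \<forall>x'\<in>L p. \<forall>y\<in>L q. br p q (x + x') y = br p q x y + br p q x' y) \<and>
     (\<forall>p q. \<forall>x\<in>L p. \<forall>y\<in>L q. \<forall>y'\<in>L q. br p q x (y + y') = br p q x y + br p q x y') \<and>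
     (\<forall>p q c. \<forall>x\<in>L p. \<forall>y\<in>L q. br p q (s c x) y = s c (br p q x y)) \<and>
     (\<forall>p q c. \<forall>x\<in>L p. \<forall>y\<in>L q. br p q x (s c y) = s c (br p q x y)) \<and>
     (\<forall>p q. \<forall>x\<in>L p. \<forall>y\<in>L q. br p q x y = - s ((-1) ^ (p * q)) (br q p y x)) \<and>
     (\<forall>p q r. \<forall>x\<in>L p. \<forall>y\<in>L q. \<forall>z\<in>L r.
        br p (q + r) x (br q r y z) =
        br (p + q) r (br p q x y) z + s ((-1) ^ (p * q)) (br q (p + r) y (br p r x z)))"

definition graded_lie_algebra_iso ::
  "('k::field_char_0 \<Rightarrow> 'b \<Rightarrow> 'b) \<Rightarrow> (nat \<Rightarrow> 'b::ab_group_add set) \<Rightarrow>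
     (nat \<Rightarrow> nat \<Rightarrow> 'b \<Rightarrow> 'b \<Rightarrow> 'b) \<Rightarrow>
   ('k \<Rightarrow> 'c \<Rightarrow> 'c) \<Rightarrow> (nat \<Rightarrow> 'c::ab_group_add set) \<Rightarrow>
     (nat \<Rightarrow> nat \<Rightarrow> 'c \<Rightarrow> 'c \<Rightarrow> 'c) \<Rightarrow>
   (nat \<Rightarrow> 'b \<Rightarrow> 'c) \<Rightarrow> bool" where
  "graded_lie_algebra_iso s L br s' L' br' f \<longleftrightarrow>
     graded_lie_algebra s L br \<and>
     graded_lie_algebra s' L' br' \<and>
     (\<forall>p. bij_betw (f p) (L p) (L' p)) \<and>
     (\<forall>p. \<forall>x\<in>L p. \<forall>y\<in>L p. f p (x + y) = f p x + f p y) \<and>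
     (\<forall>p c. \<forall>x\<in>L p. f p (s c x) = s' c (f p x)) \<and>
     (\<forall>p q. \<forall>x\<in>L p. \<forall>y\<in>L q. f (p + q) (br p q x y) = br' p q (f p x) (f q y))"

section \<open>The double Lie side\<close>

abbreviation tpow :: "('k::field \<Rightarrow> 'v \<Rightarrow> 'v) \<Rightarrow> nat \<Rightarrow> ('v::ab_group_add, 'k) tensor set" where
  "tpow scale n \<equiv> tensor_power scale UNIV n"

abbreviation opscale :: "'k::field \<Rightarrow> ('v, 'k) tensor_op \<Rightarrow> ('v, 'k) tensor_op" where
  "opscale \<equiv> pointwise tscale"

definition tensor_end :: "('k::field \<Rightarrow> 'v \<Rightarrow> 'v) \<Rightarrow> nat \<Rightarrow> ('v::ab_group_add, 'k) tensor_op set" where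
  "tensor_end scale n = lin_maps tscale (tpow scale n) tscale (tpow scale n)"

text \<open>\<open>P \<otimes> Q\<close> for \<open>P\<close> acting on \<open>V\<^sup>\<otimes>\<^sup>m\<close> and \<open>Q\<close> acting on \<open>V\<^sup>\<otimes>\<^sup>n\<close>.\<close>

definition op_tensor ::
  "('k::field \<Rightarrow> 'v \<Rightarrow> 'v) \<Rightarrow> nat \<Rightarrow> nat \<Rightarrow> ('v::ab_group_add, 'k) tensor_op \<Rightarrow>
     ('v, 'k) tensor_op \<Rightarrow> ('v, 'k) tensor_op" where
  "op_tensor scale m n P Q = tensor_lift scale UNIV (m + n) tscale
     (\<lambda>vs. tensor_append m (P (pure_tensor scale UNIV (take m vs)))
                           (Q (pure_tensor scale UNIV (drop m vs))))"

definition sigma :: "('k::field \<Rightarrow> 'v \<Rightarrow> 'v) \<Rightarrow> nat \<Rightarrow> ('v::ab_group_add, 'k) tensor_op" where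
  "sigma scale n = tensor_lift scale UNIV n tscale
     (\<lambda>vs. pure_tensor scale UNIV (last vs # butlast vs))"

definition sigma_inv :: "('k::field \<Rightarrow> 'v \<Rightarrow> 'v) \<Rightarrow> nat \<Rightarrow> ('v::ab_group_add, 'k) tensor_op" where
  "sigma_inv scale n =
     (\<lambda>T. if T \<in> tpow scale n then inv_into (tpow scale n) (sigma scale n) T else 0)"

definition C_dL :: "('k::field \<Rightarrow> 'v \<Rightarrow> 'v) \<Rightarrow> nat \<Rightarrow> ('v::ab_group_add, 'k) tensor_op set" where
  "C_dL scale p = {P \<in> tensor_end scale (p + 1).
     sigma scale (p + 1) \<circ> P \<circ> sigma_inv scale (p + 1) = opscale ((-1) ^ p) P}"

definition dL_diamond ::
  "('k::field \<Rightarrow> 'v \<Rightarrow> 'v) \<Rightarrow> nat \<Rightarrow> nat \<Rightarrow> ('v::ab_group_add, 'k) tensor_op \<Rightarrow>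
     ('v, 'k) tensor_op \<Rightarrow> ('v, 'k) tensor_op" where
  "dL_diamond scale p q P Q = op_tensor scale (p + 1) q P id \<circ> op_tensor scale p (q + 1) id Q"

definition dL_box ::
  "('k::field \<Rightarrow> 'v \<Rightarrow> 'v) \<Rightarrow> nat \<Rightarrow> nat \<Rightarrow> ('v::ab_group_add, 'k) tensor_op \<Rightarrow>
     ('v, 'k) tensor_op \<Rightarrow> ('v, 'k) tensor_op" where
  "dL_box scale p q P Q = (\<Sum>s = 0..p + q. opscale ((-1) ^ ((p + q) * s))
     ((sigma scale (p + q + 1) ^^ s) \<circ> dL_diamond scale p q P Q \<circ> (sigma_inv scale (p + q + 1) ^^ s)))"

definition dL_bracket ::
  "('k::field \<Rightarrow> 'v \<Rightarrow> 'v) \<Rightarrow> nat \<Rightarrow> nat \<Rightarrow> ('v::ab_group_add, 'k) tensor_op \<Rightarrow>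
     ('v, 'k) tensor_op \<Rightarrow> ('v, 'k) tensor_op" where
  "dL_bracket scale p q P Q =
     dL_box scale p q P Q - opscale ((-1) ^ (p * q)) (dL_box scale q p Q P)"

section \<open>The Rota-Baxter side\<close>

text \<open>The product of the algebra \<open>A = End(V)\<close> is composition.\<close>

definition End :: "('k::field \<Rightarrow> 'v \<Rightarrow> 'v) \<Rightarrow> ('v::ab_group_add \<Rightarrow> 'v) set" where
  "End scale = {a. Vector_Spaces.linear scale scale a}"

text \<open>The trace is computed in a basis \<open>B\<close> of \<open>V\<close>.\<close>

definition trace_form ::
  "('k::field \<Rightarrow> 'v \<Rightarrow> 'v) \<Rightarrow> 'v set \<Rightarrow> ('v::ab_group_add \<Rightarrow> 'v) \<Rightarrow> ('v \<Rightarrow> 'v) \<Rightarrow> 'k" where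
  "trace_form scale B x y = (\<Sum>b\<in>B. module.representation scale B ((x \<circ> y) b) b)"

text \<open>\<open>Hom(A\<^sup>\<otimes>\<^sup>p, A)\<close> is the space of \<open>p\<close>-linear maps; for \<open>p = 0\<close> such a map is its value at
  \<open>[]\<close>, an element of \<open>A\<close>.\<close>

type_synonym 'v cochain = "('v \<Rightarrow> 'v) list \<Rightarrow> ('v \<Rightarrow> 'v)"

abbreviation cscale :: "('k::field \<Rightarrow> 'v \<Rightarrow> 'v) \<Rightarrow> 'k \<Rightarrow> 'v cochain \<Rightarrow> 'v cochain" where
  "cscale scale \<equiv> pointwise (pointwise scale)"

definition C_rb :: "('k::field \<Rightarrow> 'v \<Rightarrow> 'v) \<Rightarrow> 'v set \<Rightarrow> nat \<Rightarrow> 'v::ab_group_add cochain set" where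
  "C_rb scale B p =
     {F \<in> multilin_maps (pointwise scale) (End scale) p (pointwise scale) (End scale).
        \<forall>xs\<in>words (End scale) (p + 1).
          trace_form scale B (F (tl xs)) (hd xs) =
          (-1) ^ p * trace_form scale B (F (butlast xs)) (last xs)}"

text \<open>Arguments \<open>x\<^sub>i\<close> are numbered from 1, so \<open>x\<^sub>i\<close> is \<open>xs ! (i - 1)\<close>.\<close>

definition rb_circ ::
  "('k::field \<Rightarrow> 'v \<Rightarrow> 'v) \<Rightarrow> nat \<Rightarrow> nat \<Rightarrow> 'v::ab_group_add cochain \<Rightarrow> 'v cochain \<Rightarrow> 'v cochain" where
  "rb_circ scale p q F G = (\<lambda>xs. if xs \<in> words (End scale) (p + q) then
       (\<Sum>i = 1..p. pointwise scale ((-1) ^ ((i - 1) * q))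
          (F (take (i - 1) xs @ [G (take q (drop (i - 1) xs)) \<circ> (xs ! (i + q - 1))] @ drop (i + q) xs)))
     - (\<Sum>i = 1..p. pointwise scale ((-1) ^ (i * q))
          (F (take (i - 1) xs @ [(xs ! (i - 1)) \<circ> G (take q (drop i xs))] @ drop (i + q) xs)))
     + pointwise scale ((-1) ^ (p * q)) (F (take p xs) \<circ> G (drop p xs))
     else 0)"

definition rb_act ::
  "('k::field \<Rightarrow> 'v \<Rightarrow> 'v) \<Rightarrow> nat \<Rightarrow> 'v::ab_group_add cochain \<Rightarrow> ('v \<Rightarrow> 'v) \<Rightarrow> 'v cochain" where
  "rb_act scale p F a = (\<lambda>xs. if xs \<in> words (End scale) p then
       (\<Sum>i = 1..p. F (xs[i - 1 := (a \<circ> xs ! (i - 1)) - (xs ! (i - 1) \<circ> a)]))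
       + (F xs \<circ> a) - (a \<circ> F xs)
     else 0)"

definition rb_bracket ::
  "('k::field \<Rightarrow> 'v \<Rightarrow> 'v) \<Rightarrow> nat \<Rightarrow> nat \<Rightarrow> 'v::ab_group_add cochain \<Rightarrow> 'v cochain \<Rightarrow> 'v cochain" where
  "rb_bracket scale p q F G =
     (if p \<ge> 1 \<and> q \<ge> 1 then
        rb_circ scale p q F G - cscale scale ((-1) ^ (p * q)) (rb_circ scale q p G F)
      else if p \<ge> 1 then rb_act scale p F (G [])
      else if q \<ge> 1 then - rb_act scale q G (F [])
      else (\<lambda>xs. if xs = [] then (F [] \<circ> G []) - (G [] \<circ> F []) else 0))"

section \<open>The comparison map\<close>

definition rho ::
  "('k::field \<Rightarrow> 'v \<Rightarrow> 'v) \<Rightarrow> nat \<Rightarrow> ('v::ab_group_add \<Rightarrow> 'v, 'k) tensor \<Rightarrow> ('v, 'k) tensor_op" where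
  "rho scale m = tensor_lift (pointwise scale) (End scale) m opscale
     (\<lambda>as. tensor_lift scale UNIV m tscale
        (\<lambda>vs. pure_tensor scale UNIV (map2 (\<lambda>a v. a v) as vs)))"

text \<open>The linear map \<open>A\<^sup>\<otimes>\<^sup>p\<^sup>+\<^sup>1 \<rightarrow> Hom(A\<^sup>\<otimes>\<^sup>p, A)\<close> sending \<open>a\<^sub>0 \<otimes> \<cdots> \<otimes> a\<^sub>p\<close> to
  \<open>(x\<^sub>1, \<dots>, x\<^sub>p) \<mapsto> \<langle>a\<^sub>p\<^sub>-\<^sub>1, x\<^sub>1\<rangle> \<cdots> \<langle>a\<^sub>0, x\<^sub>p\<rangle> a\<^sub>p\<close>.\<close>

definition contraction ::
  "('k::field \<Rightarrow> 'v \<Rightarrow> 'v) \<Rightarrow> 'v set \<Rightarrow> nat \<Rightarrow>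
     ('v::ab_group_add \<Rightarrow> 'v, 'k) tensor \<Rightarrow> 'v cochain" where
  "contraction scale B p = tensor_lift (pointwise scale) (End scale) (p + 1) (cscale scale)
     (\<lambda>as xs. if xs \<in> words (End scale) p
        then pointwise scale (\<Prod>i = 1..p. trace_form scale B (as ! (p - i)) (xs ! (i - 1))) (as ! p)
        else 0)"

definition Psi ::
  "('k::field \<Rightarrow> 'v \<Rightarrow> 'v) \<Rightarrow> 'v set \<Rightarrow> nat \<Rightarrow> ('v::ab_group_add, 'k) tensor_op \<Rightarrow> 'v cochain" where
  "Psi scale B p P = contraction scale B p
     (inv_into (tensor_power (pointwise scale) (End scale) (p + 1)) (rho scale (p + 1)) P)"

end

theory Submission
  imports Defs
begin

text \<open>
  Why the theorem is true. For \<open>F = \<Psi>\<^sub>p(P)\<close> the form \<open>\<langle>F(x\<^sub>1, \<dots>, x\<^sub>p), x\<^sub>0\<rangle>\<close> is the trace of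
  \<open>P \<circ> (x\<^sub>p \<otimes> \<cdots> \<otimes> x\<^sub>1 \<otimes> x\<^sub>0)\<close> (\<open>trace_Psi\<close>). The matrix of \<open>P\<close> is arbitrary, so \<open>\<Psi>\<^sub>p\<close> is a linear
  bijection from all operators onto all \<open>p\<close>-linear maps (\<open>Psi_inj\<close>, \<open>Psi_surj\<close>). Conjugation by
  \<open>\<sigma>\<close> rotates the arguments of the trace, hence the two cyclicity conditions correspond
  (\<open>Psi_C_rb_iff\<close>).

  For the brackets, everything is paired with a last argument \<open>x\<^sub>0\<close>; the trace form is
  nondegenerate. In \<open>P \<diamond> Q\<close> the operators share one tensor position, so its trace against
  endomorphisms is the trace of a product of three of them: \<open>P\<close> contracted with the arguments
  before that position, \<open>Q\<close> contracted with those after it, and the argument at it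
  (\<open>Phi_diamond\<close>). Therefore \<open>P \<square> Q\<close> gives the signed sum of \<open>tr (F(\<dots>) G(\<dots>) z)\<close> over the
  \<open>p + q + 1\<close> rotations of the cyclic word \<open>x\<^sub>1 \<dots> x\<^sub>p\<^sub>+\<^sub>q x\<^sub>0\<close> (\<open>Phi_box_trace3\<close>). On the other side,
  cyclicity moves the argument that contains the inner cochain to the last place and produces the
  same traces: the terms \<open>F(\<dots>, G(\<dots>)x, \<dots>)\<close> and \<open>FG\<close> of \<open>F \<circledcirc> G\<close> are the rotations in which
  \<open>x\<^sub>0\<close> is not an argument of \<open>G\<close>, and the terms \<open>G(\<dots>, xF(\<dots>), \<dots>)\<close> of \<open>G \<circledcirc> F\<close> are
  the remaining ones (\<open>trace_circ\<close>). This gives \<open>Psi_bracket\<close>.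

  For the graded Lie algebra structures, closure, bilinearity and antisymmetry are read off on the
  double Lie side, where \<open>P \<square> Q\<close> is cyclic because it is a sum over all rotations. The Jacobi
  identity is proved on the Rota-Baxter side, for arbitrary multilinear cochains. There
  \<open>H \<circledcirc> F\<close> inserts \<open>[F, x] = F x - (-1)\<^sup>p x F\<close> for each argument \<open>x\<close> of \<open>H\<close> and adds the
  product \<open>H F\<close>: it acts on \<open>H\<close> as the sum of the derivation
  \<open>x \<mapsto> [F, x]\<close> and a multiplication.
  These operators behave like a flat connection, which makes \<open>\<circledcirc>\<close> graded right pre-Lie
  (\<open>circ_pre_Lie\<close>), and the graded commutator of a pre-Lie product satisfies the Jacobi identity
  (\<open>bracket_Jacobi\<close>). Finally \<open>\<Psi>\<close> carries each structure to the other side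
  (\<open>graded_lie_algebra_iso_transport\<close>).
\<close>

section \<open>Words and sums over words\<close>

lemma words_0 [simp]: "words S 0 = {[]}"
  by (auto simp: words_def)

lemma Nil_in_words [simp]: "[] \<in> words S n \<longleftrightarrow> n = 0"
  by (auto simp: words_def)

lemma Cons_in_words [simp]: "x # xs \<in> words S n \<longleftrightarrow> x \<in> S \<and> (\<exists>m. n = Suc m \<and> xs \<in> words S m)"
  by (auto simp: words_def)

lemma words_append: "us \<in> words S m \<Longrightarrow> vs \<in> words S n \<Longrightarrow> us @ vs \<in> words S (m + n)"
  by (auto simp: words_def)

lemma words_length: "xs \<in> words S n \<Longrightarrow> length xs = n"
  by (simp add: words_def)

lemma words_take: "xs \<in> words S n \<Longrightarrow> m \<le> n \<Longrightarrow> take m xs \<in> words S m"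
  by (auto simp: words_def dest: in_set_takeD)

lemma words_drop: "xs \<in> words S (m + n) \<Longrightarrow> drop m xs \<in> words S n"
  by (auto simp: words_def dest: in_set_dropD)

lemma words_map: "xs \<in> words S n \<Longrightarrow> (\<And>x. x \<in> S \<Longrightarrow> f x \<in> S') \<Longrightarrow> map f xs \<in> words S' n"
  by (auto simp: words_def)

lemma words_rotate1 [simp]: "rotate1 xs \<in> words S n \<longleftrightarrow> xs \<in> words S n"
  by (simp add: words_def)

lemma words_rotate [simp]: "rotate k xs \<in> words S n \<longleftrightarrow> xs \<in> words S n"
  by (simp add: words_def)

lemma words_rev [simp]: "rev xs \<in> words S n \<longleftrightarrow> xs \<in> words S n"
  by (simp add: words_def)

lemma words_Suc_snoc: "w \<in> words S (Suc n) \<Longrightarrow> \<exists>u a. w = u @ [a] \<and> u \<in> words S n \<and> a \<in> S"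
  by (cases w rule: rev_cases) (auto simp: words_def)

lemma words_tl: "w \<in> words S (Suc n) \<Longrightarrow> tl w \<in> words S n \<and> hd w \<in> S \<and> w = hd w # tl w"
  by (cases w) auto

lemma finite_words: "finite S \<Longrightarrow> finite (words S n)"
  using finite_lists_length_eq[of S n] by (simp add: words_def conj_commute)

lemma sum_words_Suc:
  "(\<Sum>w\<in>words I (Suc n). g w) = (\<Sum>i\<in>I. \<Sum>w\<in>words I n. g (i # w))"
proof -
  have "words I (Suc n) = (\<lambda>(i, w). i # w) ` (I \<times> words I n)"
    by (auto simp: words_def length_Suc_conv image_iff)
  moreover have "inj_on (\<lambda>(i, w). i # w) (I \<times> words I n)"
    by (auto simp: inj_on_def)
  ultimately show ?thesis
    by (simp add: sum.reindex sum.cartesian_product case_prod_unfold)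
qed

lemma sum_words_add:
  "(\<Sum>w\<in>words I (m + n). g w) = (\<Sum>u\<in>words I m. \<Sum>v\<in>words I n. g (u @ v))"
  by (induction m arbitrary: g) (simp_all add: sum_words_Suc)

lemma sum_words_snoc:
  "(\<Sum>w\<in>words I (Suc n). g w) = (\<Sum>u\<in>words I n. \<Sum>i\<in>I. g (u @ [i]))"
  using sum_words_add[of g I n 1] by (simp add: sum_words_Suc)

lemma rotate1_bij_words: "bij_betw rotate1 (words I n) (words I n)"
proof (rule bij_betwI')
  fix x y :: "'a list" show "(rotate1 x = rotate1 y) = (x = y)"
    using inj_rotate1 by (auto dest: injD)
next
  fix y assume y: "y \<in> words I n"
  obtain x where "y = rotate1 x" using surj_rotate1 by (metis surjD)
  with y show "\<exists>x\<in>words I n. y = rotate1 x" by auto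
qed simp

lemma sum_words_rotate1: "(\<Sum>w\<in>words I n. g (rotate1 w)) = (\<Sum>w\<in>words I n. g w)"
  using rotate1_bij_words by (rule sum.reindex_bij_betw)

text \<open>For coordinate functions \<open>c i\<close> this is the coefficient of the pure tensor of
  \<open>xs\<close> at the basis tensor with index word \<open>is\<close>.\<close>

definition word_prod :: "('i \<Rightarrow> 'a \<Rightarrow> 'k::comm_monoid_mult) \<Rightarrow> 'i list \<Rightarrow> 'a list \<Rightarrow> 'k" where
  "word_prod c is xs = prod_list (map2 c is xs)"

lemma word_prod_simps [simp]:
  "word_prod c [] xs = 1" "word_prod c is [] = 1"
  "word_prod c (i # is) (x # xs) = c i x * word_prod c is xs"
  by (simp_all add: word_prod_def)

lemma word_prod_append:
  "length is = length xs \<Longrightarrow>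
    word_prod c (is @ is') (xs @ xs') = word_prod c is xs * word_prod c is' xs'"
  by (simp add: word_prod_def)

lemma word_prod_rotate1:
  "length is = length xs \<Longrightarrow> word_prod c (rotate1 is) (rotate1 xs) = word_prod c is xs"
  by (cases "is"; cases xs) (simp_all add: word_prod_append mult.commute)

lemma word_prod_map: "word_prod c (map f is) (map g xs) = word_prod (\<lambda>i x. c (f i) (g x)) is xs"
proof (induction "is" arbitrary: xs)
  case (Cons i "is") then show ?case by (cases xs) auto
qed simp

lemma word_prod_nth:
  "length is = n \<Longrightarrow> length xs = n \<Longrightarrow> word_prod c is xs = (\<Prod>j<n. c (is ! j) (xs ! j))"
proof (induction n arbitrary: "is" xs)
  case (Suc n)
  then obtain i "is'" x xs' where "is = i # is'" "xs = x # xs'"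
    by (metis length_Suc_conv)
  with Suc show ?case by (simp only: prod.lessThan_Suc_shift) simp
qed simp

lemma word_prod_swap: "word_prod (\<lambda>x i. c i x) xs is = word_prod c is xs"
proof (induction "is" arbitrary: xs)
  case (Cons i "is") then show ?case by (cases xs) auto
qed simp

lemma word_prod_cong:
  "(\<And>i x. i \<in> set is \<Longrightarrow> x \<in> set xs \<Longrightarrow> c i x = c' i x) \<Longrightarrow> word_prod c is xs = word_prod c' is xs"
proof (induction "is" arbitrary: xs)
  case (Cons i "is") then show ?case by (cases xs) auto
qed simp

lemma word_prod_delta:
  fixes c :: "'i \<Rightarrow> 'j \<Rightarrow> 'k::comm_semiring_1"
  assumes "is \<in> words I n" "js \<in> words J n"
    and "\<And>i j. i \<in> I \<Longrightarrow> j \<in> J \<Longrightarrow> c i j = of_bool (f i = j)"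
  shows "word_prod c is js = of_bool (map f is = js)"
  using assms(1,2)
proof (induction "is" arbitrary: js n)
  case Nil then show ?case by (cases js) (auto simp: words_def)
next
  case (Cons i "is")
  then obtain m j js' where js: "js = j # js'" "n = Suc m" by (cases js) auto
  with Cons show ?case by (auto simp: assms(3))
qed

lemma sum_words_delta:
  fixes g :: "'i list \<Rightarrow> 'k::comm_semiring_1"
  assumes "finite I" "js \<in> words I n"
  shows "(\<Sum>is\<in>words I n. of_bool (is = js) * g is) = g js"
    "(\<Sum>is\<in>words I n. of_bool (js = is) * g is) = g js"
  using assms finite_words[OF assms(1), of n]
  by (simp_all add: of_bool_def if_distrib[of "\<lambda>x. x * _"] cong: if_cong)

section \<open>Signed sums over the rotations of a word\<close>

definition rot_sum :: "nat \<Rightarrow> ('a list \<Rightarrow> 'k::comm_ring_1) \<Rightarrow> 'a list \<Rightarrow> 'k" where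
  "rot_sum n f w = (\<Sum>s = 0..n. (-1) ^ (n * s) * f (rotate s w))"

lemma sum_periodic_shift:
  fixes g :: "nat \<Rightarrow> 'k::comm_ring_1"
  assumes "\<And>s. g (s + Suc n) = g s"
  shows "(\<Sum>s = 0..n. g (s + a)) = (\<Sum>s = 0..n. g s)"
proof (induction a)
  case (Suc a)
  have "(\<Sum>s = 0..n. g (s + Suc a)) + g a = g a + (\<Sum>s = 0..n. g (Suc s + a))" by simp
  also have "\<dots> = (\<Sum>s = 0..Suc n. g (s + a))"
    by (simp only: sum.atLeast0_atMost_Suc_shift) (simp add: comp_def)
  also have "\<dots> = (\<Sum>s = 0..n. g (s + a)) + g a"
    using assms[of a] by (simp add: add.commute)
  finally show ?case using Suc by simp
qed simp

lemma sign_even: "even (k + l) \<Longrightarrow> (-1) ^ k = ((-1) ^ l :: 'k::comm_ring_1)"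
  by (cases "even k"; cases "even l") auto

text \<open>A full rotation of a word of \<open>n + 1\<close> letters contributes the sign of \<open>n(n +
  1)\<close>, which is even.\<close>

lemma rot_term_periodic:
  assumes "length w = Suc n"
  shows "(-1) ^ (n * (s + Suc n)) * f (rotate (s + Suc n) w) = (-1) ^ (n * s) * (f (rotate s w) :: 'k::comm_ring_1)"
proof -
  have "rotate (s + Suc n) w = rotate s w"
    using assms rotate_id[of "Suc n" w] by (simp only: rotate_rotate[symmetric]) (simp add: rotate_id)
  moreover have "(-1) ^ (n * (s + Suc n)) = ((-1) ^ (n * s) :: 'k)"
    by (rule sign_even) (auto simp: algebra_simps)
  ultimately show ?thesis by simp
qed

text \<open>By periodicity the range of summation may be shifted; for \<open>a = 1\<close> the sum is seen to
  be cyclic with sign \<open>(-1)\<^sup>n\<close>.\<close>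

lemma rot_sum_rotate:
  assumes "length w = Suc n"
  shows "rot_sum n f (rotate a w) = (-1) ^ (n * a) * rot_sum n f w"
proof -
  let ?g = "\<lambda>s. (-1) ^ (n * s) * f (rotate s w)"
  have "rot_sum n f w = (\<Sum>s = 0..n. ?g (s + a))"
    unfolding rot_sum_def
    by (rule sum_periodic_shift[of ?g, symmetric]) (rule rot_term_periodic[OF assms])
  also have "\<dots> = (-1) ^ (n * a) * rot_sum n f (rotate a w)"
    by (simp add: rot_sum_def rotate_rotate power_add algebra_simps sum_distrib_left)
  finally show ?thesis by (simp flip: mult.assoc power_mult_distrib)
qed

text \<open>Reversal turns the rotation by \<open>s\<close> into that by \<open>n + 1 - s\<close>, and both
  carry the same sign.\<close>

lemma rot_sum_rev:
  fixes f :: "'a list \<Rightarrow> 'k::comm_ring_1"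
  assumes w: "length w = Suc n"
  shows "(\<Sum>s = 0..n. (-1) ^ (n * s) * f (rev (rotate s w))) = rot_sum n f (rev w)"
proof -
  let ?g = "\<lambda>s. (-1) ^ (n * s) * f (rotate s (rev w))"
  have "(-1) ^ (n * s) * f (rev (rotate s w)) = ?g (Suc n - s)" if "s \<le> n" for s
  proof -
    have "rev (rotate s w) = rotate (Suc n - s) (rev w)"
    proof -
      have "rotate s (rev (rev w)) = rev (rotate (Suc n - s) (rev w))"
        using rotate_rev[of s "rev w"] w that by simp
      then show ?thesis by (metis rev_rev_ident)
    qed
    moreover have "(-1) ^ (n * s) = ((-1) ^ (n * (Suc n - s)) :: 'k)"
    proof (rule sign_even)
      have "n * s + n * (Suc n - s) = n * Suc n" using that by (simp flip: distrib_left)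
      then show "even (n * s + n * (Suc n - s))" by simp
    qed
    ultimately show ?thesis by simp
  qed
  then have "(\<Sum>s = 0..n. (-1) ^ (n * s) * f (rev (rotate s w))) = (\<Sum>s = 0..n. ?g (Suc n - s))"
    by simp
  also have "\<dots> = (\<Sum>s = 0..n. ?g (s + 1))"
    by (rule sum.reindex_bij_witness[of _ "\<lambda>s. n - s" "\<lambda>s. n - s"]) (auto simp: Suc_diff_le)
  also have "\<dots> = rot_sum n f (rev w)"
    unfolding rot_sum_def by (rule sum_periodic_shift) (rule rot_term_periodic, simp add: w)
  finally show ?thesis .
qed

lemma rot_sum_add:
  assumes "\<And>s. h (rotate s w) = f (rotate s w) + g (rotate s w)" shows "rot_sum n h w = rot_sum n f w + rot_sum n g w"
  using assms by (simp add: rot_sum_def ring_distribs sum.distrib)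

lemma rot_sum_scale:
  assumes "\<And>s. h (rotate s w) = k * f (rotate s w)" shows "rot_sum n h w = k * rot_sum n f w"
  using assms by (simp add: rot_sum_def sum_distrib_left mult.left_commute)

section \<open>Linear and multilinear maps\<close>

definition linear_on ::
  "('k \<Rightarrow> 'a \<Rightarrow> 'a) \<Rightarrow> 'a set \<Rightarrow> ('k \<Rightarrow> 'b \<Rightarrow> 'b) \<Rightarrow> ('a::ab_group_add \<Rightarrow> 'b::ab_group_add) \<Rightarrow> bool"
  where
  "linear_on s S s' f \<longleftrightarrow>
     (\<forall>x\<in>S. \<forall>y\<in>S. f (x + y) = f x + f y) \<and> (\<forall>c. \<forall>x\<in>S. f (s c x) = s' c (f x))"

text \<open>The arguments other than the varying one are given as a prefix and a suffix, which suits
  recursion on words better than updating an entry.\<close>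

definition multilinear_on ::
  "('k \<Rightarrow> 'a \<Rightarrow> 'a) \<Rightarrow> 'a set \<Rightarrow> nat \<Rightarrow> ('k \<Rightarrow> 'b \<Rightarrow> 'b) \<Rightarrow>
     ('a::ab_group_add list \<Rightarrow> 'b::ab_group_add) \<Rightarrow> bool" where
  "multilinear_on s S n s' f \<longleftrightarrow>
     (\<forall>us vs. set us \<subseteq> S \<longrightarrow> set vs \<subseteq> S \<longrightarrow> Suc (length us + length vs) = n \<longrightarrow>
        linear_on s S s' (\<lambda>x. f (us @ x # vs)))"

lemma multilinear_onD:
  "multilinear_on s S n s' f \<Longrightarrow> set us \<subseteq> S \<Longrightarrow> set vs \<subseteq> S \<Longrightarrow> Suc (length us + length vs) = n
    \<Longrightarrow> linear_on s S s' (\<lambda>x. f (us @ x # vs))"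
  by (auto simp: multilinear_on_def)

lemma linear_on_add: "linear_on s S s' f \<Longrightarrow> x \<in> S \<Longrightarrow> y \<in> S \<Longrightarrow> f (x + y) = f x + f y"
  and linear_on_scale: "linear_on s S s' f \<Longrightarrow> x \<in> S \<Longrightarrow> f (s c x) = s' c (f x)"
  by (auto simp: linear_on_def)

lemma multilinear_on_Cons:
  assumes "multilinear_on s S (Suc n) s' f"
  shows "xs \<in> words S n \<Longrightarrow> linear_on s S s' (\<lambda>x. f (x # xs))"
    and "x \<in> S \<Longrightarrow> multilinear_on s S n s' (\<lambda>xs. f (x # xs))"
proof -
  show "xs \<in> words S n \<Longrightarrow> linear_on s S s' (\<lambda>x. f (x # xs))"
    using multilinear_onD[OF assms, of "[]" xs] by (simp add: words_def)
  assume x: "x \<in> S"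
  show "multilinear_on s S n s' (\<lambda>xs. f (x # xs))"
    unfolding multilinear_on_def
  proof (intro allI impI)
    fix us vs assume "set us \<subseteq> S" "set vs \<subseteq> S" "Suc (length us + length vs) = n"
    with multilinear_onD[OF assms, of "x # us" vs] x
    show "linear_on s S s' (\<lambda>y. f (x # us @ y # vs))" by simp
  qed
qed

lemma multilin_maps_iff:
  "f \<in> multilin_maps s S n s' S' \<longleftrightarrow>
     (\<forall>xs\<in>words S n. f xs \<in> S') \<and> multilinear_on s S n s' f \<and> (\<forall>xs. xs \<notin> words S n \<longrightarrow> f xs = 0)"
proof -
  let ?A = "\<forall>xs\<in>words S n. \<forall>i<n. \<forall>x\<in>S. \<forall>y\<in>S. f (xs[i := x + y]) = f (xs[i := x]) + f (xs[i := y])"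
  let ?B = "\<forall>xs\<in>words S n. \<forall>i<n. \<forall>c. \<forall>x\<in>S. f (xs[i := s c x]) = s' c (f (xs[i := x]))"
  have "multilinear_on s S n s' f \<longleftrightarrow> ?A \<and> ?B"
  proof
    assume f: "multilinear_on s S n s' f"
    have lin: "linear_on s S s' (\<lambda>x. f (xs[i := x]))" if "xs \<in> words S n" "i < n" for xs i
    proof -
      have "linear_on s S s' (\<lambda>x. f (take i xs @ x # drop (Suc i) xs))"
        using that by (intro multilinear_onD[OF f])
          (auto simp: words_def dest: in_set_takeD in_set_dropD)
      then show ?thesis using that by (simp add: upd_conv_take_nth_drop words_def)
    qed
    show "?A \<and> ?B" using lin by (simp add: linear_on_def)
  next
    assume AB: "?A \<and> ?B"
    show "multilinear_on s S n s' f"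
      unfolding multilinear_on_def linear_on_def
    proof (intro allI impI conjI ballI)
      fix us vs x y assume h: "set us \<subseteq> S" "set vs \<subseteq> S" "Suc (length us + length vs) = n"
        and x: "x \<in> S"
      have w: "us @ x # vs \<in> words S n" "length us < n" using h x by (auto simp: words_def)
      show "f (us @ (x + y) # vs) = f (us @ x # vs) + f (us @ y # vs)" if "y \<in> S"
        using AB[THEN conjunct1, rule_format, OF w x that] by simp
      show "f (us @ s c x # vs) = s' c (f (us @ x # vs))" for c
        using AB[THEN conjunct2, rule_format, OF w x] by simp
    qed
  qed
  then show ?thesis unfolding multilin_maps_def by auto
qed

lemma lin_maps_iff:
  "f \<in> lin_maps s S s' S' \<longleftrightarrow>
     (\<forall>x\<in>S. f x \<in> S') \<and> linear_on s S s' f \<and> (\<forall>x. x \<notin> S \<longrightarrow> f x = 0)"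
  by (auto simp: lin_maps_def linear_on_def)

lemma linear_on_sum_scale:
  assumes "vector_space s" "vector_space s'" "linear_on s S s' f" "module.subspace s S"
    and "\<And>i. i \<in> I \<Longrightarrow> e i \<in> S"
  shows "f (\<Sum>i\<in>I. s (k i) (e i)) = (\<Sum>i\<in>I. s' (k i) (f (e i)))"
proof -
  interpret s: vector_space s by fact
  interpret s': vector_space s' by fact
  have f0: "f 0 = 0"
    using linear_on_add[OF assms(3), of 0 0] s.subspace_0[OF assms(4)] by simp
  show ?thesis using assms(5)
  proof (induction I rule: infinite_finite_induct)
    case (insert i I)
    have "(\<Sum>i\<in>I. s (k i) (e i)) \<in> S"
      using insert.prems by (intro s.subspace_sum[OF assms(4)] s.subspace_scale[OF assms(4)]) auto
    with insert show ?case
      by (simp add: linear_on_add[OF assms(3)] linear_on_scale[OF assms(3)] s.subspace_scale[OF assms(4)])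
  qed (simp_all add: f0)
qed

lemma vector_space_pointwise:
  assumes "vector_space s" shows "vector_space (pointwise s)"
proof -
  interpret vector_space s by fact
  show ?thesis
    by unfold_locales (auto simp: pointwise_def fun_eq_iff scale_right_distrib scale_left_distrib)
qed

lemma vector_space_mult: "vector_space ((*) :: 'k::field \<Rightarrow> 'k \<Rightarrow> 'k)"
  by unfold_locales (auto simp: algebra_simps)

lemma sum_fun_apply: "(\<Sum>i\<in>A. f i) x = (\<Sum>i\<in>A. f i x)"
  by (induction A rule: infinite_finite_induct) auto

lemma lin_maps_subspace:
  assumes "vector_space s'" "module.subspace s' S'"
  shows "module.subspace (pointwise s') (lin_maps s S s' S')"
proof -
  interpret s': vector_space s' by fact
  interpret f: vector_space "pointwise s'" by (rule vector_space_pointwise) fact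
  note sb = s'.subspace_add[OF assms(2)] s'.subspace_scale[OF assms(2)] s'.subspace_0[OF assms(2)]
  show ?thesis unfolding f.subspace_def
    by (auto simp: lin_maps_def pointwise_def sb s'.scale_right_distrib mult.commute)
qed

lemma linear_on_id: "linear_on s S s id"
  by (simp add: linear_on_def)

lemma linear_on_subset: "linear_on s S s' f \<Longrightarrow> S' \<subseteq> S \<Longrightarrow> linear_on s S' s' f"
  unfolding linear_on_def by blast

lemma linear_on_comp:
  "linear_on s S s' f \<Longrightarrow> linear_on s' S' s'' g \<Longrightarrow> (\<And>x. x \<in> S \<Longrightarrow> f x \<in> S') \<Longrightarrow>
    linear_on s S s'' (\<lambda>x. g (f x))"
  by (simp add: linear_on_def)

lemma multilinear_on_comp:
  assumes "multilinear_on s S n s' f" "linear_on s' S' s'' g" "\<And>xs. xs \<in> words S n \<Longrightarrow> f xs \<in> S'"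
  shows "multilinear_on s S n s'' (\<lambda>xs. g (f xs))"
  using assms(1,3) unfolding multilinear_on_def
  by (auto intro!: linear_on_comp[OF _ assms(2)] simp: words_def)

text \<open>The varying argument lies in exactly one of the two factors.\<close>

lemma multilinear_on_product:
  assumes f: "multilinear_on s S m s1 f" and g: "multilinear_on s S n s2 g"
    and l: "\<And>b. linear_on s1 UNIV s' (\<lambda>a. \<beta> a b)" and r: "\<And>a. linear_on s2 UNIV s' (\<beta> a)"
  shows "multilinear_on s S (m + n) s' (\<lambda>xs. \<beta> (f (take m xs)) (g (drop m xs)))"
  unfolding multilinear_on_def
proof (intro allI impI)
  fix us vs assume h: "set us \<subseteq> S" "set vs \<subseteq> S" "Suc (length us + length vs) = m + n"
  show "linear_on s S s' (\<lambda>x. \<beta> (f (take m (us @ x # vs))) (g (drop m (us @ x # vs))))"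
  proof (cases "length us < m")
    case True
    then obtain k where k: "m = length us + Suc k" using less_iff_Suc_add by (metis add_Suc_right)
    have "linear_on s S s1 (\<lambda>x. f (us @ x # take k vs))"
      using h k by (intro multilinear_onD[OF f]) (auto dest: in_set_takeD)
    from linear_on_comp[OF this l[of "g (drop k vs)"]] show ?thesis
      using k by simp
  next
    case False
    have "linear_on s S s2 (\<lambda>x. g (drop m us @ x # vs))"
      using h False by (intro multilinear_onD[OF g]) (auto dest: in_set_dropD)
    from linear_on_comp[OF this r[of "f (take m us)"]] show ?thesis
      using False by simp
  qed
qed

lemma multilinear_on_rev:
  "multilinear_on s S n s' f \<Longrightarrow> multilinear_on s S n s' (\<lambda>xs. f (rev xs))"
  unfolding multilinear_on_def by simp

lemma multilinear_on_word_prod: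
  fixes c :: "'i \<Rightarrow> 'a::ab_group_add \<Rightarrow> 'k::comm_ring_1"
  assumes "\<And>i. i \<in> set is \<Longrightarrow> linear_on s S (*) (c i)"
  shows "multilinear_on s S (length is) (*) (word_prod c is)"
  unfolding multilinear_on_def
proof (intro allI impI)
  fix us vs :: "'a list" assume h: "Suc (length us + length vs) = length is"
  have eq: "is = take (length us) is @ is ! length us # drop (Suc (length us)) is"
    using h by (intro id_take_nth_drop) auto
  have "word_prod c is (us @ x # vs) = word_prod c (take (length us) is) us *
      (c (is ! length us) x * word_prod c (drop (Suc (length us)) is) vs)" for x
    using h by (subst eq, subst word_prod_append) auto
  moreover have "linear_on s S (*) (c (is ! length us))"
    using h by (intro assms nth_mem) simp
  ultimately show "linear_on s S (*) (\<lambda>x. word_prod c is (us @ x # vs))"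
    by (simp add: linear_on_def algebra_simps)
qed

lemma multilinear_on_sum:
  assumes "vector_space s'" "\<And>i. i \<in> J \<Longrightarrow> multilinear_on s S n s' (f i)"
  shows "multilinear_on s S n s' (\<lambda>xs. \<Sum>i\<in>J. f i xs)"
proof -
  interpret s': vector_space s' by fact
  show ?thesis using assms(2)
    by (simp add: multilinear_on_def linear_on_def sum.distrib s'.scale_sum_right)
qed

lemma multilinear_on_scale_left:
  assumes "vector_space s'" "multilinear_on s S n (*) (f :: _ \<Rightarrow> 'k::field)"
  shows "multilinear_on s S n s' (\<lambda>xs. s' (k * f xs) v)"
proof -
  interpret s': vector_space s' by fact
  show ?thesis using assms(2)
    by (simp add: multilinear_on_def linear_on_def s'.scale_left_distrib algebra_simps)
qed

section \<open>Coordinates on tensor powers\<close>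

lemma tensor_append_in:
  assumes T: "T \<in> tensor_power s S m" and U: "U \<in> tensor_power s S n"
  shows "tensor_append m T U \<in> tensor_power s S (m + n)"
  unfolding tensor_power_def multilin_maps_iff
proof (intro conjI ballI allI impI)
  show "multilinear_on (pointwise (*)) (dual s S) (m + n) (*) (tensor_append m T U)"
    unfolding tensor_append_def
    by (rule multilinear_on_product[where \<beta> = "(*)"])
      (use T U in \<open>auto simp: tensor_power_def multilin_maps_iff linear_on_def algebra_simps\<close>)
  fix \<phi>s assume "\<phi>s \<notin> words (dual s S) (m + n)"
  then have "take m \<phi>s \<notin> words (dual s S) m \<or> drop m \<phi>s \<notin> words (dual s S) n"
    using words_append[of "take m \<phi>s" _ m "drop m \<phi>s" n] by auto
  then show "tensor_append m T U \<phi>s = 0"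
    using T U by (auto simp: tensor_append_def tensor_power_def multilin_maps_iff)
qed simp

text \<open>A subspace with a finite basis \<open>e\<close> and its coordinate functions \<open>c\<close>. The
  instances are \<open>V\<close>, the space \<open>End(V)\<close> with the elementary matrices, and
  the dual spaces of both.\<close>

locale coord_space = vector_space s
  for s :: "'k::field \<Rightarrow> 'a::ab_group_add \<Rightarrow> 'a" +
  fixes S :: "'a set" and I :: "'i set" and e :: "'i \<Rightarrow> 'a" and c :: "'i \<Rightarrow> 'a \<Rightarrow> 'k"
  assumes fin: "finite I"
    and sub: "subspace S"
    and e_in: "i \<in> I \<Longrightarrow> e i \<in> S"
    and c_lin: "i \<in> I \<Longrightarrow> linear_on s S (*) (c i)"
    and c_e: "i \<in> I \<Longrightarrow> j \<in> I \<Longrightarrow> c i (e j) = of_bool (i = j)"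
    and expand: "x \<in> S \<Longrightarrow> x = (\<Sum>i\<in>I. s (c i x) (e i))"
begin

lemma map_e_words: "is \<in> words I n \<Longrightarrow> map e is \<in> words S n"
  by (rule words_map) (auto simp: e_in)

lemma multilinear_expand:
  assumes s': "vector_space s'" and f: "multilinear_on s S n s' f" and xs: "xs \<in> words S n"
  shows "f xs = (\<Sum>is\<in>words I n. s' (word_prod c is xs) (f (map e is)))"
  using f xs
proof (induction n arbitrary: f xs)
  case 0
  interpret s': vector_space s' by fact
  from 0 show ?case by simp
next
  case (Suc n)
  interpret s': vector_space s' by fact
  from Suc.prems obtain x xs' where xs: "xs = x # xs'" "x \<in> S" "xs' \<in> words S n"
    by (cases xs) (auto simp: words_def)
  have "f xs = f ((\<Sum>i\<in>I. s (c i x) (e i)) # xs')"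
    using expand[OF xs(2)] xs(1) by simp
  also have "\<dots> = (\<Sum>i\<in>I. s' (c i x) (f (e i # xs')))"
    by (rule linear_on_sum_scale[OF vector_space_axioms s' multilinear_on_Cons(1)[OF Suc.prems(1) xs(3)] sub e_in])
  also have "\<dots> = (\<Sum>i\<in>I. s' (c i x) (\<Sum>is\<in>words I n. s' (word_prod c is xs') (f (e i # map e is))))"
    by (intro sum.cong refl arg_cong2[of _ _ _ _ s'] Suc.IH multilinear_on_Cons(2)[OF Suc.prems(1)] e_in xs(3))
  finally show ?case
    by (simp add: sum_words_Suc xs(1) s'.scale_sum_right)
qed

lemma multilinear_eqI:
  assumes "vector_space s'" "multilinear_on s S n s' f" "multilinear_on s S n s' g"
    and "\<And>is. is \<in> words I n \<Longrightarrow> f (map e is) = g (map e is)" and "xs \<in> words S n"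
  shows "f xs = g xs"
  using multilinear_expand[OF assms(1,2,5)] multilinear_expand[OF assms(1,3,5)] assms(4)
  by simp

definition dual_basis :: "'i \<Rightarrow> 'a \<Rightarrow> 'k" where
  "dual_basis i = (\<lambda>x. if x \<in> S then c i x else 0)"

lemma dual_basis_in: "i \<in> I \<Longrightarrow> dual_basis i \<in> dual s S"
  using c_lin[of i] subspace_add[OF sub] subspace_scale[OF sub]
  by (auto simp: dual_def lin_maps_iff linear_on_def dual_basis_def)

text \<open>The coordinates of a form are its values on the basis. Tensors are multilinear forms on the dual,
  so this turns \<open>multilinear_expand\<close> into an expansion of tensors.\<close>

lemma dual_coord_space: "coord_space (pointwise (*)) (dual s S) I dual_basis (\<lambda>i \<phi>. \<phi> (e i))"
proof -
  interpret f: vector_space "pointwise (*) :: 'k \<Rightarrow> ('a \<Rightarrow> 'k) \<Rightarrow> _"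
    by (rule vector_space_pointwise[OF vector_space_mult])
  have sb: "f.subspace (dual s S)"
    unfolding f.subspace_def
    by (auto simp: dual_def lin_maps_def pointwise_def algebra_simps)
  show ?thesis
  proof unfold_locales
    fix \<phi> assume phi: "\<phi> \<in> dual s S"
    then have lin: "linear_on s S (*) \<phi>" and out: "\<And>x. x \<notin> S \<Longrightarrow> \<phi> x = 0"
      by (auto simp: dual_def lin_maps_iff)
    show "\<phi> = (\<Sum>i\<in>I. pointwise (*) (\<phi> (e i)) (dual_basis i))"
    proof
      fix x
      show "\<phi> x = (\<Sum>i\<in>I. pointwise (*) (\<phi> (e i)) (dual_basis i)) x"
      proof (cases "x \<in> S")
        case True
        have "\<phi> x = \<phi> (\<Sum>i\<in>I. s (c i x) (e i))" using expand[OF True] by simp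
        also have "\<dots> = (\<Sum>i\<in>I. c i x * \<phi> (e i))"
          by (rule linear_on_sum_scale[OF vector_space_axioms vector_space_mult lin sub e_in])
        finally show ?thesis using True
          by (simp add: sum_fun_apply pointwise_def dual_basis_def mult.commute)
      qed (simp add: out sum_fun_apply pointwise_def dual_basis_def)
    qed
  qed (use dual_basis_in in \<open>auto simp: fin sb linear_on_def pointwise_def dual_basis_def e_in c_e\<close>)
qed

lemma tensor_power_iff:
  "T \<in> tensor_power s S n \<longleftrightarrow>
     multilinear_on (pointwise (*)) (dual s S) n (*) T \<and> (\<forall>\<phi>s. \<phi>s \<notin> words (dual s S) n \<longrightarrow> T \<phi>s = 0)"
  by (simp add: tensor_power_def multilin_maps_iff)

lemma tensor_expand:
  assumes "T \<in> tensor_power s S n" "\<phi>s \<in> words (dual s S) n"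
  shows "T \<phi>s = (\<Sum>is\<in>words I n. word_prod (\<lambda>i \<phi>. \<phi> (e i)) is \<phi>s * T (map dual_basis is))"
proof -
  interpret D: coord_space "pointwise (*)" "dual s S" I dual_basis "\<lambda>i \<phi>. \<phi> (e i)"
    by (rule dual_coord_space)
  show ?thesis
    using D.multilinear_expand[OF vector_space_mult _ assms(2)] assms(1) by (auto simp: tensor_power_iff)
qed

lemma tensor_eqI:
  assumes "T \<in> tensor_power s S n" "U \<in> tensor_power s S n"
    and "\<And>is. is \<in> words I n \<Longrightarrow> T (map dual_basis is) = U (map dual_basis is)"
  shows "T = U"
proof
  fix \<phi>s show "T \<phi>s = U \<phi>s"
    using tensor_expand[OF assms(1), of \<phi>s] tensor_expand[OF assms(2), of \<phi>s] assms
    by (cases "\<phi>s \<in> words (dual s S) n") (auto simp: tensor_power_iff)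
qed

lemma pure_tensor_eq:
  "pure_tensor s S as \<phi>s =
     (if \<phi>s \<in> words (dual s S) (length as) then word_prod (\<lambda>\<phi> a. \<phi> a) \<phi>s as else 0)"
  using word_prod_nth[of \<phi>s "length as" as "\<lambda>\<phi> a. \<phi> a"] by (auto simp: pure_tensor_def words_def)

lemma pure_tensor_dual_basis:
  assumes "is \<in> words I n" "as \<in> words S n"
  shows "pure_tensor s S as (map dual_basis is) = word_prod c is as"
proof -
  have "map dual_basis is \<in> words (dual s S) n"
    using assms(1) by (rule words_map) (rule dual_basis_in)
  moreover have "word_prod (\<lambda>\<phi> a. \<phi> a) (map dual_basis is) (map id as) = word_prod c is as"
    unfolding word_prod_map using assms
    by (intro word_prod_cong) (auto simp: dual_basis_def words_def)
  ultimately show ?thesis using assms by (simp add: pure_tensor_eq words_def)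
qed

lemma pure_tensor_in: "length as = n \<Longrightarrow> pure_tensor s S as \<in> tensor_power s S n"
  unfolding tensor_power_iff multilinear_on_def linear_on_def
proof (intro conjI allI impI ballI)
  interpret D: coord_space "pointwise (*)" "dual s S" I dual_basis "\<lambda>i \<phi>. \<phi> (e i)"
    by (rule dual_coord_space)
  fix us vs :: "('a \<Rightarrow> 'k) list" and x y and k :: 'k
  assume as: "length as = n" and h: "set us \<subseteq> dual s S" "set vs \<subseteq> dual s S"
    "Suc (length us + length vs) = n" and x: "x \<in> dual s S"
  define as1 a as2 where "as1 = take (length us) as" and "a = as ! length us"
    and "as2 = drop (Suc (length us)) as"
  have as_eq: "as = as1 @ a # as2" "length as1 = length us"
    using h as by (auto simp: as1_def a_def as2_def id_take_nth_drop)
  have eq: "pure_tensor s S as (us @ z # vs)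
      = word_prod (\<lambda>\<phi> a. \<phi> a) us as1 * (z a * word_prod (\<lambda>\<phi> a. \<phi> a) vs as2)" if "z \<in> dual s S" for z
    using that h as as_eq by (auto simp: pure_tensor_eq words_def word_prod_append)
  show "pure_tensor s S as (us @ (x + y) # vs)
      = pure_tensor s S as (us @ x # vs) + pure_tensor s S as (us @ y # vs)" if "y \<in> dual s S"
    using x that D.subspace_add[OF D.sub x that] by (simp add: eq algebra_simps)
  show "pure_tensor s S as (us @ pointwise (*) k x # vs) = k * pure_tensor s S as (us @ x # vs)"
    using x D.subspace_scale[OF D.sub x] by (simp add: eq algebra_simps pointwise_def)
qed (simp add: pure_tensor_def)

lemma tensor_power_subspace: "module.subspace tscale (tensor_power s S n)"
proof -
  interpret T: vector_space "tscale :: 'k \<Rightarrow> ('a, 'k) tensor \<Rightarrow> _"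
    by (rule vector_space_pointwise[OF vector_space_mult])
  show ?thesis
    unfolding T.subspace_def
    by (auto simp: tensor_power_iff multilinear_on_def linear_on_def pointwise_def algebra_simps)
qed

lemma tensor_expand_pure:
  assumes T: "T \<in> tensor_power s S n"
  shows "T = (\<Sum>is\<in>words I n. tscale (T (map dual_basis is)) (pure_tensor s S (map e is)))"
proof -
  interpret T: vector_space "tscale :: 'k \<Rightarrow> ('a, 'k) tensor \<Rightarrow> _"
    by (rule vector_space_pointwise[OF vector_space_mult])
  show ?thesis
  proof (rule tensor_eqI[OF T])
    show "(\<Sum>is\<in>words I n. tscale (T (map dual_basis is)) (pure_tensor s S (map e is))) \<in> tensor_power s S n"
      by (intro T.subspace_sum[OF tensor_power_subspace] T.subspace_scale[OF tensor_power_subspace]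
          pure_tensor_in) (simp add: words_def)
    fix js assume js: "js \<in> words I n"
    have "pure_tensor s S (map e is) (map dual_basis js) = of_bool (js = is)"
      if "is \<in> words I n" for "is"
      using that js word_prod_delta[OF js that, of "\<lambda>i j. c i (e j)" id] 
      by (simp add: pure_tensor_dual_basis map_e_words c_e word_prod_map[of c id, simplified])
    then show "T (map dual_basis js) =
        (\<Sum>is\<in>words I n. tscale (T (map dual_basis is)) (pure_tensor s S (map e is))) (map dual_basis js)"
      using js sum_words_delta(2)[OF fin js, of "\<lambda>is. T (map dual_basis is)"]
      by (simp add: sum_fun_apply pointwise_def mult.commute)
  qed
qed

text \<open>The sum is linear in \<open>T\<close> and takes the value \<open>f as\<close> on pure tensors,
  whose coordinates are the products in \<open>multilinear_expand\<close>; it is the only such map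
  because the pure tensors of basis vectors span. This formula replaces the definite description in
  all later arguments.\<close>

lemma tensor_lift_eq:
  fixes s' :: "'k \<Rightarrow> 'b::ab_group_add \<Rightarrow> 'b"
  assumes s': "vector_space s'" and f: "multilinear_on s S n s' f"
  shows "tensor_lift s S n s' f =
    (\<lambda>T. if T \<in> tensor_power s S n then \<Sum>is\<in>words I n. s' (T (map dual_basis is)) (f (map e is)) else 0)"
    (is "_ = ?g")
proof -
  interpret s': vector_space s' by fact
  interpret T: vector_space "tscale :: 'k \<Rightarrow> ('a, 'k) tensor \<Rightarrow> _"
    by (rule vector_space_pointwise[OF vector_space_mult])
  note sb = T.subspace_add[OF tensor_power_subspace] T.subspace_scale[OF tensor_power_subspace]
  show ?thesis unfolding tensor_lift_def
  proof (rule the_equality)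
    show "?g \<in> lin_maps tscale (tensor_power s S n) s' UNIV \<and>
      (\<forall>as\<in>words S n. ?g (pure_tensor s S as) = f as)"
    proof
      show "?g \<in> lin_maps tscale (tensor_power s S n) s' UNIV"
        by (auto simp: lin_maps_def sb[unfolded pointwise_def] pointwise_def s'.scale_left_distrib sum.distrib s'.scale_sum_right)
      show "\<forall>as\<in>words S n. ?g (pure_tensor s S as) = f as"
        using multilinear_expand[OF s' f]
        by (auto simp: pure_tensor_in words_length pure_tensor_dual_basis)
    qed
    fix g assume g: "g \<in> lin_maps tscale (tensor_power s S n) s' UNIV \<and>
      (\<forall>as\<in>words S n. g (pure_tensor s S as) = f as)"
    show "g = ?g"
    proof
      fix T show "g T = ?g T"
      proof (cases "T \<in> tensor_power s S n")
        case True
        have "g T = g (\<Sum>is\<in>words I n. tscale (T (map dual_basis is)) (pure_tensor s S (map e is)))"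
          using tensor_expand_pure[OF True] by simp
        also have "\<dots> = (\<Sum>is\<in>words I n. s' (T (map dual_basis is)) (g (pure_tensor s S (map e is))))"
          using g by (intro linear_on_sum_scale[OF T.vector_space_axioms s' _ tensor_power_subspace])
            (auto simp: lin_maps_iff words_def intro!: pure_tensor_in)
        also have "\<dots> = ?g T" using True g by (auto intro!: sum.cong simp: map_e_words)
        finally show ?thesis .
      qed (use g in \<open>auto simp: lin_maps_iff\<close>)
    qed
  qed
qed

lemma pure_tensor_multilinear: "multilinear_on s S n tscale (pure_tensor s S)"
  unfolding multilinear_on_def
proof (intro allI impI)
  fix us vs assume h: "set us \<subseteq> S" "set vs \<subseteq> S" "Suc (length us + length vs) = n"
  show "linear_on s S tscale (\<lambda>x. pure_tensor s S (us @ x # vs))"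
  proof -
    have eq: "pure_tensor s S (us @ x # vs) \<phi>s =
      (if \<phi>s \<in> words (dual s S) n
       then word_prod (\<lambda>\<phi> a. \<phi> a) (take (length us) \<phi>s) us * ((\<phi>s ! length us) x *
              word_prod (\<lambda>\<phi> a. \<phi> a) (drop (Suc (length us)) \<phi>s) vs) else 0)" for x \<phi>s
    proof (cases "\<phi>s \<in> words (dual s S) n")
      case True
      then have "\<phi>s = take (length us) \<phi>s @ \<phi>s ! length us # drop (Suc (length us)) \<phi>s"
        using h by (intro id_take_nth_drop) (auto simp: words_def)
      then have "word_prod (\<lambda>\<phi> a. \<phi> a) \<phi>s (us @ x # vs) =
        word_prod (\<lambda>\<phi> a. \<phi> a) (take (length us) \<phi>s @ \<phi>s ! length us # drop (Suc (length us)) \<phi>s) (us @ x # vs)"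
        by simp
      also have "\<dots> = word_prod (\<lambda>\<phi> a. \<phi> a) (take (length us) \<phi>s) us * ((\<phi>s ! length us) x *
              word_prod (\<lambda>\<phi> a. \<phi> a) (drop (Suc (length us)) \<phi>s) vs)"
        using True h by (subst word_prod_append) (auto simp: words_def)
      finally show ?thesis using True h by (auto simp: pure_tensor_eq)
    qed (use h in \<open>simp add: pure_tensor_eq\<close>)
    have lin: "linear_on s S (*) (\<phi>s ! length us)" if "\<phi>s \<in> words (dual s S) n" for \<phi>s
    proof -
      have "\<phi>s ! length us \<in> set \<phi>s" using that h by (auto simp: words_def)
      then show ?thesis using that by (auto simp: words_def dual_def lin_maps_iff)
    qed
    show ?thesis unfolding linear_on_def
      by (auto simp: fun_eq_iff pointwise_def eq linear_on_add[OF lin] linear_on_scale[OF lin] algebra_simps)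
  qed
qed

lemma tensor_lift_pure:
  assumes "vector_space s'" "multilinear_on s S n s' f" "as \<in> words S n"
  shows "tensor_lift s S n s' f (pure_tensor s S as) = f as"
  using assms multilinear_expand[OF assms]
  by (auto simp: tensor_lift_eq pure_tensor_in words_length pure_tensor_dual_basis)

lemma tensor_lift_in:
  assumes s': "vector_space s'" and f: "multilinear_on s S n s' f"
    and S': "module.subspace s' S'" "\<And>as. as \<in> words S n \<Longrightarrow> f as \<in> S'"
  shows "tensor_lift s S n s' f \<in> lin_maps tscale (tensor_power s S n) s' S'"
proof -
  interpret s': vector_space s' by fact
  interpret T: vector_space "tscale :: 'k \<Rightarrow> ('a, 'k) tensor \<Rightarrow> _"
    by (rule vector_space_pointwise[OF vector_space_mult])
  note sb = T.subspace_add[OF tensor_power_subspace] T.subspace_scale[OF tensor_power_subspace]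
  show ?thesis
    unfolding tensor_lift_eq[OF s' f]
    by (auto simp: lin_maps_def sb[unfolded pointwise_def] pointwise_def s'.scale_left_distrib
        sum.distrib s'.scale_sum_right
        intro!: s'.subspace_sum[OF S'(1)] s'.subspace_scale[OF S'(1)] S'(2) map_e_words)
qed

lemma tensor_lin_expand:
  assumes s': "vector_space s'" and P: "linear_on tscale (tensor_power s S n) s' P"
    and T: "T \<in> tensor_power s S n"
  shows "P T = (\<Sum>is\<in>words I n. s' (T (map dual_basis is)) (P (pure_tensor s S (map e is))))"
proof -
  interpret T: vector_space "tscale :: 'k \<Rightarrow> ('a, 'k) tensor \<Rightarrow> _"
    by (rule vector_space_pointwise[OF vector_space_mult])
  have "P T = P (\<Sum>is\<in>words I n. tscale (T (map dual_basis is)) (pure_tensor s S (map e is)))"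
    using tensor_expand_pure[OF T] by simp
  also have "\<dots> = (\<Sum>is\<in>words I n. s' (T (map dual_basis is)) (P (pure_tensor s S (map e is))))"
    by (intro linear_on_sum_scale[OF T.vector_space_axioms s' P tensor_power_subspace])
      (auto simp: words_def intro!: pure_tensor_in)
  finally show ?thesis .
qed

end

section \<open>Matrix coordinates on a finite-dimensional space\<close>

locale fd_space = finite_dimensional_vector_space scale B
  for scale :: "'k::field \<Rightarrow> 'v::ab_group_add \<Rightarrow> 'v" and B
begin

abbreviation ends :: "nat \<Rightarrow> ('v \<Rightarrow> 'v) list set" where
  "ends \<equiv> words (End scale)"

abbreviation idx :: "nat \<Rightarrow> ('v \<times> 'v) list set" where
  "idx \<equiv> words (B \<times> B)"

abbreviation \<Psi> :: "nat \<Rightarrow> ('v, 'k) tensor_op \<Rightarrow> 'v cochain" where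
  "\<Psi> \<equiv> Psi scale B"

definition crd :: "'v \<Rightarrow> 'v \<Rightarrow> 'k" where
  "crd b v = representation B v b"

lemma crd_add: "crd b (x + y) = crd b x + crd b y"
  by (simp add: crd_def representation_add independent_Basis span_Basis)

lemma crd_scale: "crd b (scale k x) = k * crd b x"
  by (simp add: crd_def representation_scale independent_Basis span_Basis)

lemma crd_basis: "b \<in> B \<Longrightarrow> crd a b = of_bool (a = b)"
  by (simp add: crd_def representation_basis independent_Basis)

lemma crd_expand: "x = (\<Sum>b\<in>B. scale (crd b x) b)"
  using sum_representation_eq[OF independent_Basis _ finite_Basis order_refl, of x]
  by (simp add: crd_def span_Basis)

sublocale V: coord_space scale UNIV B id crd
proof unfold_locales
  show "finite B" by (rule finite_Basis)
  show "linear_on scale UNIV (*) (crd i)" for i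
    by (simp add: linear_on_def crd_add crd_scale)
  show "x = (\<Sum>i\<in>B. scale (crd i x) (id i))" for x
    using crd_expand[of x] by simp
qed (auto simp: crd_basis)

lemma crd_sum: "crd b (\<Sum>i\<in>J. f i) = (\<Sum>i\<in>J. crd b (f i))"
  by (simp add: crd_def representation_sum independent_Basis span_Basis)

lemma dual_basis_crd [simp]: "V.dual_basis = crd"
  by (auto simp: V.dual_basis_def fun_eq_iff)

lemma End_iff: "a \<in> End scale \<longleftrightarrow> linear_on scale UNIV scale a"
proof
  assume "a \<in> End scale"
  then interpret Vector_Spaces.linear scale scale a by (simp add: End_def)
  show "linear_on scale UNIV scale a" by (simp add: linear_on_def add scale)
next
  assume "linear_on scale UNIV scale a"
  then show "a \<in> End scale"
    using vector_space_axioms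
    by (simp add: End_def linear_on_def Vector_Spaces.linear_iff)
qed

lemma End_add: "a \<in> End scale \<Longrightarrow> a (x + y) = a x + a y"
  and End_scale: "a \<in> End scale \<Longrightarrow> a (scale k x) = scale k (a x)"
  by (auto simp: End_iff linear_on_def)

lemma End_comp: "a \<in> End scale \<Longrightarrow> b \<in> End scale \<Longrightarrow> a \<circ> b \<in> End scale"
  by (auto simp: End_iff linear_on_def)

lemma vs_End: "vector_space (pointwise scale :: 'k \<Rightarrow> ('v \<Rightarrow> 'v) \<Rightarrow> _)"
  by (rule vector_space_pointwise) (rule vector_space_axioms)

lemma End_subspace: "module.subspace (pointwise scale) (End scale)"
proof -
  interpret f: vector_space "pointwise scale :: 'k \<Rightarrow> ('v \<Rightarrow> 'v) \<Rightarrow> _" by (rule vs_End)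
  show ?thesis unfolding f.subspace_def
    by (auto simp: End_iff linear_on_def pointwise_def scale_right_distrib mult.commute)
qed

text \<open>For \<open>a, b \<in> B\<close> these are the elementary matrix with its entry in row
  \<open>a\<close> and column \<open>b\<close>, and the coordinate function belonging to it.\<close>

definition elem :: "'v \<times> 'v \<Rightarrow> 'v \<Rightarrow> 'v" where
  "elem = (\<lambda>(a, b) v. scale (crd b v) a)"

definition entry :: "'v \<times> 'v \<Rightarrow> ('v \<Rightarrow> 'v) \<Rightarrow> 'k" where
  "entry = (\<lambda>(a, b) x. crd a (x b))"

lemma End_expand:
  assumes x: "x \<in> End scale"
  shows "x = (\<Sum>i\<in>B \<times> B. pointwise scale (entry i x) (elem i))"
proof
  fix v
  have "x v = x (\<Sum>b\<in>B. scale (crd b v) b)"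
    using crd_expand[of v] by simp
  also have "\<dots> = (\<Sum>b\<in>B. scale (crd b v) (x b))"
    using x unfolding End_iff
    by (rule linear_on_sum_scale[OF vector_space_axioms vector_space_axioms _ subspace_UNIV]) simp
  also have "\<dots> = (\<Sum>b\<in>B. scale (crd b v) (\<Sum>a\<in>B. scale (crd a (x b)) a))"
    using crd_expand by simp
  also have "\<dots> = (\<Sum>b\<in>B. \<Sum>a\<in>B. scale (crd a (x b)) (scale (crd b v) a))"
    by (simp add: scale_sum_right mult.commute)
  also have "\<dots> = (\<Sum>i\<in>B \<times> B. pointwise scale (entry i x) (elem i)) v"
    by (subst sum.swap) (simp add: sum_fun_apply pointwise_def entry_def elem_def sum.cartesian_product case_prod_unfold)
  finally show "x v = (\<Sum>i\<in>B \<times> B. pointwise scale (entry i x) (elem i)) v" .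
qed

lemma entry_elem: "i \<in> B \<times> B \<Longrightarrow> j \<in> B \<times> B \<Longrightarrow> entry i (elem j) = of_bool (i = j)"
  by (auto simp: entry_def elem_def crd_scale crd_basis)

lemma elem_in: "elem i \<in> End scale"
  by (auto simp: elem_def case_prod_unfold End_iff linear_on_def crd_add crd_scale scale_left_distrib)

lemma entry_linear: "linear_on (pointwise scale) UNIV (*) (entry i)"
  by (auto simp: linear_on_def entry_def pointwise_def crd_add crd_scale case_prod_unfold)

sublocale A: coord_space "pointwise scale" "End scale" "B \<times> B" elem entry
proof -
  interpret f: vector_space "pointwise scale :: 'k \<Rightarrow> ('v \<Rightarrow> 'v) \<Rightarrow> _" by (rule vs_End)
  show "coord_space (pointwise scale) (End scale) (B \<times> B) elem entry"
  proof unfold_locales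
    show "f.subspace (End scale)" by (rule End_subspace)
    show "linear_on (pointwise scale) (End scale) (*) (entry i)" for i
      using entry_linear by (auto simp: linear_on_def)
    show "x = (\<Sum>i\<in>B \<times> B. pointwise scale (entry i x) (elem i))" if "x \<in> End scale" for x
      by (rule End_expand) fact
  qed (auto simp: finite_Basis elem_in entry_elem)
qed

lemma End_eqI:
  assumes "x \<in> End scale" "y \<in> End scale" "\<And>a b. a \<in> B \<Longrightarrow> b \<in> B \<Longrightarrow> crd a (x b) = crd a (y b)"
  shows "x = y"
proof -
  have "(\<Sum>i\<in>B \<times> B. pointwise scale (entry i x) (elem i)) = (\<Sum>i\<in>B \<times> B. pointwise scale (entry i y) (elem i))"
    by (rule sum.cong) (auto simp: entry_def assms(3))
  then show ?thesis using End_expand[OF assms(1)] End_expand[OF assms(2)] by simp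
qed

section \<open>Operators on tensor powers of V as matrices\<close>

abbreviation pv :: "'v list \<Rightarrow> ('v, 'k) tensor" where
  "pv \<equiv> pure_tensor scale UNIV"

lemma vs_tensor: "vector_space (tscale :: 'k \<Rightarrow> ('b, 'k) tensor \<Rightarrow> _)"
  by (rule vector_space_pointwise[OF vector_space_mult])

lemma vs_op: "vector_space (opscale :: 'k \<Rightarrow> ('v, 'k) tensor_op \<Rightarrow> _)"
  by (rule vector_space_pointwise[OF vs_tensor])

lemma tensor_end_subspace: "module.subspace opscale (tensor_end scale n)"
  unfolding tensor_end_def by (rule lin_maps_subspace[OF vs_tensor V.tensor_power_subspace])

lemma pv_in: "length v = n \<Longrightarrow> pv v \<in> tpow scale n"
  by (rule V.pure_tensor_in)

lemma pv_eval: "u \<in> words B n \<Longrightarrow> length v = n \<Longrightarrow> pv v (map crd u) = word_prod crd u v"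
  using V.pure_tensor_dual_basis[of u n v] by (simp add: words_def)

lemma pv_crd: "u \<in> words B n \<Longrightarrow> v \<in> words B n \<Longrightarrow> pv v (map crd u) = of_bool (u = v)"
  using word_prod_delta[of u B n v B crd id] by (simp add: pv_eval words_length crd_basis)

text \<open>The matrix entry of \<open>P\<close> whose row and column are the words of first and of second
  components of \<open>w\<close>. Pairing the row and column index of each tensor position gives
  operators on \<open>V\<^sup>\<otimes>\<^sup>n\<close> the same index words as tensors over
  \<open>End(V)\<close>.\<close>

definition coef :: "('v, 'k) tensor_op \<Rightarrow> ('v \<times> 'v) list \<Rightarrow> 'k" where
  "coef P w = P (pv (map snd w)) (map crd (map fst w))"

lemma words_fst_snd: "w \<in> idx n \<Longrightarrow> map fst w \<in> words B n \<and> map snd w \<in> words B n"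
  by (auto simp: words_def)

lemma op_expand:
  "P \<in> tensor_end scale n \<Longrightarrow> T \<in> tpow scale n \<Longrightarrow>
     P T = (\<Sum>v\<in>words B n. tscale (T (map crd v)) (P (pv v)))"
  using V.tensor_lin_expand[OF vs_tensor, of n P T] by (simp add: tensor_end_def lin_maps_iff)

lemma tensor_end_in: "P \<in> tensor_end scale n \<Longrightarrow> T \<in> tpow scale n \<Longrightarrow> P T \<in> tpow scale n"
  by (simp add: tensor_end_def lin_maps_iff)

lemma tensor_end_eqI:
  assumes P: "P \<in> tensor_end scale n" and Q: "Q \<in> tensor_end scale n"
    and eq: "\<And>w. w \<in> idx n \<Longrightarrow> coef P w = coef Q w"
  shows "P = Q"
proof
  fix T show "P T = Q T"
  proof (cases "T \<in> tpow scale n")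
    case True
    have "P (pv v) = Q (pv v)" if v: "v \<in> words B n" for v
    proof (rule V.tensor_eqI)
      show "P (pv v) \<in> tpow scale n" "Q (pv v) \<in> tpow scale n"
        using v by (auto intro!: tensor_end_in[OF P] tensor_end_in[OF Q] pv_in simp: words_def)
      fix u assume u: "u \<in> words B n"
      have "zip u v \<in> idx n" using u v
        by (auto simp: words_def dest: set_zip_leftD set_zip_rightD)
      from eq[OF this] show "P (pv v) (map V.dual_basis u) = Q (pv v) (map V.dual_basis u)"
        using u v map_fst_zip[of u v] map_snd_zip[of u v] unfolding coef_def words_def
        by (simp del: map_map)
    qed
    then show ?thesis by (simp add: op_expand[OF P True] op_expand[OF Q True])
  qed (use P Q in \<open>simp add: tensor_end_def lin_maps_iff\<close>)
qed

text \<open>Together with \<open>tensor_end_eqI\<close> this identifies operators with arbitrary functions on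
  index words.\<close>

lemma ex_op_with_coef: "\<exists>P\<in>tensor_end scale n. \<forall>w\<in>idx n. coef P w = k w"
proof -
  interpret T: vector_space "tscale :: 'k \<Rightarrow> ('v, 'k) tensor \<Rightarrow> _" by (rule vs_tensor)
  note sb = T.subspace_add[OF V.tensor_power_subspace] T.subspace_scale[OF V.tensor_power_subspace]
  define P where "P = (\<lambda>T. if T \<in> tpow scale n
    then \<Sum>w\<in>idx n. tscale (T (map crd (map snd w)) * k w) (pv (map fst w)) else 0)"
  have "P \<in> tensor_end scale n"
    unfolding tensor_end_def lin_maps_iff linear_on_def
  proof (intro conjI ballI allI impI)
    fix T assume T: "T \<in> tpow scale n"
    show "P T \<in> tpow scale n" unfolding P_def using T
      by (auto intro!: T.subspace_sum[OF V.tensor_power_subspace]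
          T.subspace_scale[OF V.tensor_power_subspace] pv_in simp: words_def)
    show "P (T + U) = P T + P U" if "U \<in> tpow scale n" for U
      using T that sb(1)[OF T that]
      by (simp add: P_def ring_distribs T.scale_left_distrib sum.distrib)
    show "P (tscale c T) = tscale c (P T)" for c
    proof -
      have "tscale c T \<phi>s = c * T \<phi>s" for \<phi>s
        by (simp add: pointwise_def)
      then show ?thesis using T sb(2)[OF T, of c] by (simp add: P_def T.scale_sum_right mult.assoc)
    qed
  qed (simp add: P_def)
  moreover have "coef P w = k w" if w: "w \<in> idx n" for w
  proof -
    have "coef P w = (\<Sum>w'\<in>idx n. of_bool (w = w') * k w')"
    proof -
      have "coef P w = (\<Sum>w'\<in>idx n.
         pv (map snd w) (map crd (map snd w')) * k w' * pv (map fst w') (map crd (map fst w)))"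
        using w by (simp add: coef_def P_def pv_in words_length sum_fun_apply pointwise_def)
      also have "\<dots> = (\<Sum>w'\<in>idx n. of_bool (w = w') * k w')"
      proof (rule sum.cong[OF refl])
        fix w' assume w': "w' \<in> idx n"
        have "w = w' \<longleftrightarrow> map snd w' = map snd w \<and> map fst w = map fst w'"
          by (metis pair_list_eqI)
        moreover have "pv (map snd w) (map crd (map snd w')) = of_bool (map snd w' = map snd w)"
          "pv (map fst w') (map crd (map fst w)) = of_bool (map fst w = map fst w')"
          using words_fst_snd[OF w] words_fst_snd[OF w'] by (blast intro: pv_crd)+
        ultimately show "pv (map snd w) (map crd (map snd w')) * k w' * pv (map fst w') (map crd (map fst w))
            = of_bool (w = w') * k w'"
          by (simp only:) auto
      qed
      finally show ?thesis .
    qed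
    then show ?thesis using sum_words_delta(2)[OF _ w, of k] by (simp add: finite_Basis)
  qed
  ultimately show ?thesis by blast
qed

section \<open>The isomorphism \<open>\<rho>\<close> and the comparison map in coordinates\<close>

abbreviation rho_pure :: "nat \<Rightarrow> ('v \<Rightarrow> 'v) list \<Rightarrow> ('v, 'k) tensor_op" where
  "rho_pure m as \<equiv> tensor_lift scale UNIV m tscale (\<lambda>vs. pv (map2 (\<lambda>a v. a v) as vs))"

lemma pv_map2_multilinear:
  assumes as: "as \<in> ends m"
  shows "multilinear_on scale UNIV m tscale (\<lambda>vs. pv (map2 (\<lambda>a v. a v) as vs))"
  unfolding multilinear_on_def
proof (intro allI impI)
  fix us vs :: "'v list" assume h: "Suc (length us + length vs) = m"
  have eq: "as = take (length us) as @ as ! length us # drop (Suc (length us)) as"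
    using h as by (intro id_take_nth_drop) (auto simp: words_def)
  have a: "as ! length us \<in> End scale"
    using as h by (auto simp: words_def)
  have "linear_on scale UNIV tscale (\<lambda>x. pv (map2 (\<lambda>a v. a v) (take (length us) as) us @ x #
        map2 (\<lambda>a v. a v) (drop (Suc (length us)) as) vs))"
    using h as by (intro multilinear_onD[OF V.pure_tensor_multilinear[of m]]) (auto simp: words_def)
  then have "linear_on scale UNIV tscale (\<lambda>x. pv (map2 (\<lambda>a v. a v) (take (length us) as) us @ (as ! length us) x #
        map2 (\<lambda>a v. a v) (drop (Suc (length us)) as) vs))"
    using a by (auto simp: linear_on_def End_add End_scale)
  moreover have "map2 (\<lambda>a v. a v) as (us @ x # vs) = map2 (\<lambda>a v. a v) (take (length us) as) us @ (as ! length us) x #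
        map2 (\<lambda>a v. a v) (drop (Suc (length us)) as) vs" for x
    by (subst eq, subst zip_append) (use h as in \<open>auto simp: words_def\<close>)
  ultimately show "linear_on scale UNIV tscale (\<lambda>x. pv (map2 (\<lambda>a v. a v) as (us @ x # vs)))"
    by simp
qed

lemma rho_pure_in: "as \<in> ends m \<Longrightarrow> rho_pure m as \<in> tensor_end scale m"
  unfolding tensor_end_def
  by (rule V.tensor_lift_in[OF vs_tensor pv_map2_multilinear V.tensor_power_subspace])
    (auto intro!: pv_in simp: words_def)

lemma rho_pure_multilinear:
  "multilinear_on (pointwise scale) (End scale) m opscale (rho_pure m)"
  unfolding multilinear_on_def
proof (intro allI impI)
  interpret T: vector_space "tscale :: 'k \<Rightarrow> ('v, 'k) tensor \<Rightarrow> _" by (rule vs_tensor)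
  fix us vs assume h: "set us \<subseteq> End scale" "set vs \<subseteq> End scale" "Suc (length us + length vs) = m"
  have lin: "linear_on (pointwise scale) (End scale) tscale (\<lambda>x. pv (map2 (\<lambda>a v. a v) (us @ x # vs) is))"
    if ism: "is \<in> words B m" for "is"
  proof -
    have eq: "is = take (length us) is @ is ! length us # drop (Suc (length us)) is"
      using h ism by (intro id_take_nth_drop) (auto simp: words_def)
    have "linear_on scale UNIV tscale (\<lambda>x. pv (map2 (\<lambda>a v. a v) us (take (length us) is) @ x #
        map2 (\<lambda>a v. a v) vs (drop (Suc (length us)) is)))"
      using h ism by (intro multilinear_onD[OF V.pure_tensor_multilinear[of m]]) (auto simp: words_def)
    moreover have "map2 (\<lambda>a v. a v) (us @ x # vs) is = map2 (\<lambda>a v. a v) us (take (length us) is) @ x (is ! length us) #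
        map2 (\<lambda>a v. a v) vs (drop (Suc (length us)) is)" for x
      by (subst eq, subst zip_append) (use h ism in \<open>auto simp: words_def\<close>)
    ultimately show ?thesis by (auto simp: linear_on_def pointwise_def[of scale])
  qed
  have lift: "rho_pure m (us @ x # vs) = (\<lambda>T. if T \<in> tpow scale m
      then \<Sum>is\<in>words B m. tscale (T (map crd is)) (pv (map2 (\<lambda>a v. a v) (us @ x # vs) is)) else 0)"
    if "x \<in> End scale" for x
    using V.tensor_lift_eq[OF vs_tensor pv_map2_multilinear, of "us @ x # vs" m] that h
    by (simp add: words_def cong: if_cong)
  show "linear_on (pointwise scale) (End scale) opscale (\<lambda>x. rho_pure m (us @ x # vs))"
    unfolding linear_on_def
  proof (intro conjI ballI allI)
    fix x assume x: "x \<in> End scale"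
    show "rho_pure m (us @ (x + y) # vs) = rho_pure m (us @ x # vs) + rho_pure m (us @ y # vs)"
      if y: "y \<in> End scale" for y
      using x y A.subspace_add[OF End_subspace x y]
      by (simp add: lift linear_on_add[OF lin] T.scale_right_distrib sum.distrib fun_eq_iff[of _ "_ + _"])
    show "rho_pure m (us @ pointwise scale c x # vs) = opscale c (rho_pure m (us @ x # vs))" for c
      using x A.subspace_scale[OF End_subspace x, of c]
      by (simp add: lift linear_on_scale[OF lin] T.scale_sum_right fun_eq_iff[of _ "opscale _ _"]
         pointwise_def[of tscale] mult.commute if_distrib[of "tscale c"] cong: if_cong)
  qed
qed

lemma coef_rho_pure:
  assumes as: "as \<in> ends m" and w: "w \<in> idx m"
  shows "coef (rho_pure m as) w = word_prod entry w as"
proof -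
  have "coef (rho_pure m as) w = word_prod crd (map fst w) (map2 (\<lambda>a v. a v) as (map snd w))"
    unfolding coef_def
    using as w words_fst_snd[OF w]
    by (subst V.tensor_lift_pure[OF vs_tensor pv_map2_multilinear[OF as]])
      (auto simp: words_def pv_eval[of _ "length as"] simp del: map_map)
  also have "\<dots> = word_prod entry w as"
  proof (induction w arbitrary: as)
    case (Cons i w) then show ?case by (cases as) (auto simp: entry_def case_prod_unfold)
  qed simp
  finally show ?thesis .
qed

lemma coef_sum_scale: "coef (\<Sum>i\<in>J. opscale (k i) (P i)) w = (\<Sum>i\<in>J. k i * coef (P i) w)"
  by (simp add: coef_def sum_fun_apply pointwise_def)

lemma coef_add: "coef (P + Q) w = coef P w + coef Q w"
  and coef_diff: "coef (P - Q) w = coef P w - coef Q w"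
  and coef_scale: "coef (opscale k P) w = k * coef P w"
  by (simp_all add: coef_def pointwise_def)

lemma rho_in: "T \<in> tensor_power (pointwise scale) (End scale) m \<Longrightarrow> rho scale m T \<in> tensor_end scale m"
  using A.tensor_lift_in[OF vs_op rho_pure_multilinear tensor_end_subspace, of m] rho_pure_in
  by (auto simp: rho_def lin_maps_iff)

text \<open>In coordinates \<open>\<rho>\<close> is the identity, because the operator of \<open>a\<^sub>1
  \<otimes> \<cdots> \<otimes> a\<^sub>m\<close> has as its entries the products of the entries of
  the factors (\<open>coef_rho_pure\<close>).\<close>

lemma coef_rho:
  assumes T: "T \<in> tensor_power (pointwise scale) (End scale) m" and w: "w \<in> idx m"
  shows "coef (rho scale m T) w = T (map A.dual_basis w)"
proof -
  have "coef (rho scale m T) w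
      = (\<Sum>i\<in>idx m. T (map A.dual_basis i) * word_prod entry w (map elem i))"
    using T w by (simp add: rho_def A.tensor_lift_eq[OF vs_op rho_pure_multilinear] coef_sum_scale
        coef_rho_pure A.map_e_words)
  also have "\<dots> = (\<Sum>i\<in>idx m. of_bool (w = i) * T (map A.dual_basis i))"
  proof (rule sum.cong[OF refl])
    fix i assume i: "i \<in> idx m"
    have "word_prod entry w (map elem i) = of_bool (w = i)"
      using word_prod_delta[OF w i, of "\<lambda>i j. entry i (elem j)" id] word_prod_map[of entry id w elem i]
      by (simp add: entry_elem)
    then show "T (map A.dual_basis i) * word_prod entry w (map elem i) = of_bool (w = i) * T (map A.dual_basis i)"
      by simp
  qed
  finally show ?thesis using sum_words_delta(2)[OF A.fin w] by simp
qed

lemma rho_inverse: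
  assumes P: "P \<in> tensor_end scale m"
  defines "T \<equiv> inv_into (tensor_power (pointwise scale) (End scale) m) (rho scale m) P"
  shows "T \<in> tensor_power (pointwise scale) (End scale) m"
    and "w \<in> idx m \<Longrightarrow> T (map A.dual_basis w) = coef P w"
proof -
  interpret T: vector_space "tscale :: 'k \<Rightarrow> ('v \<Rightarrow> 'v, 'k) tensor \<Rightarrow> _" by (rule vs_tensor)
  let ?U = "\<Sum>w\<in>idx m. tscale (coef P w) (pure_tensor (pointwise scale) (End scale) (map elem w))"
  have U: "?U \<in> tensor_power (pointwise scale) (End scale) m"
    by (auto intro!: T.subspace_sum[OF A.tensor_power_subspace]
          T.subspace_scale[OF A.tensor_power_subspace] A.pure_tensor_in simp: words_def)
  have "rho scale m ?U = P"
  proof (rule tensor_end_eqI[OF rho_in[OF U] P])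
    fix w assume w: "w \<in> idx m"
    have "coef (rho scale m ?U) w = (\<Sum>i\<in>idx m. coef P i * word_prod entry w (map elem i))"
      unfolding coef_rho[OF U w]
      using w by (simp add: sum_fun_apply pointwise_def A.pure_tensor_dual_basis A.map_e_words)
    also have "\<dots> = (\<Sum>i\<in>idx m. of_bool (w = i) * coef P i)"
    proof (rule sum.cong[OF refl])
      fix i assume i: "i \<in> idx m"
      have "word_prod entry w (map elem i) = of_bool (w = i)"
        using word_prod_delta[OF w i, of "\<lambda>i j. entry i (elem j)" id] word_prod_map[of entry id w elem i]
        by (simp add: entry_elem)
      then show "coef P i * word_prod entry w (map elem i) = of_bool (w = i) * coef P i"
        by simp
    qed
    finally show "coef (rho scale m ?U) w = coef P w" using sum_words_delta(2)[OF A.fin w] by simp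
  qed
  then have im: "P \<in> rho scale m ` tensor_power (pointwise scale) (End scale) m"
    using U by (intro image_eqI) simp_all
  show T: "T \<in> tensor_power (pointwise scale) (End scale) m"
    unfolding T_def using im by (rule inv_into_into)
  show "T (map A.dual_basis w) = coef P w" if "w \<in> idx m"
    using coef_rho[OF T that] f_inv_into_f[OF im] by (simp add: T_def)
qed

section \<open>Cyclic rotation and composition of operators in coordinates\<close>

lemma sigma_multilinear:
  "multilinear_on scale UNIV (Suc m) tscale (\<lambda>vs. pv (last vs # butlast vs))"
  unfolding multilinear_on_def
proof (intro allI impI)
  fix us vs :: "'v list" assume h: "Suc (length us + length vs) = Suc m"
  show "linear_on scale UNIV tscale (\<lambda>x. pv (last (us @ x # vs) # butlast (us @ x # vs)))"
  proof (cases vs rule: rev_cases)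
    case Nil
    then show ?thesis using h multilinear_onD[OF V.pure_tensor_multilinear, of "[]" us "Suc m"]
      by (simp add: butlast_append)
  next
    case (snoc vs' v)
    then show ?thesis using h multilinear_onD[OF V.pure_tensor_multilinear, of "v # us" vs' "Suc m"]
      by (simp add: butlast_append)
  qed
qed

lemma sigma_in: "sigma scale (Suc m) \<in> tensor_end scale (Suc m)"
  unfolding tensor_end_def sigma_def
  by (rule V.tensor_lift_in[OF vs_tensor sigma_multilinear V.tensor_power_subspace])
    (auto intro!: pv_in simp: words_def)

text \<open>Evaluating \<open>a\<^sub>n \<otimes> a\<^sub>1 \<otimes> \<cdots> \<otimes>
  a\<^sub>n\<^sub>-\<^sub>1\<close> at \<open>\<phi>\<^sub>1, \<dots>, \<phi>\<^sub>n\<close> is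
  evaluating \<open>a\<^sub>1 \<otimes> \<cdots> \<otimes> a\<^sub>n\<close> at
  \<open>\<phi>\<^sub>2, \<dots>, \<phi>\<^sub>n, \<phi>\<^sub>1\<close>.\<close>

lemma sigma_coord:
  assumes T: "T \<in> tpow scale (Suc m)" and u: "u \<in> words B (Suc m)"
  shows "sigma scale (Suc m) T (map crd u) = T (map crd (rotate1 u))"
proof -
  have "sigma scale (Suc m) T (map crd u)
      = (\<Sum>i\<in>words B (Suc m). T (map crd i) * pv (last i # butlast i) (map crd u))"
    using T by (simp add: sigma_def V.tensor_lift_eq[OF vs_tensor sigma_multilinear] sum_fun_apply pointwise_def)
  also have "\<dots> = (\<Sum>i\<in>words B (Suc m). of_bool (rotate1 u = i) * T (map crd i))"
  proof (rule sum.cong[OF refl])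
    fix i assume i: "i \<in> words B (Suc m)"
    obtain j b where j: "i = j @ [b]" "j \<in> words B m" "b \<in> B" using words_Suc_snoc[OF i] by blast
    obtain a u' where a: "u = a # u'" using u by (cases u) auto
    have "pv (b # j) (map crd u) = of_bool (u = b # j)"
      using u j by (intro pv_crd) auto
    then show "T (map crd i) * pv (last i # butlast i) (map crd u) = of_bool (rotate1 u = i) * T (map crd i)"
      by (auto simp: j a)
  qed
  finally show ?thesis using sum_words_delta(2)[OF finite_Basis, of "rotate1 u" "Suc m"] u by simp
qed

lemma sigma_pow_in: "T \<in> tpow scale (Suc m) \<Longrightarrow> (sigma scale (Suc m) ^^ k) T \<in> tpow scale (Suc m)"
  by (induction k) (simp_all add: tensor_end_in[OF sigma_in])

lemma sigma_pow_coord: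
  assumes T: "T \<in> tpow scale (Suc m)" and u: "u \<in> words B (Suc m)"
  shows "(sigma scale (Suc m) ^^ k) T (map crd u) = T (map crd (rotate k u))"
  using u
proof (induction k arbitrary: u)
  case (Suc k)
  have "rotate k (rotate1 u) = rotate (Suc k) u" by (simp add: rotate1_rotate_swap)
  with Suc show ?case by (simp add: sigma_coord[OF sigma_pow_in[OF T]])
qed simp

text \<open>Surjective because the \<open>(m + 1)\<close>-st power is the identity. Hence
  \<open>sigma_inv\<close> is a genuine inverse.\<close>

lemma sigma_bij: "bij_betw (sigma scale (Suc m)) (tpow scale (Suc m)) (tpow scale (Suc m))"
proof (rule bij_betwI')
  let ?s = "sigma scale (Suc m)"
  fix T U assume TU: "T \<in> tpow scale (Suc m)" "U \<in> tpow scale (Suc m)"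
  show "(?s T = ?s U) = (T = U)"
  proof
    assume eq: "?s T = ?s U"
    show "T = U"
    proof (rule V.tensor_eqI[OF TU])
      fix u assume "u \<in> words B (Suc m)"
      then obtain u' where "u = rotate1 u'" "u' \<in> words B (Suc m)"
        using rotate1_bij_words[of B "Suc m"] by (auto simp: bij_betw_def)
      then show "T (map V.dual_basis u) = U (map V.dual_basis u)"
        using eq TU by (simp add: sigma_coord[symmetric])
    qed
  qed simp
next
  fix T assume "T \<in> tpow scale (Suc m)"
  then show "sigma scale (Suc m) T \<in> tpow scale (Suc m)" by (rule tensor_end_in[OF sigma_in])
next
  let ?s = "sigma scale (Suc m)"
  fix T assume T: "T \<in> tpow scale (Suc m)"
  have "(?s ^^ Suc m) T = T"
  proof (rule V.tensor_eqI[OF _ T])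
    show "(?s ^^ Suc m) T \<in> tpow scale (Suc m)"
      using T by (rule sigma_pow_in)
    fix u assume u: "u \<in> words B (Suc m)"
    show "(?s ^^ Suc m) T (map V.dual_basis u) = T (map V.dual_basis u)"
      using sigma_pow_coord[OF T u, of "Suc m"] rotate_id[of "Suc m" u] u by (simp add: words_def)
  qed
  moreover have "(?s ^^ m) T \<in> tpow scale (Suc m)"
    using T by (rule sigma_pow_in)
  ultimately show "\<exists>U\<in>tpow scale (Suc m). T = ?s U" by (intro bexI[of _ "(?s ^^ m) T"]) auto
qed

lemma sigma_inv_in: "T \<in> tpow scale (Suc m) \<Longrightarrow> sigma_inv scale (Suc m) T \<in> tpow scale (Suc m)"
  and sigma_sigma_inv: "T \<in> tpow scale (Suc m) \<Longrightarrow> sigma scale (Suc m) (sigma_inv scale (Suc m) T) = T"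
  using sigma_bij[of m] by (auto simp: sigma_inv_def bij_betw_def f_inv_into_f inv_into_into)

lemma sigma_inv_coord:
  "T \<in> tpow scale (Suc m) \<Longrightarrow> u \<in> words B (Suc m) \<Longrightarrow>
    sigma_inv scale (Suc m) T (map crd (rotate1 u)) = T (map crd u)"
  by (metis sigma_coord sigma_inv_in sigma_sigma_inv)

lemma sigma_inv_tensor_end: "sigma_inv scale (Suc m) \<in> tensor_end scale (Suc m)"
proof -
  interpret T: vector_space "tscale :: 'k \<Rightarrow> ('v, 'k) tensor \<Rightarrow> _" by (rule vs_tensor)
  note sb = T.subspace_add[OF V.tensor_power_subspace] T.subspace_scale[OF V.tensor_power_subspace]
  have rot: "(\<And>u. u \<in> words B (Suc m) \<Longrightarrow> T (map crd (rotate1 u)) = U (map crd (rotate1 u))) \<Longrightarrow> T = U"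
    if "T \<in> tpow scale (Suc m)" "U \<in> tpow scale (Suc m)" for T U
  proof (rule V.tensor_eqI[OF that])
    fix u assume rot: "\<And>u. u \<in> words B (Suc m) \<Longrightarrow> T (map crd (rotate1 u)) = U (map crd (rotate1 u))"
      and "u \<in> words B (Suc m)"
    then obtain u' where "u = rotate1 u'" "u' \<in> words B (Suc m)"
      using rotate1_bij_words[of B "Suc m"] by (auto simp: bij_betw_def)
    then show "T (map V.dual_basis u) = U (map V.dual_basis u)" using rot by simp
  qed
  show ?thesis
    unfolding tensor_end_def lin_maps_iff linear_on_def
  proof (intro conjI ballI allI impI)
    fix T assume T: "T \<in> tpow scale (Suc m)"
    show "sigma_inv scale (Suc m) T \<in> tpow scale (Suc m)" using T by (rule sigma_inv_in)
    show "sigma_inv scale (Suc m) (T + U) = sigma_inv scale (Suc m) T + sigma_inv scale (Suc m) U"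
      if U: "U \<in> tpow scale (Suc m)" for U
      using T U by (intro rot) (simp_all add: sigma_inv_in sb sigma_inv_coord)
    show "sigma_inv scale (Suc m) (tscale c T) = tscale c (sigma_inv scale (Suc m) T)" for c
    proof (rule rot)
      fix u assume u: "u \<in> words B (Suc m)"
      show "sigma_inv scale (Suc m) (tscale c T) (map crd (rotate1 u)) =
          tscale c (sigma_inv scale (Suc m) T) (map crd (rotate1 u))"
        unfolding sigma_inv_coord[OF sb(2)[OF T] u]
        by (simp add: pointwise_def sigma_inv_coord[OF T u])
    qed (use T in \<open>auto simp: sigma_inv_in sb\<close>)
  qed (simp add: sigma_inv_def)
qed

lemma tensor_end_comp:
  "P \<in> tensor_end scale n \<Longrightarrow> Q \<in> tensor_end scale n \<Longrightarrow> P \<circ> Q \<in> tensor_end scale n"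
proof -
  interpret T: vector_space "tscale :: 'k \<Rightarrow> ('v, 'k) tensor \<Rightarrow> _" by (rule vs_tensor)
  assume P: "P \<in> tensor_end scale n" and Q: "Q \<in> tensor_end scale n"
  have "0 \<in> tpow scale n" using T.subspace_0[OF V.tensor_power_subspace] .
  then have "P 0 = 0"
    using linear_on_add[of tscale "tpow scale n" tscale P 0 0] P by (simp add: tensor_end_def lin_maps_iff)
  with P Q show ?thesis by (auto simp: tensor_end_def lin_maps_iff linear_on_def)
qed

definition conj_sigma :: "nat \<Rightarrow> ('v, 'k) tensor_op \<Rightarrow> ('v, 'k) tensor_op" where
  "conj_sigma n P = sigma scale n \<circ> P \<circ> sigma_inv scale n"

lemma conj_sigma_in: "P \<in> tensor_end scale (Suc m) \<Longrightarrow> conj_sigma (Suc m) P \<in> tensor_end scale (Suc m)"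
  unfolding conj_sigma_def by (intro tensor_end_comp sigma_in sigma_inv_tensor_end)

lemma conj_sigma_pow:
  "(conj_sigma n ^^ k) P = (sigma scale n ^^ k) \<circ> P \<circ> (sigma_inv scale n ^^ k)"
proof (induction k)
  case (Suc k)
  have "(conj_sigma n ^^ Suc k) P = conj_sigma n ((conj_sigma n ^^ k) P)" by simp
  also have "\<dots> = conj_sigma n ((sigma scale n ^^ k) \<circ> P \<circ> (sigma_inv scale n ^^ k))"
    by (simp only: Suc)
  also have "\<dots> = (sigma scale n ^^ Suc k) \<circ> P \<circ> (sigma_inv scale n ^^ Suc k)"
    by (simp add: conj_sigma_def fun_eq_iff funpow_swap1)
  finally show ?case .
qed simp

lemma sigma_inv_pv: "v \<in> words B (Suc m) \<Longrightarrow> sigma_inv scale (Suc m) (pv v) = pv (rotate1 v)"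
proof (rule V.tensor_eqI)
  assume v: "v \<in> words B (Suc m)"
  then show "sigma_inv scale (Suc m) (pv v) \<in> tpow scale (Suc m)" "pv (rotate1 v) \<in> tpow scale (Suc m)"
    by (auto intro!: sigma_inv_in pv_in simp: words_def)
  fix u assume "u \<in> words B (Suc m)"
  then obtain u' where u': "u = rotate1 u'" "u' \<in> words B (Suc m)"
    using rotate1_bij_words[of B "Suc m"] by (auto simp: bij_betw_def)
  have "rotate1 u' = rotate1 v \<longleftrightarrow> u' = v" using inj_rotate1 by (auto dest: injD)
  then show "sigma_inv scale (Suc m) (pv v) (map V.dual_basis u) = pv (rotate1 v) (map V.dual_basis u)"
    using u' v pv_crd[of "rotate1 u'" "Suc m" "rotate1 v"]
    by (simp add: sigma_inv_coord pv_in words_length pv_crd[of _ "Suc m"])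
qed

lemma coef_conj_sigma:
  assumes P: "P \<in> tensor_end scale (Suc m)" and w: "w \<in> idx (Suc m)"
  shows "coef (conj_sigma (Suc m) P) w = coef P (rotate1 w)"
  using words_fst_snd[OF w]
  by (simp add: coef_def conj_sigma_def sigma_inv_pv sigma_coord tensor_end_in[OF P] pv_in words_length[OF w]
      rotate1_map del: map_map)

lemma C_dL_iff:
  "P \<in> C_dL scale p \<longleftrightarrow> P \<in> tensor_end scale (Suc p) \<and>
     (\<forall>w\<in>idx (Suc p). coef P (rotate1 w) = (-1) ^ p * coef P w)"
proof -
  interpret O: vector_space "opscale :: 'k \<Rightarrow> ('v, 'k) tensor_op \<Rightarrow> _" by (rule vs_op)
  have "conj_sigma (Suc p) P = opscale ((-1) ^ p) P \<longleftrightarrow>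
     (\<forall>w\<in>idx (Suc p). coef P (rotate1 w) = (-1) ^ p * coef P w)"
    if P: "P \<in> tensor_end scale (Suc p)"
  proof
    assume "conj_sigma (Suc p) P = opscale ((-1) ^ p) P"
    then show "\<forall>w\<in>idx (Suc p). coef P (rotate1 w) = (-1) ^ p * coef P w"
      using coef_conj_sigma[OF P] by (metis coef_scale)
  next
    assume "\<forall>w\<in>idx (Suc p). coef P (rotate1 w) = (-1) ^ p * coef P w"
    then show "conj_sigma (Suc p) P = opscale ((-1) ^ p) P"
      using O.subspace_scale[OF tensor_end_subspace P]
      by (intro tensor_end_eqI[OF conj_sigma_in[OF P]]) (auto simp: coef_conj_sigma[OF P] coef_scale)
  qed
  then show ?thesis by (auto simp: C_dL_def conj_sigma_def)
qed

lemma tensor_append_linear: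
  "linear_on tscale UNIV tscale (\<lambda>T. tensor_append m T U)"
  "linear_on tscale UNIV tscale (\<lambda>U. tensor_append m T U)"
  by (auto simp: linear_on_def tensor_append_def pointwise_def fun_eq_iff algebra_simps)

lemma op_tensor_multilinear:
  assumes "linear_on tscale (tpow scale m) tscale P" "linear_on tscale (tpow scale n) tscale Q"
  shows "multilinear_on scale UNIV (m + n) tscale
    (\<lambda>vs. tensor_append m (P (pv (take m vs))) (Q (pv (drop m vs))))"
  by (rule multilinear_on_product[where f = "\<lambda>vs. P (pv vs)" and g = "\<lambda>vs. Q (pv vs)"
        and \<beta> = "tensor_append m"])
    (auto intro!: multilinear_on_comp[OF V.pure_tensor_multilinear] assms tensor_append_linear pv_in
      simp: words_def)

lemma op_tensor_in:
  assumes "linear_on tscale (tpow scale m) tscale P" "linear_on tscale (tpow scale n) tscale Q"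
    and "\<And>T. T \<in> tpow scale m \<Longrightarrow> P T \<in> tpow scale m" "\<And>T. T \<in> tpow scale n \<Longrightarrow> Q T \<in> tpow scale n"
  shows "op_tensor scale m n P Q \<in> tensor_end scale (m + n)"
  unfolding tensor_end_def op_tensor_def
  by (rule V.tensor_lift_in[OF vs_tensor op_tensor_multilinear V.tensor_power_subspace])
    (auto intro!: assms tensor_append_in pv_in simp: words_def)

lemma op_tensor_pv:
  assumes "linear_on tscale (tpow scale m) tscale P" "linear_on tscale (tpow scale n) tscale Q"
    and "length us = m" "length vs = n"
  shows "op_tensor scale m n P Q (pv (us @ vs)) = tensor_append m (P (pv us)) (Q (pv vs))"
  using V.tensor_lift_pure[OF vs_tensor op_tensor_multilinear[OF assms(1,2)], of "us @ vs"] assms(3,4)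
  by (simp add: op_tensor_def words_def)

lemma tensor_end_lin: "P \<in> tensor_end scale n \<Longrightarrow> linear_on tscale (tpow scale n) tscale P"
  by (simp add: tensor_end_def lin_maps_iff)

lemma diamond_in:
  assumes P: "P \<in> tensor_end scale (Suc p)" and Q: "Q \<in> tensor_end scale (Suc q)"
  shows "dL_diamond scale p q P Q \<in> tensor_end scale (Suc (p + q))"
  using op_tensor_in[OF tensor_end_lin[OF P] linear_on_id, of q]
    op_tensor_in[OF linear_on_id tensor_end_lin[OF Q], of p] tensor_end_in[OF P] tensor_end_in[OF Q]
  by (auto simp: dL_diamond_def intro!: tensor_end_comp)

text \<open>In the matrix product each identity factor forces the intermediate index to equal the row or the
  column index at its position, so a sum remains only at position \<open>p\<close>, where
  \<open>P\<close> and \<open>Q\<close> meet.\<close>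

lemma coef_diamond:
  assumes P: "P \<in> tensor_end scale (Suc p)" and Q: "Q \<in> tensor_end scale (Suc q)"
    and w: "w1 \<in> idx p" "w2 \<in> idx q" and a: "a \<in> B" and b: "b \<in> B"
  shows "coef (dL_diamond scale p q P Q) (w1 @ (a, b) # w2)
    = (\<Sum>c\<in>B. coef P (w1 @ [(a, c)]) * coef Q ((c, b) # w2))"
proof -
  define u1 v1 u2 v2 where uv: "u1 = map fst w1" "v1 = map snd w1" "u2 = map fst w2" "v2 = map snd w2"
  have uvw: "u1 \<in> words B p" "v1 \<in> words B p" "u2 \<in> words B q" "v2 \<in> words B q"
    using words_fst_snd[OF w(1)] words_fst_snd[OF w(2)] by (auto simp: uv)
  note len = uvw[THEN words_length]
  let ?D1 = "op_tensor scale (Suc p) q P id"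
  \<comment> \<open>The image of the basis tensor of column \<open>v1 @ b # v2\<close> under the right factor of the composition.\<close>
  define T where "T = tensor_append p (pv v1) (Q (pv (b # v2)))"
  have T: "T \<in> tpow scale (Suc p + q)"
    using tensor_append_in[OF pv_in[of v1 p] tensor_end_in[OF Q pv_in[of "b # v2"]]] len
    by (simp add: T_def)
  have D1: "?D1 \<in> tensor_end scale (Suc p + q)"
    using op_tensor_in[OF tensor_end_lin[OF P] linear_on_id, of q] tensor_end_in[OF P] by simp
  have "coef (dL_diamond scale p q P Q) (w1 @ (a, b) # w2) = ?D1 T (map crd (u1 @ a # u2))"
    using op_tensor_pv[OF linear_on_id tensor_end_lin[OF Q], of v1 p "b # v2"] len
    by (simp add: coef_def dL_diamond_def T_def flip: uv)
  also have "\<dots> = (\<Sum>i\<in>words B (p + Suc q). T (map crd i) * ?D1 (pv i) (map crd (u1 @ a # u2)))"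
    using op_expand[OF D1 T] by (simp add: sum_fun_apply pointwise_def)
  also have "\<dots> = (\<Sum>i1\<in>words B p. \<Sum>c\<in>B. \<Sum>i2\<in>words B q.
       T (map crd (i1 @ c # i2)) * ?D1 (pv (i1 @ c # i2)) (map crd (u1 @ a # u2)))"
    by (simp only: sum_words_add sum_words_Suc)
  also have "\<dots> = (\<Sum>i1\<in>words B p. \<Sum>c\<in>B. \<Sum>i2\<in>words B q.
       of_bool (i2 = u2) * (of_bool (i1 = v1) * (coef P (zip u1 i1 @ [(a, c)]) * coef Q ((c, b) # zip i2 v2))))"
  proof (intro sum.cong refl)
    fix i1 c i2 assume i: "i1 \<in> words B p" "c \<in> B" "i2 \<in> words B q"
    note leni = i(1,3)[THEN words_length]
    have "T (map crd (i1 @ c # i2)) = of_bool (i1 = v1) * coef Q ((c, b) # zip i2 v2)"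
      using i uvw leni len
      by (auto simp: T_def tensor_append_def pv_crd coef_def map_fst_zip map_snd_zip simp del: map_map)
    moreover have "?D1 (pv (i1 @ c # i2)) (map crd (u1 @ a # u2))
      = of_bool (i2 = u2) * coef P (zip u1 i1 @ [(a, c)])"
      using op_tensor_pv[OF tensor_end_lin[OF P] linear_on_id, of "i1 @ [c]" i2 q] i uvw leni len
      by (auto simp: tensor_append_def pv_crd coef_def map_fst_zip map_snd_zip simp del: map_map)
    ultimately show "T (map crd (i1 @ c # i2)) * ?D1 (pv (i1 @ c # i2)) (map crd (u1 @ a # u2)) =
      of_bool (i2 = u2) * (of_bool (i1 = v1) * (coef P (zip u1 i1 @ [(a, c)]) * coef Q ((c, b) # zip i2 v2)))"
      by simp
  qed
  also have "\<dots> = (\<Sum>i1\<in>words B p. of_bool (i1 = v1) * (\<Sum>c\<in>B. coef P (zip u1 i1 @ [(a, c)]) * coef Q ((c, b) # zip u2 v2)))"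
    by (simp only: sum_words_delta(1)[OF finite_Basis uvw(3)] sum_distrib_left)
  also have "\<dots> = (\<Sum>c\<in>B. coef P (zip u1 v1 @ [(a, c)]) * coef Q ((c, b) # zip u2 v2))"
    by (rule sum_words_delta(1)[OF finite_Basis uvw(2)])
  finally show ?thesis by (simp add: uv zip_map_fst_snd)
qed

section \<open>The trace form and the comparison map in coordinates\<close>

abbreviation tr :: "('v \<Rightarrow> 'v) \<Rightarrow> ('v \<Rightarrow> 'v) \<Rightarrow> 'k" where
  "tr \<equiv> trace_form scale B"

text \<open>The coordinate dual to \<open>elem i\<close> for the trace form: \<open>\<langle>elem i,
  y\<rangle>\<close> is the transposed entry of \<open>y\<close>.\<close>

abbreviation tentry :: "'v \<times> 'v \<Rightarrow> ('v \<Rightarrow> 'v) \<Rightarrow> 'k" where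
  "tentry i \<equiv> entry (prod.swap i)"

lemma trace_crd: "tr x y = (\<Sum>b\<in>B. crd b (x (y b)))"
  by (simp add: trace_form_def crd_def)

lemma trace_linear_left: "linear_on (pointwise scale) UNIV (*) (\<lambda>x. tr x y)"
  by (simp add: linear_on_def trace_crd crd_add crd_scale pointwise_def sum.distrib sum_distrib_left)

lemma crd_End: "x \<in> End scale \<Longrightarrow> crd a (x v) = (\<Sum>b\<in>B. crd a (x b) * crd b v)"
proof -
  assume x: "x \<in> End scale"
  have "crd a (x v) = (\<Sum>i\<in>B \<times> B. entry i x * crd a (elem i v))"
    by (subst End_expand[OF x]) (simp add: sum_fun_apply pointwise_def crd_sum crd_scale)
  moreover have "x v = (\<Sum>b\<in>B. scale (crd b v) (x b))"
    using linear_on_sum_scale[OF vector_space_axioms vector_space_axioms x[unfolded End_iff] subspace_UNIV,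
        of B id "\<lambda>b. crd b v"] crd_expand[of v] by simp
  ultimately show ?thesis by (simp add: crd_sum crd_scale mult.commute)
qed

lemma trace_entries:
  assumes "x \<in> End scale"
  shows "tr x y = (\<Sum>i\<in>B \<times> B. entry i x * tentry i y)"
proof -
  have "tr x y = (\<Sum>b\<in>B. \<Sum>a\<in>B. crd b (x a) * crd a (y b))"
    unfolding trace_crd by (intro sum.cong refl crd_End assms)
  then show ?thesis by (simp add: entry_def sum.cartesian_product case_prod_unfold)
qed

lemma trace_commute: "x \<in> End scale \<Longrightarrow> y \<in> End scale \<Longrightarrow> tr x y = tr y x"
proof -
  assume "x \<in> End scale" "y \<in> End scale"
  then have "tr x y = (\<Sum>i\<in>B \<times> B. entry i x * tentry i y)" "tr y x = (\<Sum>i\<in>B \<times> B. entry i y * tentry i x)"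
    by (simp_all add: trace_entries)
  moreover have "(\<Sum>i\<in>B \<times> B. entry i x * tentry i y) = (\<Sum>i\<in>B \<times> B. entry i y * tentry i x)"
    by (rule sum.reindex_bij_witness[of _ prod.swap prod.swap]) (auto simp: mult.commute)
  ultimately show ?thesis by simp
qed

lemma trace_comp: "tr (x \<circ> y) z = tr x (y \<circ> z)"
  by (simp add: trace_crd)

lemma trace_elem_left: "i \<in> B \<times> B \<Longrightarrow> tr (elem i) y = tentry i y"
proof -
  assume i: "i \<in> B \<times> B"
  have "tr (elem i) y = (\<Sum>j\<in>B \<times> B. if j = i then tentry j y else 0)"
    unfolding trace_entries[OF elem_in] by (rule sum.cong) (auto simp: entry_elem i)
  then show ?thesis using i by (simp add: finite_Basis)
qed

lemma trace_elem_right: "x \<in> End scale \<Longrightarrow> i \<in> B \<times> B \<Longrightarrow> tr x (elem i) = tentry i x"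
  by (simp add: trace_commute[OF _ elem_in] trace_elem_left)

text \<open>Elementary matrices pick out single entries, so the trace form is nondegenerate.\<close>

lemma trace_eqI:
  assumes "x \<in> End scale" "y \<in> End scale" "\<And>z. z \<in> End scale \<Longrightarrow> tr x z = tr y z"
  shows "x = y"
proof (rule End_eqI[OF assms(1,2)])
  fix a b assume "a \<in> B" "b \<in> B"
  then show "crd a (x b) = crd a (y b)"
    using assms(3)[OF elem_in, of "(b, a)"] assms(1,2) by (simp add: trace_elem_right entry_def)
qed

text \<open>In the contraction the factor \<open>a\<^sub>p\<^sub>-\<^sub>i\<close> meets the argument
  \<open>x\<^sub>i\<close>: the arguments are read backwards.\<close>

lemma prod_reversed:
  assumes "length as = p" "length xs = p"
  shows "(\<Prod>i = 1..p. g (as ! (p - i)) (xs ! (i - 1))) = word_prod g as (rev xs)"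
proof -
  have "word_prod g as (rev xs) = (\<Prod>j<p. g (as ! j) (rev xs ! j))"
    using assms by (simp add: word_prod_nth)
  also have "\<dots> = (\<Prod>i = 1..p. g (as ! (p - i)) (xs ! (i - 1)))"
    by (rule prod.reindex_bij_witness[of _ "\<lambda>i. p - i" "\<lambda>j. p - j"]) (use assms in \<open>auto simp: rev_nth\<close>)
  finally show ?thesis by simp
qed

text \<open>The multilinear map of which the contraction is the linear extension.\<close>

definition contract_pure :: "nat \<Rightarrow> ('v \<Rightarrow> 'v) list \<Rightarrow> 'v cochain" where
  "contract_pure p as = (\<lambda>xs. if xs \<in> ends p
     then pointwise scale (\<Prod>i = 1..p. tr (as ! (p - i)) (xs ! (i - 1))) (as ! p) else 0)"

lemma contract_pure_snoc:
  "length as = p \<Longrightarrow> xs \<in> ends p \<Longrightarrow>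
    contract_pure p (as @ [a]) xs = pointwise scale (word_prod tr as (rev xs)) a"
  unfolding contract_pure_def prod_reversed[of as p, symmetric, OF _ words_length]
  by (auto simp: nth_append intro!: arg_cong2[of _ _ _ _ "pointwise scale"] prod.cong)

lemma vs_cochain: "vector_space (cscale scale :: 'k \<Rightarrow> 'v cochain \<Rightarrow> _)"
  by (rule vector_space_pointwise[OF vs_End])

lemma contract_pure_multilinear:
  "multilinear_on (pointwise scale) (End scale) (Suc p) (cscale scale) (contract_pure p)"
  unfolding multilinear_on_def
proof (intro allI impI)
  fix us vs :: "('v \<Rightarrow> 'v) list" assume h: "Suc (length us + length vs) = Suc p"
  show "linear_on (pointwise scale) (End scale) (cscale scale) (\<lambda>x. contract_pure p (us @ x # vs))"
  proof (cases vs rule: rev_cases)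
    case Nil
    have "contract_pure p (us @ [x]) = (\<lambda>xs. if xs \<in> ends p
        then pointwise scale (word_prod tr us (rev xs)) x else 0)" for x
      using h Nil by (auto simp: fun_eq_iff contract_pure_snoc) (simp add: contract_pure_def)
    then show ?thesis
      by (auto simp: Nil linear_on_def pointwise_def fun_eq_iff scale_right_distrib mult.commute)
  next
    case (snoc vs' a)
    have "contract_pure p (us @ x # vs) = (\<lambda>xs. if xs \<in> ends p
        then pointwise scale (word_prod tr (us @ x # vs') (rev xs)) a else 0)" for x
      using h snoc contract_pure_snoc[of "us @ x # vs'" p _ a]
      by (auto simp: fun_eq_iff) (simp add: contract_pure_def)
    moreover have "linear_on (pointwise scale) (End scale) (*) (\<lambda>x. word_prod tr (us @ x # vs') (rev xs))"
      if "xs \<in> ends p" for xs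
    proof -
      have "multilinear_on (pointwise scale) UNIV (length (rev xs)) (*) (word_prod (\<lambda>x a. tr a x) (rev xs))"
        by (rule multilinear_on_word_prod) (rule trace_linear_left)
      then have "linear_on (pointwise scale) UNIV (*) (\<lambda>x. word_prod (\<lambda>x a. tr a x) (rev xs) (us @ x # vs'))"
        using that h snoc by (intro multilinear_onD) (auto simp: words_def)
      then show ?thesis
        by (simp add: word_prod_swap[of "\<lambda>x a. tr a x"] linear_on_def)
    qed
    ultimately show ?thesis
      by (auto simp: linear_on_def pointwise_def[of "pointwise scale"] pointwise_def[of scale] fun_eq_iff scale_left_distrib)
  qed
qed

abbreviation wp :: "('v \<times> 'v) list \<Rightarrow> ('v \<Rightarrow> 'v) list \<Rightarrow> 'k" where
  "wp \<equiv> word_prod tentry"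

text \<open>The inverse of \<open>\<rho>\<close> inside \<open>\<Psi>\<close> disappears in coordinates, by
  \<open>rho_inverse\<close>.\<close>

lemma Psi_eq:
  assumes P: "P \<in> tensor_end scale (Suc p)"
  shows "\<Psi> p P = (\<lambda>xs. if xs \<in> ends p
    then \<Sum>u\<in>idx p. \<Sum>i\<in>B \<times> B. pointwise scale (coef P (u @ [i]) * wp u (rev xs)) (elem i)
    else 0)"
proof
  fix xs
  let ?T = "inv_into (tensor_power (pointwise scale) (End scale) (Suc p)) (rho scale (Suc p)) P"
  have "\<Psi> p P = (\<Sum>w\<in>idx (Suc p). cscale scale (coef P w) (contract_pure p (map elem w)))"
    using A.tensor_lift_eq[OF vs_cochain contract_pure_multilinear[of p]] rho_inverse[OF P]
    by (simp add: Psi_def contraction_def contract_pure_def[abs_def])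
  then have "\<Psi> p P xs =
      (\<Sum>u\<in>idx p. \<Sum>i\<in>B \<times> B. pointwise scale (coef P (u @ [i])) (contract_pure p (map elem u @ [elem i]) xs))"
    by (simp add: sum_words_snoc sum_fun_apply pointwise_def[of "pointwise scale"])
  also have "\<dots> = (if xs \<in> ends p
    then \<Sum>u\<in>idx p. \<Sum>i\<in>B \<times> B. pointwise scale (coef P (u @ [i]) * wp u (rev xs)) (elem i)
    else 0)"
  proof (cases "xs \<in> ends p")
    case True
    have "contract_pure p (map elem u @ [elem i]) xs = pointwise scale (wp u (rev xs)) (elem i)"
      if u: "u \<in> idx p" for u i
    proof -
      have "word_prod tr (map elem u) (rev xs) = word_prod tentry u (rev xs)"
        using u word_prod_map[of tr elem u id "rev xs"]
        by (auto simp: words_def intro!: word_prod_cong trace_elem_left)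
      then show ?thesis using u True by (simp add: contract_pure_snoc words_length)
    qed
    with True show ?thesis by (simp add: pointwise_def[of scale])
  qed (simp add: contract_pure_def)
  finally show "\<Psi> p P xs = \<dots>" .
qed

lemma Psi_entry:
  assumes P: "P \<in> tensor_end scale (Suc p)" and xs: "xs \<in> ends p" and i: "i \<in> B \<times> B"
  shows "entry i (\<Psi> p P xs) = (\<Sum>u\<in>idx p. coef P (u @ [i]) * wp u (rev xs))"
proof -
  have "entry i (\<Psi> p P xs) = (\<Sum>u\<in>idx p. \<Sum>j\<in>B \<times> B.
      (coef P (u @ [j]) * wp u (rev xs)) * entry i (elem j))"
    using xs by (simp add: Psi_eq[OF P] entry_def case_prod_unfold sum_fun_apply crd_sum pointwise_def crd_scale)
  also have "\<dots> = (\<Sum>u\<in>idx p. \<Sum>j\<in>B \<times> B.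
      if j = i then coef P (u @ [j]) * wp u (rev xs) else 0)"
    using i by (intro sum.cong refl) (auto simp: entry_elem)
  finally show ?thesis using i by (simp add: A.fin)
qed

abbreviation cochains :: "nat \<Rightarrow> 'v cochain set" where
  "cochains p \<equiv> multilin_maps (pointwise scale) (End scale) p (pointwise scale) (End scale)"

lemma Psi_in:
  assumes P: "P \<in> tensor_end scale (Suc p)"
  shows "\<Psi> p P \<in> cochains p"
  unfolding multilin_maps_iff
proof (intro conjI ballI allI impI)
  let ?f = "\<lambda>xs. \<Sum>u\<in>idx p. \<Sum>i\<in>B \<times> B. pointwise scale (coef P (u @ [i]) * wp u (rev xs)) (elem i)"
  have "multilinear_on (pointwise scale) (End scale) p (pointwise scale) ?f"
  proof (intro multilinear_on_sum vs_End multilinear_on_scale_left)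
    fix u i assume u: "u \<in> idx p"
    have "multilinear_on (pointwise scale) (End scale) (length u) (*) (wp u)"
      by (rule multilinear_on_word_prod) (use entry_linear linear_on_subset in blast)
    then show "multilinear_on (pointwise scale) (End scale) p (*) (\<lambda>xs. wp u (rev xs))"
      using u by (intro multilinear_on_rev) (simp add: words_length)
  qed
  moreover have "set us \<subseteq> End scale \<Longrightarrow> set vs \<subseteq> End scale \<Longrightarrow> x \<in> End scale \<Longrightarrow> Suc (length us + length vs) = p
     \<Longrightarrow> us @ x # vs \<in> ends p" for us vs x
    by (auto simp: words_def)
  ultimately show "multilinear_on (pointwise scale) (End scale) p (pointwise scale) (\<Psi> p P)"
    using A.subspace_add[OF End_subspace] A.subspace_scale[OF End_subspace]
    by (auto simp: Psi_eq[OF P] multilinear_on_def linear_on_def)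
  show "\<Psi> p P xs \<in> End scale" if "xs \<in> ends p" for xs
    using that by (auto simp: Psi_eq[OF P] intro!: A.subspace_sum[OF End_subspace] A.subspace_scale[OF End_subspace] elem_in)
  show "\<Psi> p P xs = 0" if "xs \<notin> ends p" for xs
    using that by (simp add: Psi_eq[OF P])
qed

lemma Psi_add:
  assumes "P \<in> tensor_end scale (Suc p)" "Q \<in> tensor_end scale (Suc p)"
  shows "\<Psi> p (P + Q) = \<Psi> p P + \<Psi> p Q"
proof -
  interpret O: vector_space "opscale :: 'k \<Rightarrow> ('v, 'k) tensor_op \<Rightarrow> _" by (rule vs_op)
  show ?thesis
    using O.subspace_add[OF tensor_end_subspace assms] assms
    by (auto simp: Psi_eq coef_add fun_eq_iff sum_fun_apply pointwise_def sum.distrib algebra_simps)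
qed

lemma Psi_scale:
  assumes "P \<in> tensor_end scale (Suc p)"
  shows "\<Psi> p (opscale k P) = cscale scale k (\<Psi> p P)"
proof -
  interpret O: vector_space "opscale :: 'k \<Rightarrow> ('v, 'k) tensor_op \<Rightarrow> _" by (rule vs_op)
  show ?thesis
    using O.subspace_scale[OF tensor_end_subspace assms] assms
    by (auto simp: Psi_eq coef_scale fun_eq_iff sum_fun_apply pointwise_def[of scale] 
        pointwise_def[of "pointwise scale"] scale_sum_right mult.assoc)
qed

text \<open>\<open>Phi P (z\<^sub>0, \<dots>, z\<^sub>p)\<close> is the trace of \<open>P (z\<^sub>0 \<otimes> \<cdots> \<otimes> z\<^sub>p)\<close>, in coordinates.\<close>

definition Phi :: "('v, 'k) tensor_op \<Rightarrow> ('v \<Rightarrow> 'v) list \<Rightarrow> 'k" where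
  "Phi P z = (\<Sum>w\<in>idx (length z). coef P w * wp w z)"

lemma trace_Psi:
  assumes P: "P \<in> tensor_end scale (Suc p)" and xs: "xs \<in> ends p"
  shows "tr (\<Psi> p P xs) y = Phi P (rev xs @ [y])"
proof -
  have "tr (\<Psi> p P xs) y
     = (\<Sum>i\<in>B \<times> B. \<Sum>u\<in>idx p. coef P (u @ [i]) * wp u (rev xs) * tentry i y)"
    using Psi_in[OF P] xs
    by (subst trace_entries) (auto simp: multilin_maps_iff Psi_entry[OF P xs] sum_distrib_right)
  also have "\<dots> = Phi P (rev xs @ [y])"
    using xs by (subst sum.swap)
      (auto simp: Phi_def sum_words_snoc words_length word_prod_append mult.assoc intro!: sum.cong)
  finally show ?thesis .
qed

text \<open>For the trace form, the transposed elementary matrices are dual to the elementary ones.\<close>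

lemma wp_elem:
  assumes "w \<in> idx n" "w' \<in> idx n"
  shows "wp w (map (\<lambda>i. elem (prod.swap i)) w') = of_bool (w = w')"
proof -
  have "word_prod (\<lambda>i j. tentry i (elem (prod.swap j))) w w' = of_bool (map id w = w')"
    using assms by (intro word_prod_delta) (auto simp: entry_elem)
  then show ?thesis using word_prod_map[of tentry id w "\<lambda>i. elem (prod.swap i)" w'] by simp
qed

lemma words_elem_swap: "w \<in> idx n \<Longrightarrow> map (\<lambda>i. elem (prod.swap i)) w \<in> ends n"
  by (erule words_map) (rule elem_in)

lemma Psi_entry_elem:
  assumes P: "P \<in> tensor_end scale (Suc p)" and u: "u \<in> idx p" and i: "i \<in> B \<times> B"
  shows "entry i (\<Psi> p P (rev (map (\<lambda>i. elem (prod.swap i)) u))) = coef P (u @ [i])"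
proof -
  have xs: "rev (map (\<lambda>i. elem (prod.swap i)) u) \<in> ends p"
    using words_elem_swap[OF u] by simp
  have "entry i (\<Psi> p P (rev (map (\<lambda>i. elem (prod.swap i)) u)))
      = (\<Sum>v\<in>idx p. of_bool (v = u) * coef P (v @ [i]))"
    unfolding Psi_entry[OF P xs i] by (intro sum.cong refl) (simp add: wp_elem[OF _ u])
  then show ?thesis using sum_words_delta(1)[OF A.fin u] by simp
qed

lemma Psi_inj: "inj_on (\<Psi> p) (tensor_end scale (Suc p))"
proof (rule inj_onI)
  fix P Q assume P: "P \<in> tensor_end scale (Suc p)" and Q: "Q \<in> tensor_end scale (Suc p)"
    and eq: "\<Psi> p P = \<Psi> p Q"
  show "P = Q"
  proof (rule tensor_end_eqI[OF P Q])
    fix w assume "w \<in> idx (Suc p)"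
    then obtain u i where "w = u @ [i]" "u \<in> idx p" "i \<in> B \<times> B"
      using words_Suc_snoc by blast
    then show "coef P w = coef Q w"
      using Psi_entry_elem[OF P, of u i] Psi_entry_elem[OF Q, of u i] eq by simp
  qed
qed

text \<open>The entries of the values of \<open>F\<close> on elementary matrices are prescribed as the matrix
  entries of \<open>P\<close>; the reversal compensates the one in \<open>Psi_entry_elem\<close>.\<close>

lemma Psi_surj:
  assumes F: "F \<in> cochains p"
  shows "\<exists>P\<in>tensor_end scale (Suc p). \<Psi> p P = F"
proof -
  let ?e = "\<lambda>i. elem (prod.swap i)"
  obtain P where P: "P \<in> tensor_end scale (Suc p)"
    and coef: "\<And>w. w \<in> idx (Suc p) \<Longrightarrow> coef P w = entry (last w) (F (rev (map ?e (butlast w))))"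
    using ex_op_with_coef[of "Suc p" "\<lambda>w. entry (last w) (F (rev (map ?e (butlast w))))"] by blast
  have Fp: "F xs \<in> End scale" if "xs \<in> ends p" for xs using F that by (simp add: multilin_maps_iff)
  have "\<Psi> p P xs = F xs" for xs
  proof (cases "xs \<in> ends p")
    case True
    show ?thesis
    proof (rule A.multilinear_eqI[OF vs_End _ _ _ True])
      show "multilinear_on (pointwise scale) (End scale) p (pointwise scale) (\<Psi> p P)"
        "multilinear_on (pointwise scale) (End scale) p (pointwise scale) F"
        using Psi_in[OF P] F by (auto simp: multilin_maps_iff)
      fix w assume w: "w \<in> idx p"
      define u where "u = rev (map prod.swap w)"
      have u: "u \<in> idx p" using w by (auto simp: u_def words_def)
      have we: "map elem w = rev (map ?e u)" by (simp add: u_def rev_map comp_def)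
      have "map elem w \<in> ends p" using w by (rule A.map_e_words)
      then show "\<Psi> p P (map elem w) = F (map elem w)"
      proof (intro End_eqI)
        fix a b assume ab: "a \<in> B" "b \<in> B"
        have "u @ [(a, b)] \<in> idx (Suc p)"
          using words_append[OF u, of "[(a, b)]" 1] ab by simp
        then show "crd a (\<Psi> p P (map elem w) b) = crd a (F (map elem w) b)"
          using Psi_entry_elem[OF P u, of "(a, b)"] coef ab by (simp add: we entry_def)
      qed (use Psi_in[OF P] F in \<open>auto simp: multilin_maps_iff\<close>)
    qed
  next
    case False
    then show ?thesis using F Psi_in[OF P] by (simp add: multilin_maps_iff)
  qed
  with P show ?thesis by blast
qed

lemma Phi_rotate_coef:
  assumes "\<And>w. w \<in> idx (length z) \<Longrightarrow> coef P' w = coef P (rotate1 w)"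
  shows "Phi P' z = Phi P (rotate1 z)"
proof -
  have "Phi P (rotate1 z) = (\<Sum>w\<in>idx (length z). coef P (rotate1 w) * wp (rotate1 w) (rotate1 z))"
    unfolding Phi_def by (simp add: sum_words_rotate1[of "\<lambda>w. coef P w * wp w (rotate1 z)"])
  also have "\<dots> = Phi P' z"
    unfolding Phi_def by (intro sum.cong refl) (simp add: assms word_prod_rotate1 words_length)
  finally show ?thesis by simp
qed

lemma Phi_elem:
  assumes "w \<in> idx n"
  shows "Phi P (map (\<lambda>i. elem (prod.swap i)) w) = coef P w"
proof -
  have "Phi P (map (\<lambda>i. elem (prod.swap i)) w) = (\<Sum>v\<in>idx n. of_bool (v = w) * coef P v)"
    unfolding Phi_def using assms by (intro sum.cong) (auto simp: wp_elem[OF _ assms] words_length)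
  then show ?thesis using sum_words_delta(1)[OF A.fin assms] by simp
qed

lemma Phi_scale: "Phi (opscale k P) z = k * Phi P z"
  by (simp add: Phi_def coef_scale sum_distrib_left mult.assoc)

lemma Phi_diff: "Phi (P - Q) z = Phi P z - Phi Q z"
  by (simp add: Phi_def coef_diff left_diff_distrib sum_subtractf)

lemma Phi_sum: "Phi (\<Sum>i\<in>J. P i) z = (\<Sum>i\<in>J. Phi (P i) z)"
  by (induction J rule: infinite_finite_induct) (simp_all add: Phi_def coef_add coef_def ring_distribs sum.distrib)

lemma C_dL_iff_Phi:
  "P \<in> C_dL scale p \<longleftrightarrow> P \<in> tensor_end scale (Suc p) \<and>
     (\<forall>z\<in>ends (Suc p). Phi P (rotate1 z) = (-1) ^ p * Phi P z)"
proof (cases "P \<in> tensor_end scale (Suc p)")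
  case True
  have "(\<forall>w\<in>idx (Suc p). coef P (rotate1 w) = (-1) ^ p * coef P w) \<longleftrightarrow>
     (\<forall>z\<in>ends (Suc p). Phi P (rotate1 z) = (-1) ^ p * Phi P z)"
  proof (intro iffI ballI)
    fix z assume "\<forall>w\<in>idx (Suc p). coef P (rotate1 w) = (-1) ^ p * coef P w"
      and "z \<in> ends (Suc p)"
    then show "Phi P (rotate1 z) = (-1) ^ p * Phi P z"
      using Phi_rotate_coef[of z "opscale ((-1) ^ p) P" P] by (simp add: coef_scale Phi_scale words_length)
  next
    fix w assume *: "\<forall>z\<in>ends (Suc p). Phi P (rotate1 z) = (-1) ^ p * Phi P z"
      and w: "w \<in> idx (Suc p)"
    show "coef P (rotate1 w) = (-1) ^ p * coef P w"
      using *[rule_format, OF words_elem_swap[OF w]] Phi_elem[OF w, of P] w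
        Phi_elem[of "rotate1 w" "Suc p" P]
      by (simp add: rotate1_map)
  qed
  with True show ?thesis by (simp add: C_dL_iff)
qed (simp add: C_dL_iff)

text \<open>Both conditions compare the form \<open>Phi P\<close> at a word and at its rotation. As
  \<open>trace_Psi\<close> reverses the arguments, the rotation goes the other way, which is
  harmless since the sign \<open>(-1)\<^sup>p\<close> is its own inverse.\<close>

lemma Psi_C_rb_iff:
  assumes P: "P \<in> tensor_end scale (Suc p)"
  shows "\<Psi> p P \<in> C_rb scale B p \<longleftrightarrow> P \<in> C_dL scale p"
proof -
  have *: "(tr (\<Psi> p P (tl xs)) (hd xs) = (-1) ^ p * tr (\<Psi> p P (butlast xs)) (last xs)) \<longleftrightarrow>
      Phi P (rotate1 (rev xs)) = (-1) ^ p * Phi P (rev xs)" if "xs \<in> ends (Suc p)" for xs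
  proof -
    obtain us y where xs: "xs = us @ [y]" "us \<in> ends p" using words_Suc_snoc[OF \<open>xs \<in> _\<close>] by blast
    obtain x vs where xs': "xs = x # vs" "vs \<in> ends p" using \<open>xs \<in> _\<close> by (cases xs) auto
    have "tr (\<Psi> p P (tl xs)) (hd xs) = Phi P (rev xs)"
      using trace_Psi[OF P xs'(2)] by (simp add: xs')
    moreover have "tr (\<Psi> p P (butlast xs)) (last xs) = Phi P (rotate1 (rev xs))"
      using trace_Psi[OF P xs(2)] by (simp add: xs)
    moreover have "(-1) ^ p * ((-1) ^ p * c) = (c :: 'k)" for c
      by (simp flip: mult.assoc power_mult_distrib)
    ultimately show ?thesis by metis
  qed
  have "(\<forall>xs\<in>ends (Suc p). Phi P (rotate1 (rev xs)) = (-1) ^ p * Phi P (rev xs)) \<longleftrightarrow>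
    (\<forall>z\<in>ends (Suc p). Phi P (rotate1 z) = (-1) ^ p * Phi P z)"
    by (metis words_rev rev_rev_ident)
  then show ?thesis using Psi_in[OF P] P * by (simp add: C_rb_def C_dL_iff_Phi)
qed

lemma Psi_bij: "bij_betw (\<Psi> p) (C_dL scale p) (C_rb scale B p)"
proof -
  have "inj_on (\<Psi> p) (C_dL scale p)"
    using Psi_inj by (rule inj_on_subset) (auto simp: C_dL_iff)
  moreover have "\<Psi> p ` C_dL scale p = C_rb scale B p"
  proof (intro equalityI subsetI)
    fix F assume F: "F \<in> C_rb scale B p"
    then obtain P where "P \<in> tensor_end scale (Suc p)" "\<Psi> p P = F"
      using Psi_surj[of F p] by (auto simp: C_rb_def)
    with F show "F \<in> \<Psi> p ` C_dL scale p" using Psi_C_rb_iff by blast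
  qed (auto simp: C_dL_iff Psi_C_rb_iff)
  ultimately show ?thesis by (simp add: bij_betw_def)
qed

section \<open>The bracket of operators, paired with endomorphisms\<close>

text \<open>The sign arises because the product joins position \<open>0\<close> of \<open>Q\<close> to
  \<open>P\<close>, whereas \<open>\<Psi>\<close> leaves the last position of \<open>Q\<close>
  uncontracted: cyclicity of \<open>Q\<close> exchanges the two.\<close>

lemma Phi_diamond:
  assumes P: "P \<in> tensor_end scale (Suc p)" and Q: "Q \<in> C_dL scale q"
    and z: "z1 \<in> ends p" "z2 \<in> ends q"
  shows "Phi (dL_diamond scale p q P Q) (z1 @ y # z2)
    = (-1) ^ q * tr (\<Psi> p P (rev z1) \<circ> \<Psi> q Q (rev z2)) y"
proof -
  have Q': "Q \<in> tensor_end scale (Suc q)" using Q by (simp add: C_dL_iff)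
  define F G where "F = \<Psi> p P (rev z1)" and "G = \<Psi> q Q (rev z2)"
  have F: "F \<in> End scale" and G: "G \<in> End scale"
    using Psi_in[OF P] Psi_in[OF Q'] z by (auto simp: F_def G_def multilin_maps_iff)
  have Fe: "crd a (F c) = (\<Sum>w\<in>idx p. coef P (w @ [(a, c)]) * wp w z1)" if "a \<in> B" "c \<in> B" for a c
    using Psi_entry[OF P, of "rev z1" "(a, c)"] z that by (simp add: F_def entry_def)
  have Ge: "(-1) ^ q * crd c (G b) = (\<Sum>w\<in>idx q. coef Q ((c, b) # w) * wp w z2)"
    if "c \<in> B" "b \<in> B" for c b
  proof -
    have "crd c (G b) = (\<Sum>w\<in>idx q. coef Q (w @ [(c, b)]) * wp w z2)"
      using Psi_entry[OF Q', of "rev z2" "(c, b)"] z that by (simp add: G_def entry_def)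
    also have "\<dots> = (-1) ^ q * (\<Sum>w\<in>idx q. coef Q ((c, b) # w) * wp w z2)"
      unfolding sum_distrib_left
    proof (intro sum.cong refl)
      fix w assume "w \<in> idx q"
      then have "(c, b) # w \<in> idx (Suc q)" using that by simp
      then have "coef Q (rotate1 ((c, b) # w)) = (-1) ^ q * coef Q ((c, b) # w)"
        using Q unfolding C_dL_iff by blast
      then show "coef Q (w @ [(c, b)]) * wp w z2 = (-1) ^ q * (coef Q ((c, b) # w) * wp w z2)"
        by (simp add: mult.assoc)
    qed
    finally show ?thesis by (simp flip: mult.assoc power_mult_distrib)
  qed
  have "Phi (dL_diamond scale p q P Q) (z1 @ y # z2)
     = (\<Sum>w1\<in>idx p. \<Sum>i\<in>B \<times> B. \<Sum>w2\<in>idx q.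
          coef (dL_diamond scale p q P Q) (w1 @ i # w2) * (wp w1 z1 * (tentry i y * wp w2 z2)))"
  proof -
    have "length (z1 @ y # z2) = p + Suc q" using z by (simp add: words_length)
    then show ?thesis unfolding Phi_def
      by (simp only: sum_words_add sum_words_Suc)
        (use z in \<open>auto intro!: sum.cong simp: word_prod_append words_length\<close>)
  qed
  also have "\<dots> = (\<Sum>i\<in>B \<times> B. \<Sum>c\<in>B. (\<Sum>w1\<in>idx p. coef P (w1 @ [(fst i, c)]) * wp w1 z1)
      * (\<Sum>w2\<in>idx q. coef Q ((c, snd i) # w2) * wp w2 z2) * tentry i y)"
  proof (subst sum.swap, rule sum.cong[OF refl])
    fix i assume i: "i \<in> B \<times> B"
    have "(\<Sum>w1\<in>idx p. \<Sum>w2\<in>idx q.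
          coef (dL_diamond scale p q P Q) (w1 @ i # w2) * (wp w1 z1 * (tentry i y * wp w2 z2)))
       = (\<Sum>w1\<in>idx p. \<Sum>w2\<in>idx q. \<Sum>c\<in>B.
          (coef P (w1 @ [(fst i, c)]) * wp w1 z1) * (coef Q ((c, snd i) # w2) * wp w2 z2) * tentry i y)"
    proof (intro sum.cong refl)
      fix w1 w2 assume "w1 \<in> idx p" "w2 \<in> idx q"
      then have "coef (dL_diamond scale p q P Q) (w1 @ i # w2)
        = (\<Sum>c\<in>B. coef P (w1 @ [(fst i, c)]) * coef Q ((c, snd i) # w2))"
        using coef_diamond[OF P Q', of w1 w2 "fst i" "snd i"] i by auto
      then show "coef (dL_diamond scale p q P Q) (w1 @ i # w2) * (wp w1 z1 * (tentry i y * wp w2 z2)) =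
        (\<Sum>c\<in>B. (coef P (w1 @ [(fst i, c)]) * wp w1 z1) * (coef Q ((c, snd i) # w2) * wp w2 z2) * tentry i y)"
        by (simp only: sum_distrib_right) (simp only: mult_ac)
    qed
    also have "\<dots> = (\<Sum>w1\<in>idx p. \<Sum>c\<in>B. \<Sum>w2\<in>idx q.
          (coef P (w1 @ [(fst i, c)]) * wp w1 z1) * (coef Q ((c, snd i) # w2) * wp w2 z2) * tentry i y)"
      by (rule sum.cong[OF refl]) (rule sum.swap)
    also have "\<dots> = (\<Sum>c\<in>B. \<Sum>w1\<in>idx p. \<Sum>w2\<in>idx q.
          (coef P (w1 @ [(fst i, c)]) * wp w1 z1) * (coef Q ((c, snd i) # w2) * wp w2 z2) * tentry i y)"
      by (rule sum.swap)
    finally show "(\<Sum>w1\<in>idx p. \<Sum>w2\<in>idx q.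
          coef (dL_diamond scale p q P Q) (w1 @ i # w2) * (wp w1 z1 * (tentry i y * wp w2 z2))) =
       (\<Sum>c\<in>B. (\<Sum>w1\<in>idx p. coef P (w1 @ [(fst i, c)]) * wp w1 z1)
      * (\<Sum>w2\<in>idx q. coef Q ((c, snd i) # w2) * wp w2 z2) * tentry i y)"
      unfolding sum_product unfolding sum_distrib_right .
  qed
  also have "\<dots> = (\<Sum>i\<in>B \<times> B. \<Sum>c\<in>B. crd (fst i) (F c) * ((-1) ^ q * crd c (G (snd i))) * tentry i y)"
    by (intro sum.cong refl) (auto simp: Fe Ge)
  also have "\<dots> = (-1) ^ q * (\<Sum>i\<in>B \<times> B. entry i (F \<circ> G) * tentry i y)"
    by (simp add: entry_def case_prod_unfold crd_End[OF F, of _ "G _"] sum_distrib_left sum_distrib_right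
        mult.assoc mult.left_commute)
  finally show ?thesis
    using trace_entries[OF End_comp[OF F G], of y] by (simp add: F_def G_def)
qed

lemma box_eq:
  "dL_box scale p q P Q = (\<Sum>s = 0..p + q. opscale ((-1) ^ ((p + q) * s))
     ((conj_sigma (Suc (p + q)) ^^ s) (dL_diamond scale p q P Q)))"
  by (simp add: dL_box_def conj_sigma_pow)

lemma conj_sigma_pow_in:
  "P \<in> tensor_end scale (Suc m) \<Longrightarrow> (conj_sigma (Suc m) ^^ s) P \<in> tensor_end scale (Suc m)"
  by (induction s) (simp_all add: conj_sigma_in)

lemma box_in:
  assumes "P \<in> tensor_end scale (Suc p)" "Q \<in> tensor_end scale (Suc q)"
  shows "dL_box scale p q P Q \<in> tensor_end scale (Suc (p + q))"
proof -
  interpret O: vector_space "opscale :: 'k \<Rightarrow> ('v, 'k) tensor_op \<Rightarrow> _" by (rule vs_op)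
  show ?thesis unfolding box_eq
    by (intro O.subspace_sum[OF tensor_end_subspace] O.subspace_scale[OF tensor_end_subspace]
        conj_sigma_pow_in diamond_in assms)
qed

lemma Phi_conj_sigma_pow:
  assumes "P \<in> tensor_end scale (Suc m)" "length z = Suc m"
  shows "Phi ((conj_sigma (Suc m) ^^ s) P) z = Phi P (rotate s z)"
  using assms(2)
proof (induction s arbitrary: z)
  case (Suc s)
  have "Phi ((conj_sigma (Suc m) ^^ Suc s) P) z = Phi ((conj_sigma (Suc m) ^^ s) P) (rotate1 z)"
    using Suc.prems by (intro Phi_rotate_coef) (simp add: coef_conj_sigma conj_sigma_pow_in[OF assms(1)])
  then show ?case using Suc by (simp add: rotate1_rotate_swap)
qed simp

lemma Phi_box:
  assumes "P \<in> tensor_end scale (Suc p)" "Q \<in> tensor_end scale (Suc q)" "length z = Suc (p + q)"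
  shows "Phi (dL_box scale p q P Q) z = rot_sum (p + q) (Phi (dL_diamond scale p q P Q)) z"
  unfolding box_eq Phi_sum Phi_scale rot_sum_def
  using assms by (simp add: Phi_conj_sigma_pow diamond_in)

lemma box_in_C_dL:
  assumes "P \<in> tensor_end scale (Suc p)" "Q \<in> tensor_end scale (Suc q)"
  shows "dL_box scale p q P Q \<in> C_dL scale (p + q)"
  unfolding C_dL_iff_Phi
proof (intro conjI ballI)
  fix z assume "z \<in> ends (Suc (p + q))"
  then have "length z = Suc (p + q)" by (rule words_length)
  then show "Phi (dL_box scale p q P Q) (rotate1 z) = (-1) ^ (p + q) * Phi (dL_box scale p q P Q) z"
    using rot_sum_rotate[of z "p + q" _ 1] by (simp add: Phi_box assms)
qed (rule box_in[OF assms])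

text \<open>Both brackets, paired with a last argument, are signed sums of values of this form.\<close>

definition trace3 :: "nat \<Rightarrow> nat \<Rightarrow> 'v cochain \<Rightarrow> 'v cochain \<Rightarrow> ('v \<Rightarrow> 'v) list \<Rightarrow> 'k" where
  "trace3 p q F G w = tr (F (take p w) \<circ> G (take q (drop p w))) (w ! (p + q))"

lemma trace3_eq: "length u = p \<Longrightarrow> length v = q \<Longrightarrow> trace3 p q F G (u @ v @ [y]) = tr (F u \<circ> G v) y"
  by (simp add: trace3_def nth_append)

text \<open>Reading the arguments backwards and rotating the one at the shared position to the end turns each
  summand into a value of \<open>trace3\<close>. The rotations involved are absorbed by
  \<open>rot_sum_rotate\<close>; their sign combines with that of \<open>Phi_diamond\<close> to
  \<open>(-1)\<^sup>p\<^sup>q\<close>.\<close>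

lemma Phi_box_trace3:
  assumes P: "P \<in> C_dL scale p" and Q: "Q \<in> C_dL scale q"
    and xs: "xs \<in> ends (p + q)" and y: "y \<in> End scale"
  defines "F \<equiv> \<Psi> p P" and "G \<equiv> \<Psi> q Q"
  shows "Phi (dL_box scale p q P Q) (rev xs @ [y]) = (-1) ^ (p * q) * rot_sum (p + q) (trace3 p q F G) (xs @ [y])"
proof -
  have P': "P \<in> tensor_end scale (Suc p)" and Q': "Q \<in> tensor_end scale (Suc q)"
    using P Q by (auto simp: C_dL_iff)
  let ?n = "p + q" and ?D = "dL_diamond scale p q P Q" and ?T = "trace3 p q F G"
  \<comment> \<open>The reversed word is (arguments after position \<open>p\<close>), the argument at it, (arguments before it); a rotation by \<open>q + 1\<close> brings the last group to the front.\<close>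
  have D: "Phi ?D z = (-1) ^ q * ?T (rotate (Suc q) (rev z))" if z: "z \<in> ends (Suc ?n)" for z
  proof -
    have zeq: "z = take p z @ z ! p # drop (Suc p) z"
      using z by (intro id_take_nth_drop) (auto simp: words_length)
    have w: "take p z \<in> ends p" "drop (Suc p) z \<in> ends q"
      using words_take[OF z, of p] words_drop[of z "End scale" "Suc p" q] z by auto
    have "rev z = (rev (drop (Suc p) z) @ [z ! p]) @ rev (take p z)"
      by (subst zeq) simp
    then have "rotate (Suc q) (rev z) = rev (take p z) @ rev (drop (Suc p) z) @ [z ! p]"
      using rotate_append[of "rev (drop (Suc p) z) @ [z ! p]" "rev (take p z)"] words_length[OF w(2)] by simp
    then have "?T (rotate (Suc q) (rev z)) = tr (F (rev (take p z)) \<circ> G (rev (drop (Suc p) z))) (z ! p)"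
      using w[THEN words_length] by (simp add: trace3_eq)
    then show ?thesis
      using Phi_diamond[OF P' Q w, of "z ! p"] zeq by (simp add: F_def G_def)
  qed
  let ?z = "rev xs @ [y]"
  have z: "?z \<in> ends (Suc ?n)" using xs y by (auto simp: words_def)
  then have lz: "length ?z = Suc ?n" by (rule words_length)
  have "Phi (dL_box scale p q P Q) ?z = (\<Sum>s = 0..?n. (-1) ^ (?n * s) * Phi ?D (rotate s ?z))"
    by (simp add: Phi_box[OF P' Q' lz] rot_sum_def)
  also have "\<dots> = (-1) ^ q * (\<Sum>s = 0..?n. (-1) ^ (?n * s) * ?T (rotate (Suc q) (rev (rotate s ?z))))"
    using z by (simp only: D words_rotate sum_distrib_left) (simp add: mult.left_commute)
  also have "\<dots> = (-1) ^ q * rot_sum ?n (\<lambda>w. ?T (rotate (Suc q) w)) (rev ?z)"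
    by (simp only: rot_sum_rev[OF lz, of "\<lambda>w. ?T (rotate (Suc q) w)"])
  also have "rot_sum ?n (\<lambda>w. ?T (rotate (Suc q) w)) (rev ?z) = rot_sum ?n ?T (rotate (Suc q) (rev ?z))"
    unfolding rot_sum_def rotate_rotate by (simp only: add.commute)
  also have "rotate (Suc q) (rev ?z) = rotate q (xs @ [y])"
    by (simp add: rotate1_rotate_swap)
  also have "rot_sum ?n ?T (rotate q (xs @ [y])) = (-1) ^ (?n * q) * rot_sum ?n ?T (xs @ [y])"
    using lz by (intro rot_sum_rotate) simp
  also have "(-1) ^ q * ((-1) ^ (?n * q) * rot_sum ?n ?T (xs @ [y]))
      = (-1) ^ (q + ?n * q) * rot_sum ?n ?T (xs @ [y])" by (simp add: power_add)
  also have "(-1) ^ (q + ?n * q) = ((-1) ^ (p * q) :: 'k)"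
    by (rule sign_even) (auto simp: algebra_simps)
  finally show ?thesis .
qed

section \<open>The Rota-Baxter bracket, paired with endomorphisms\<close>

text \<open>Iterating the cyclicity condition brings any chosen argument \<open>g\<close> to the last place.\<close>

lemma cochain_cyclic:
  assumes F: "F \<in> C_rb scale B p" and w: "as \<in> ends i" "cs \<in> ends j" "p = Suc (i + j)"
    and g: "g \<in> End scale" "y \<in> End scale"
  shows "tr (F (as @ g # cs)) y = (-1) ^ (p * Suc i) * tr (F (cs @ y # as)) g"
proof -
  define h where "h = (\<lambda>v. tr (F (butlast v)) (last v))"
  have "h (rotate k v) = (-1) ^ (p * k) * h v" if "v \<in> ends (Suc p)" for k v
  proof (induction k)
    case (Suc k)
    have "tr (F (tl (rotate k v))) (hd (rotate k v)) = (-1) ^ p * h (rotate k v)"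
      using F that by (auto simp: C_rb_def h_def)
    moreover have "rotate k v \<noteq> []" using that by (auto simp: words_def)
    then have "h (rotate1 (rotate k v)) = tr (F (tl (rotate k v))) (hd (rotate k v))"
      by (simp add: h_def rotate1_hd_tl)
    ultimately show ?case by (simp add: Suc power_add)
  qed simp
  from this[of "(as @ [g]) @ (cs @ [y])" "Suc i"]
  have "h (rotate (Suc i) ((as @ [g]) @ (cs @ [y]))) = (-1) ^ (p * Suc i) * h (as @ g # cs @ [y])"
    using w g by (auto simp: words_def)
  moreover have "rotate (Suc i) ((as @ [g]) @ (cs @ [y])) = (cs @ [y]) @ (as @ [g])"
    using rotate_append[of "as @ [g]" "cs @ [y]"] w by (simp add: words_length)
  ultimately have "tr (F (cs @ y # as)) g = (-1) ^ (p * Suc i) * tr (F (as @ g # cs)) y"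
    by (simp add: h_def butlast_append)
  then show ?thesis by (simp flip: mult.assoc power_mult_distrib)
qed

lemma cochain_in: "F \<in> cochains p \<Longrightarrow> xs \<in> ends p \<Longrightarrow> F xs \<in> End scale"
  by (simp add: multilin_maps_iff)

lemma C_rb_cochain: "F \<in> C_rb scale B p \<Longrightarrow> F \<in> cochains p"
  by (simp add: C_rb_def)

lemma trace_sum_left: "tr (\<Sum>i\<in>J. f i) y = (\<Sum>i\<in>J. tr (f i) y)"
  by (simp add: trace_crd sum_fun_apply crd_sum) (rule sum.swap)

lemma trace_scale_left: "tr (pointwise scale c f) y = c * tr f y"
  using linear_on_scale[OF trace_linear_left] by simp

lemma trace_add_left: "tr (f + g) y = tr f y + tr g y"
  using linear_on_add[OF trace_linear_left] by simp

lemma trace_diff_left: "tr (f - g) y = tr f y - tr g y"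
  using trace_add_left[of "f - g" g y] by simp

text \<open>The two sums in \<open>F \<circledcirc> G\<close>, in which the value of \<open>G\<close> is multiplied to the left and to the right of
  the neighbouring argument; \<open>right_part\<close> is the sum that is subtracted.\<close>

definition left_part :: "nat \<Rightarrow> nat \<Rightarrow> 'v cochain \<Rightarrow> 'v cochain \<Rightarrow> ('v \<Rightarrow> 'v) list \<Rightarrow> 'v \<Rightarrow> 'v" where
  "left_part p q F G xs = (\<Sum>i = 1..p. pointwise scale ((-1) ^ ((i - 1) * q))
          (F (take (i - 1) xs @ [G (take q (drop (i - 1) xs)) \<circ> (xs ! (i + q - 1))] @ drop (i + q) xs)))"

definition right_part :: "nat \<Rightarrow> nat \<Rightarrow> 'v cochain \<Rightarrow> 'v cochain \<Rightarrow> ('v \<Rightarrow> 'v) list \<Rightarrow> 'v \<Rightarrow> 'v" where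
  "right_part p q F G xs = (\<Sum>i = 1..p. pointwise scale ((-1) ^ (i * q))
          (F (take (i - 1) xs @ [(xs ! (i - 1)) \<circ> G (take q (drop i xs))] @ drop (i + q) xs)))"

lemma rb_circ_eq:
  "xs \<in> ends (p + q) \<Longrightarrow> rb_circ scale p q F G xs = left_part p q F G xs - right_part p q F G xs
     + pointwise scale ((-1) ^ (p * q)) (F (take p xs) \<circ> G (drop p xs))"
  by (simp add: rb_circ_def left_part_def right_part_def)

text \<open>By cyclicity the \<open>i\<close>-th term is \<open>tr (F(\<dots>) G(u) x)\<close>, where
  \<open>x\<close> is the letter after the block \<open>u\<close> of arguments of \<open>G\<close>;
  it is at place \<open>i + q\<close>, so this is the value of \<open>trace3\<close> at the rotation
  that makes \<open>x\<close> the last letter.\<close>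

lemma trace_left_part:
  assumes F: "F \<in> C_rb scale B p" and G: "G \<in> C_rb scale B q"
    and xs: "xs \<in> ends (p + q)" and y: "y \<in> End scale"
  shows "tr (left_part p q F G xs) y =
    (-1) ^ (p * q) * (\<Sum>i = 1..p. (-1) ^ ((p + q) * (i + q)) * trace3 p q F G (rotate (i + q) (xs @ [y])))"
  unfolding left_part_def trace_sum_left trace_scale_left sum_distrib_left
proof (rule sum.cong[OF refl])
  fix i assume i: "i \<in> {1..p}"
  define as u x cs where "as = take (i - 1) xs" and "u = take q (drop (i - 1) xs)"
    and "x = xs ! (i + q - 1)" and "cs = drop (i + q) xs"
  note len = words_length[OF xs]
  have "drop (i - 1) xs = u @ drop (i + q - 1) xs"
    using i by (simp add: u_def append_take_drop_id[of q "drop (i - 1) xs", symmetric, unfolded drop_drop] add.commute)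
      (metis Nat.add_diff_assoc add.commute append_take_drop_id drop_drop)
  moreover have "drop (i + q - 1) xs = x # cs"
    using i len Cons_nth_drop_Suc[of "i + q - 1" xs] by (auto simp: x_def cs_def)
  ultimately have xs_eq: "xs = as @ u @ x # cs"
    using append_take_drop_id[of "i - 1" xs] by (simp add: as_def)
  have w: "as \<in> ends (i - 1)" "u \<in> ends q" "x \<in> End scale" "cs \<in> ends (p - i)"
    using xs i unfolding xs_eq by (auto simp: words_def as_def u_def x_def cs_def len)
  note lw = w(1,2,4)[THEN words_length]
  have Gu: "G u \<in> End scale" using cochain_in[OF C_rb_cochain[OF G] w(2)] .
  have "tr (F (as @ (G u \<circ> x) # cs)) y = (-1) ^ (p * i) * tr (F (cs @ y # as)) (G u \<circ> x)"
    using cochain_cyclic[OF F w(1,4) _ End_comp[OF Gu w(3)] y] i by simp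
  also have "tr (F (cs @ y # as)) (G u \<circ> x) = trace3 p q F G (rotate (i + q) (xs @ [y]))"
  proof -
    have "length (as @ u @ [x]) = i + q" using lw i by simp
    then have "rotate (i + q) ((as @ u @ [x]) @ (cs @ [y])) = (cs @ [y]) @ (as @ u @ [x])"
      using rotate_append by metis
    then have "rotate (i + q) (xs @ [y]) = (cs @ y # as) @ u @ [x]" by (simp add: xs_eq)
    then show ?thesis using lw i trace3_eq[of "cs @ y # as" p u q F G x] by (simp add: trace_comp)
  qed
  finally have 1: "tr (F (as @ (G u \<circ> x) # cs)) y = (-1) ^ (p * i) * trace3 p q F G (rotate (i + q) (xs @ [y]))" .
  have "(-1) ^ ((i - 1) * q + p * i) = ((-1) ^ (p * q + (p + q) * (i + q)) :: 'k)"
    by (rule sign_even) (use i in auto)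
  then have sg: "(-1) ^ ((i - 1) * q) * ((-1) ^ (p * i) * c) = (-1) ^ (p * q) * ((-1) ^ ((p + q) * (i + q)) * c)" for c :: 'k
    by (simp only: power_add mult.assoc[symmetric])
  show "(-1) ^ ((i - 1) * q) * tr (F (take (i - 1) xs @ [G (take q (drop (i - 1) xs)) \<circ> xs ! (i + q - 1)] @ drop (i + q) xs)) y
     = (-1) ^ (p * q) * ((-1) ^ ((p + q) * (i + q)) * trace3 p q F G (rotate (i + q) (xs @ [y])))"
    unfolding as_def[symmetric] u_def[symmetric] x_def[symmetric] cs_def[symmetric] append_Cons append_Nil 1
    by (rule sg)
qed

text \<open>Here \<open>F\<close> is the inner cochain and \<open>x\<close> the letter before its block, at
  place \<open>i\<close>. Commuting \<open>x F(u)\<close> past \<open>G\<close> under the trace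
  gives again the product of \<open>F\<close>, \<open>G\<close> and \<open>x\<close> in this order.\<close>

lemma trace_right_part:
  assumes F: "F \<in> C_rb scale B p" and G: "G \<in> C_rb scale B q"
    and xs: "xs \<in> ends (p + q)" and y: "y \<in> End scale"
  shows "tr (right_part q p G F xs) y =
    (\<Sum>i = 1..q. (-1) ^ ((p + q) * i) * trace3 p q F G (rotate i (xs @ [y])))"
  unfolding right_part_def trace_sum_left trace_scale_left
proof (rule sum.cong[OF refl])
  fix i assume i: "i \<in> {1..q}"
  define as u x cs where "as = take (i - 1) xs" and "u = take p (drop i xs)"
    and "x = xs ! (i - 1)" and "cs = drop (i + p) xs"
  note len = words_length[OF xs]
  have "drop i xs = u @ cs"
    by (metis add.commute append_take_drop_id cs_def drop_drop u_def)
  moreover have "xs = as @ x # drop i xs"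
    using i len id_take_nth_drop[of "i - 1" xs] by (auto simp: x_def as_def)
  ultimately have xs_eq: "xs = as @ x # u @ cs" by simp
  have w: "as \<in> ends (i - 1)" "u \<in> ends p" "x \<in> End scale" "cs \<in> ends (q - i)"
    using xs i unfolding xs_eq by (auto simp: words_def as_def u_def x_def cs_def len)
  note lw = w(1,2,4)[THEN words_length]
  have Fu: "F u \<in> End scale" using cochain_in[OF C_rb_cochain[OF F] w(2)] .
  have "cs @ y # as \<in> ends q"
    using w y i by (auto simp: words_def)
  then have Gv: "G (cs @ y # as) \<in> End scale" using cochain_in[OF C_rb_cochain[OF G]] by blast
  have "tr (G (as @ (x \<circ> F u) # cs)) y = (-1) ^ (q * i) * tr (G (cs @ y # as)) (x \<circ> F u)"
    using cochain_cyclic[OF G w(1,4) _ End_comp[OF w(3) Fu] y] i by simp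
  also have "tr (G (cs @ y # as)) (x \<circ> F u) = tr (F u \<circ> G (cs @ y # as)) x"
    by (metis End_comp Fu Gv trace_commute trace_comp w(3))
  also have "\<dots> = trace3 p q F G (rotate i (xs @ [y]))"
  proof -
    have "length (as @ [x]) = i" using lw i by simp
    then have "rotate i ((as @ [x]) @ (u @ cs @ [y])) = (u @ cs @ [y]) @ (as @ [x])"
      using rotate_append by metis
    then have "rotate i (xs @ [y]) = u @ (cs @ y # as) @ [x]" by (simp add: xs_eq)
    then show ?thesis using lw i trace3_eq[of u p "cs @ y # as" q F G x] by simp
  qed
  finally have 1: "tr (G (as @ (x \<circ> F u) # cs)) y = (-1) ^ (q * i) * trace3 p q F G (rotate i (xs @ [y]))" .
  show "(-1) ^ (i * p) * tr (G (take (i - 1) xs @ [xs ! (i - 1) \<circ> F (take p (drop i xs))] @ drop (i + p) xs)) y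
     = (-1) ^ ((p + q) * i) * trace3 p q F G (rotate i (xs @ [y]))"
    unfolding as_def[symmetric] u_def[symmetric] x_def[symmetric] cs_def[symmetric] append_Cons append_Nil 1
    by (simp add: distrib_right distrib_left power_add mult.commute mult.left_commute)
qed

text \<open>The \<open>p + q + 1\<close> rotations are distributed by the amount of rotation: \<open>0\<close>
  is the product term, \<open>1, \<dots>, q\<close> belong to \<open>trace_right_part\<close> and
  \<open>q + 1, \<dots>, q + p\<close> to \<open>trace_left_part\<close>.\<close>

lemma trace_circ:
  assumes F: "F \<in> C_rb scale B p" and G: "G \<in> C_rb scale B q"
    and xs: "xs \<in> ends (p + q)" and y: "y \<in> End scale"
  shows "(-1) ^ (p * q) * rot_sum (p + q) (trace3 p q F G) (xs @ [y]) =
    tr (left_part p q F G xs) y + (-1) ^ (p * q) * tr (right_part q p G F xs) y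
    + (-1) ^ (p * q) * tr (F (take p xs) \<circ> G (drop p xs)) y"
proof -
  define h where "h = (\<lambda>s. (-1) ^ ((p + q) * s) * trace3 p q F G (rotate s (xs @ [y])))"
  have "rot_sum (p + q) (trace3 p q F G) (xs @ [y]) = h 0 + (\<Sum>i = 1..q + p. h i)"
    unfolding rot_sum_def h_def[symmetric]
    by (simp add: sum.atLeast_Suc_atMost add.commute[of q])
  also have "(\<Sum>i = 1..q + p. h i) = (\<Sum>i = 1..q. h i) + (\<Sum>i = 1 + q..p + q. h i)"
    using sum.ub_add_nat[of 1 q h p] by (simp add: add.commute)
  also have "(\<Sum>i = 1 + q..p + q. h i) = (\<Sum>i = 1..p. h (i + q))"
    by (rule sum.shift_bounds_cl_nat_ivl)
  also have "h 0 = tr (F (take p xs) \<circ> G (drop p xs)) y"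
  proof -
    have "trace3 p q F G (take p xs @ drop p xs @ [y]) = tr (F (take p xs) \<circ> G (drop p xs)) y"
      using words_length[OF xs] by (intro trace3_eq) auto
    moreover have "take p xs @ drop p xs @ [y] = xs @ [y]" by simp
    ultimately show ?thesis by (simp add: h_def)
  qed
  finally have R: "rot_sum (p + q) (trace3 p q F G) (xs @ [y])
    = tr (F (take p xs) \<circ> G (drop p xs)) y + ((\<Sum>i = 1..q. h i) + (\<Sum>i = 1..p. h (i + q)))" .
  have "tr (left_part p q F G xs) y = (-1) ^ (p * q) * (\<Sum>i = 1..p. h (i + q))"
    "tr (right_part q p G F xs) y = (\<Sum>i = 1..q. h i)"
    by (simp_all only: trace_left_part[OF assms] trace_right_part[OF assms] h_def)
  then show ?thesis unfolding R by (simp add: distrib_left add_ac)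
qed

lemma cochain_diff:
  assumes F: "F \<in> cochains p" and w: "set us \<subseteq> End scale" "set vs \<subseteq> End scale" "Suc (length us + length vs) = p"
    and a: "a \<in> End scale" "b \<in> End scale"
  shows "F (us @ (a - b) # vs) = F (us @ a # vs) - F (us @ b # vs)"
proof -
  have l: "linear_on (pointwise scale) (End scale) (pointwise scale) (\<lambda>x. F (us @ x # vs))"
    using F w by (intro multilinear_onD) (auto simp: multilin_maps_iff)
  have "a - b \<in> End scale" using A.subspace_diff[OF End_subspace a] .
  from linear_on_add[OF l this a(2)] show ?thesis by simp
qed

text \<open>The action of an element of \<open>A\<close> is the general commutator in degree \<open>0\<close>:
  in one of the two products the sums are empty. Hence \<open>rb_bracket_eq\<close> needs no
  distinction of degrees.\<close>

lemma rb_act_eq: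
  assumes F: "F \<in> cochains p" and a: "G [] \<in> End scale"
  shows "rb_act scale p F (G []) = rb_circ scale p 0 F G - rb_circ scale 0 p G F"
proof
  fix xs
  show "rb_act scale p F (G []) xs = (rb_circ scale p 0 F G - rb_circ scale 0 p G F) xs"
  proof (cases "xs \<in> ends p")
    case True
    have "F (xs[i - 1 := (G [] \<circ> xs ! (i - 1)) - (xs ! (i - 1) \<circ> G [])]) =
      F (take (i - 1) xs @ [G [] \<circ> xs ! (i - 1)] @ drop i xs) -
      F (take (i - 1) xs @ [xs ! (i - 1) \<circ> G []] @ drop i xs)" if i: "i \<in> {1..p}" for i
    proof -
      have "xs ! (i - 1) \<in> End scale" using True i by (auto simp: words_def)
      then have "F (take (i - 1) xs @ ((G [] \<circ> xs ! (i - 1)) - (xs ! (i - 1) \<circ> G [])) # drop i xs) =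
        F (take (i - 1) xs @ (G [] \<circ> xs ! (i - 1)) # drop i xs) -
        F (take (i - 1) xs @ (xs ! (i - 1) \<circ> G []) # drop i xs)"
        using True i a by (intro cochain_diff[OF F])
          (auto simp: words_def End_comp dest: in_set_takeD in_set_dropD)
      moreover have "xs[i - 1 := z] = take (i - 1) xs @ z # drop i xs" for z
        using upd_conv_take_nth_drop[of "i - 1" xs z] True i by (auto simp: words_length)
      ultimately show ?thesis by simp
    qed
    then show ?thesis using True
      by (simp add: rb_act_def rb_circ_def sum_subtractf words_length)
  qed (simp add: rb_act_def rb_circ_def)
qed

lemma rb_bracket_eq:
  assumes F: "F \<in> cochains p" and G: "G \<in> cochains q"
  shows "rb_bracket scale p q F G = rb_circ scale p q F G - cscale scale ((-1) ^ (p * q)) (rb_circ scale q p G F)"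
proof -
  have one: "cscale scale 1 H = H" for H :: "'v cochain" by (simp add: pointwise_def)
  consider "p \<ge> 1" "q \<ge> 1" | "p \<ge> 1" "q = 0" | "p = 0" "q \<ge> 1" | "p = 0" "q = 0" by linarith
  then show ?thesis
  proof cases
    case 1 then show ?thesis by (simp add: rb_bracket_def)
  next
    case 2 then show ?thesis using rb_act_eq[OF F, of G] cochain_in[OF G, of "[]"]
      by (simp add: rb_bracket_def one)
  next
    case 3 then show ?thesis using rb_act_eq[OF G, of F] cochain_in[OF F, of "[]"]
      by (simp add: rb_bracket_def one)
  next
    case 4 then show ?thesis
      by (auto simp: rb_bracket_def one rb_circ_def fun_eq_iff)
  qed
qed

lemma take_nth_drop_words:
  assumes "xs \<in> words S n" "i \<le> n" "z \<in> S" "j \<le> n"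
  shows "take i xs @ [z] @ drop j xs \<in> words S (Suc (i + (n - j)))"
  using assms by (auto simp: words_def dest: in_set_takeD in_set_dropD)

lemma rb_circ_in:
  assumes F: "F \<in> cochains p" and G: "G \<in> cochains q" and xs: "xs \<in> ends (p + q)"
  shows "rb_circ scale p q F G xs \<in> End scale"
proof -
  note len = words_length[OF xs]
  have 1: "F (take (i - 1) xs @ [z] @ drop (i + q) xs) \<in> End scale" if "i \<in> {1..p}" "z \<in> End scale" for i z
    using that take_nth_drop_words[OF xs, of "i - 1" z "i + q"] by (intro cochain_in[OF F]) auto
  have 2: "G (take q (drop i xs)) \<in> End scale" if "i \<le> p" for i
    using xs that by (intro cochain_in[OF G]) (auto simp: words_def dest: in_set_takeD in_set_dropD)
  have 3: "xs ! i \<in> End scale" if "i < p + q" for i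
    using xs that by (auto simp: words_def)
  show ?thesis
    unfolding rb_circ_eq[OF xs] left_part_def right_part_def
    by (intro A.subspace_add[OF End_subspace] A.subspace_diff[OF End_subspace] A.subspace_sum[OF End_subspace]
        A.subspace_scale[OF End_subspace] 1 End_comp 2 3 cochain_in[OF F] cochain_in[OF G])
      (use xs words_drop in \<open>auto intro!: words_take\<close>)
qed

lemma bracket_in:
  assumes P: "P \<in> C_dL scale p" and Q: "Q \<in> C_dL scale q"
  shows "dL_bracket scale p q P Q \<in> C_dL scale (p + q)"
proof -
  interpret O: vector_space "opscale :: 'k \<Rightarrow> ('v, 'k) tensor_op \<Rightarrow> _" by (rule vs_op)
  have "dL_box scale p q P Q \<in> C_dL scale (p + q)" "dL_box scale q p Q P \<in> C_dL scale (p + q)"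
    using box_in_C_dL[of P p Q q] box_in_C_dL[of Q q P p] P Q by (auto simp: C_dL_iff add.commute)
  then show ?thesis
    using O.subspace_diff[OF tensor_end_subspace] O.subspace_scale[OF tensor_end_subspace]
    by (auto simp: C_dL_iff_Phi dL_bracket_def Phi_diff Phi_scale algebra_simps)
qed

text \<open>Both sides are commutators whose halves have equal pairings only after the terms \<open>G(\<dots>,
  xF(\<dots>), \<dots>)\<close> of one half are exchanged with the terms \<open>F(\<dots>,
  xG(\<dots>), \<dots>)\<close> of the other.\<close>

theorem Psi_bracket:
  assumes P: "P \<in> C_dL scale p" and Q: "Q \<in> C_dL scale q"
  shows "\<Psi> (p + q) (dL_bracket scale p q P Q)
    = rb_bracket scale p q (\<Psi> p P) (\<Psi> q Q)"
proof
  fix xs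
  define F G where FG: "F = \<Psi> p P" "G = \<Psi> q Q"
  have P': "P \<in> tensor_end scale (Suc p)" and Q': "Q \<in> tensor_end scale (Suc q)"
    using P Q by (auto simp: C_dL_iff)
  have br: "dL_bracket scale p q P Q \<in> tensor_end scale (Suc (p + q))"
    using bracket_in[OF P Q] by (simp add: C_dL_iff)
  have F: "F \<in> C_rb scale B p" and G: "G \<in> C_rb scale B q"
    using P Q Psi_C_rb_iff[OF P'] Psi_C_rb_iff[OF Q'] by (auto simp: FG)
  note F' = C_rb_cochain[OF F] and G' = C_rb_cochain[OF G]
  note rb = rb_bracket_eq[OF F' G']
  show "\<Psi> (p + q) (dL_bracket scale p q P Q) xs = rb_bracket scale p q (\<Psi> p P) (\<Psi> q Q) xs"
  proof (cases "xs \<in> ends (p + q)")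
    case xs: True
    then have xs': "xs \<in> ends (q + p)" by (simp add: add.commute)
    have rbx: "rb_bracket scale p q F G xs = rb_circ scale p q F G xs - pointwise scale ((-1) ^ (p * q)) (rb_circ scale q p G F xs)"
      by (simp add: rb pointwise_def[of "pointwise scale"])
    have "\<Psi> (p + q) (dL_bracket scale p q P Q) xs = rb_bracket scale p q F G xs"
    proof (rule trace_eqI)
      show "\<Psi> (p + q) (dL_bracket scale p q P Q) xs \<in> End scale"
        using Psi_in[OF br] xs by (simp add: multilin_maps_iff)
      show "rb_bracket scale p q F G xs \<in> End scale"
        unfolding rbx by (intro A.subspace_diff[OF End_subspace] A.subspace_scale[OF End_subspace] rb_circ_in F' G' xs xs')
      fix y assume y: "y \<in> End scale"
      have sq: "(-1) ^ (p * q) * ((-1) ^ (p * q) * c) = c" for c :: 'k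
        by (simp flip: mult.assoc power_mult_distrib)
      have "tr (\<Psi> (p + q) (dL_bracket scale p q P Q) xs) y
        = Phi (dL_box scale p q P Q) (rev xs @ [y]) - (-1) ^ (p * q) * Phi (dL_box scale q p Q P) (rev xs @ [y])"
        unfolding trace_Psi[OF br xs] by (simp add: dL_bracket_def Phi_diff Phi_scale)
      also have "\<dots> = (-1) ^ (p * q) * rot_sum (p + q) (trace3 p q F G) (xs @ [y])
         - (-1) ^ (p * q) * ((-1) ^ (q * p) * rot_sum (q + p) (trace3 q p G F) (xs @ [y]))"
        by (simp add: Phi_box_trace3[OF P Q xs y] Phi_box_trace3[OF Q P xs' y] FG)
      also have "\<dots> = tr (rb_bracket scale p q F G xs) y"
        unfolding trace_circ[OF F G xs y] trace_circ[OF G F xs' y] rbx rb_circ_eq[OF xs] rb_circ_eq[OF xs']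
        by (simp add: trace_diff_left trace_add_left trace_scale_left algebra_simps sq mult.commute[of q p])
      finally show "tr (\<Psi> (p + q) (dL_bracket scale p q P Q) xs) y = tr (rb_bracket scale p q F G xs) y" .
    qed
    then show ?thesis by (simp add: FG)
  next
    case False
    then have "rb_bracket scale p q F G xs = 0"
      by (simp add: rb rb_circ_def pointwise_def add.commute[of q] zero_fun_def)
    then show ?thesis using False Psi_in[OF br] by (simp add: FG multilin_maps_iff)
  qed
qed

end

section \<open>The Rota-Baxter product is graded pre-Lie\<close>

text \<open>Signs are written without scalars, so that the pre-Lie identity can be stated for additive groups.\<close>

definition signed :: "nat \<Rightarrow> 'a::ab_group_add \<Rightarrow> 'a" where
  "signed k x = (if even k then x else - x)"

lemma signed_add: "signed k (x + y) = signed k x + signed k y"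
  and signed_diff: "signed k (x - y) = signed k x - signed k y"
  and signed_0 [simp]: "signed k 0 = 0"
  and signed_zero [simp]: "signed 0 x = x"
  and signed_signed: "signed k (signed l x) = signed (k + l) x"
  by (auto simp: signed_def)

lemma signed_sum: "signed k (\<Sum>i\<in>J. f i) = (\<Sum>i\<in>J. signed k (f i))"
  by (simp add: signed_def sum_negf)

text \<open>The model is composition on \<open>End(V)\<close> inside the group of all functions: \<open>(a +
  b) c = a c + b c\<close> holds for all functions, whereas \<open>a (b + c) = a b + a c\<close>
  requires \<open>a\<close> to be additive.\<close>

locale additive_product =
  fixes S :: "'a::ab_group_add set" and mul :: "'a \<Rightarrow> 'a \<Rightarrow> 'a" (infixl "\<cdot>" 70)
  assumes zero_in: "0 \<in> S"
    and add_in: "a \<in> S \<Longrightarrow> b \<in> S \<Longrightarrow> a + b \<in> S"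
    and minus_in: "a \<in> S \<Longrightarrow> - a \<in> S"
    and mul_in: "a \<in> S \<Longrightarrow> b \<in> S \<Longrightarrow> a \<cdot> b \<in> S"
    and mul_assoc: "a \<cdot> b \<cdot> c = a \<cdot> (b \<cdot> c)"
    and mul_add_left: "(a + b) \<cdot> c = a \<cdot> c + b \<cdot> c"
    and mul_add_right: "a \<in> S \<Longrightarrow> a \<cdot> (b + c) = a \<cdot> b + a \<cdot> c"
begin

lemma diff_in: "a \<in> S \<Longrightarrow> b \<in> S \<Longrightarrow> a - b \<in> S"
  using add_in[of a "- b"] minus_in[of b] by simp

lemma signed_in: "a \<in> S \<Longrightarrow> signed k a \<in> S"
  by (simp add: signed_def minus_in)

lemma mul_diff_left: "(a - b) \<cdot> c = a \<cdot> c - b \<cdot> c"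
  using mul_add_left[of "a - b" b c] by (simp add: algebra_simps)

lemma mul_signed_left: "signed k a \<cdot> b = signed k (a \<cdot> b)"
  using mul_diff_left[of 0 a b] mul_add_left[of 0 0 b] by (simp add: signed_def)

lemma mul_0: "a \<in> S \<Longrightarrow> a \<cdot> 0 = 0"
  using mul_add_right[of a 0 0] by simp

lemma mul_diff_right: "a \<in> S \<Longrightarrow> a \<cdot> (b - c) = a \<cdot> b - a \<cdot> c"
  using mul_add_right[of a "b - c" c] by (simp add: algebra_simps)

lemma mul_signed_right: "a \<in> S \<Longrightarrow> a \<cdot> signed k b = signed k (a \<cdot> b)"
  using mul_diff_right[of a 0 b] mul_0[of a] by (simp add: signed_def)

definition valued :: "nat \<Rightarrow> ('a list \<Rightarrow> 'a) \<Rightarrow> bool" where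
  "valued n F \<longleftrightarrow> (\<forall>w\<in>words S n. F w \<in> S)"

text \<open>The arguments are fixed one after the other, with additivity required in the next one; the
  definition of \<open>insert_all\<close> recurses in the same way.\<close>

primrec multiadditive :: "nat \<Rightarrow> ('a list \<Rightarrow> 'a) \<Rightarrow> bool" where
  "multiadditive 0 F \<longleftrightarrow> F [] \<in> S"
| "multiadditive (Suc n) F \<longleftrightarrow> (\<forall>a\<in>S. multiadditive n (\<lambda>v. F (a # v))) \<and>
     (\<forall>v\<in>words S n. \<forall>a\<in>S. \<forall>b\<in>S. F ((a + b) # v) = F (a # v) + F (b # v))"

lemma valuedD: "valued n F \<Longrightarrow> w \<in> words S n \<Longrightarrow> F w \<in> S"
  by (simp add: valued_def)

lemma valued_Cons: "valued (Suc n) F \<Longrightarrow> a \<in> S \<Longrightarrow> valued n (\<lambda>v. F (a # v))"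
  by (simp add: valued_def)

lemma multiadditive_valued: "multiadditive n F \<Longrightarrow> valued n F"
proof (induction n arbitrary: F)
  case (Suc n)
  show ?case unfolding valued_def
  proof
    fix w assume "w \<in> words S (Suc n)"
    then obtain a v where "w = a # v" "a \<in> S" "v \<in> words S n" by (cases w) auto
    then show "F w \<in> S" using Suc.IH[of "\<lambda>v. F (a # v)"] Suc.prems by (auto dest: valuedD)
  qed
qed (simp add: valued_def)

lemma multiadditive_Cons: "multiadditive (Suc n) F \<Longrightarrow> a \<in> S \<Longrightarrow> multiadditive n (\<lambda>v. F (a # v))"
  by simp

lemma multiadditive_add:
  "multiadditive (Suc n) F \<Longrightarrow> v \<in> words S n \<Longrightarrow> a \<in> S \<Longrightarrow> b \<in> S \<Longrightarrow>
    F ((a + b) # v) = F (a # v) + F (b # v)"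
  by simp

lemma additive_signed:
  assumes add: "\<And>a b. a \<in> S \<Longrightarrow> b \<in> S \<Longrightarrow> f (a + b) = f a + f b" and a: "a \<in> S"
  shows "f (signed k a) = signed k (f a :: 'b::ab_group_add)"
proof -
  have "f 0 = 0" using add[OF zero_in zero_in] by simp
  then have "f (- a) = - f a"
    using add[of a "- a"] a minus_in[OF a] by (simp add: eq_neg_iff_add_eq_0 add.commute)
  then show ?thesis by (simp add: signed_def)
qed

text \<open>The graded commutator \<open>G x - (-1)\<^sup>q x G\<close>, as a function of \<open>q + 1\<close>
  letters.\<close>

definition ad_cochain :: "nat \<Rightarrow> ('a list \<Rightarrow> 'a) \<Rightarrow> ('a list \<Rightarrow> 'a)" where
  "ad_cochain q G w = G (take q w) \<cdot> hd (drop q w) - signed q (hd w \<cdot> G (tl w))"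

text \<open>The signed sum of the insertions of \<open>K\<close>, which takes \<open>q + 1\<close> letters,
  into the \<open>p\<close> arguments of \<open>F\<close>, plus the signed product of
  \<open>F\<close> and \<open>G\<close>. The recursion decides about the first letter: either
  \<open>K\<close> is applied to the initial letters, or the first letter becomes the first argument
  of \<open>F\<close>, which \<open>K\<close> and \<open>G\<close> pass with the sign of their
  degree \<open>q\<close>. For \<open>G = 0\<close> only the insertions remain;
  \<open>insertion_sum\<close> writes them as a sum over positions.\<close>

primrec insert_all :: "nat \<Rightarrow> nat \<Rightarrow> ('a list \<Rightarrow> 'a) \<Rightarrow> ('a list \<Rightarrow> 'a) \<Rightarrow> ('a list \<Rightarrow> 'a) \<Rightarrow> ('a list \<Rightarrow> 'a)" where
  "insert_all 0 q K G F w = F [] \<cdot> G w"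
| "insert_all (Suc p) q K G F w = F (K (take (Suc q) w) # drop (Suc q) w)
     + signed q (insert_all p q K G (\<lambda>v. F (hd w # v)) (tl w))"

abbreviation insertion :: "nat \<Rightarrow> nat \<Rightarrow> ('a list \<Rightarrow> 'a) \<Rightarrow> ('a list \<Rightarrow> 'a) \<Rightarrow> ('a list \<Rightarrow> 'a)" where
  "insertion p q F K \<equiv> insert_all p q K (\<lambda>_. 0) F"

text \<open>This is \<open>F \<circledcirc> G\<close>: the two sums in its definition together insert the
  commutator of \<open>G\<close> with a letter.\<close>

definition circ :: "nat \<Rightarrow> nat \<Rightarrow> ('a list \<Rightarrow> 'a) \<Rightarrow> ('a list \<Rightarrow> 'a) \<Rightarrow> ('a list \<Rightarrow> 'a)" where
  "circ p q F G = insert_all p q (ad_cochain q G) G F"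

lemma ad_cochain_in:
  assumes "valued q G" shows "valued (Suc q) (ad_cochain q G)"
  unfolding valued_def ad_cochain_def
proof
  fix w assume w: "w \<in> words S (Suc q)"
  then obtain u y where u: "w = u @ [y]" "u \<in> words S q" "y \<in> S"
    using words_Suc_snoc by blast
  obtain x v where v: "w = x # v" "v \<in> words S q" "x \<in> S"
    using w by (cases w) auto
  have "take q w = u" "hd (drop q w) = y" using u by (auto simp: words_def)
  then show "G (take q w) \<cdot> hd (drop q w) - signed q (hd w \<cdot> G (tl w)) \<in> S"
    using u(2,3) v assms by (simp add: valued_def diff_in mul_in signed_in)
qed

lemma insert_all_in:
  assumes "valued p F" "valued (Suc q) K" "valued q G"
  shows "valued (p + q) (insert_all p q K G F)"
  unfolding valued_def using assms(1)
proof (induction p arbitrary: F)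
  case 0
  show ?case
  proof
    fix w assume w: "w \<in> words S (0 + q)"
    have "F [] \<cdot> G w \<in> S"
      using w by (intro mul_in valuedD[OF 0] valuedD[OF assms(3)]) simp_all
    then show "insert_all 0 q K G F w \<in> S" by (simp only: insert_all.simps)
  qed
next
  case (Suc p)
  show ?case
  proof
    fix w assume w: "w \<in> words S (Suc p + q)"
    have "K (take (Suc q) w) # drop (Suc q) w \<in> words S (Suc p)"
      using w valuedD[OF assms(2)] words_take[OF w, of "Suc q"] words_drop[of w "S" "Suc q" p]
      by (auto simp: add.commute)
    moreover have "insert_all p q K G (\<lambda>v. F (hd w # v)) (tl w) \<in> S"
      using words_tl[of w "S" "p + q"] w Suc.IH valued_Cons[OF Suc.prems] by auto
    ultimately show "insert_all (Suc p) q K G F w \<in> S"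
      using Suc.prems unfolding valued_def by (simp add: add_in signed_in del: Cons_in_words)
  qed
qed

lemma zero_valued: "valued q (\<lambda>_. 0)"
  by (simp add: valued_def zero_in)

lemma insert_all_add:
  "insert_all p q K G (\<lambda>v. F v + F' v) w = insert_all p q K G F w + insert_all p q K G F' w"
  by (induction p arbitrary: F F' w) (simp_all add: mul_add_left signed_add algebra_simps)

lemma insert_all_signed: "insert_all p q K G (\<lambda>v. signed k (F v)) w = signed k (insert_all p q K G F w)"
  by (induction p arbitrary: F w) (simp_all add: mul_signed_left signed_add signed_signed add.commute)

lemma insert_all_comp:
  assumes a: "a \<in> S"
  shows "insert_all p q K G (\<lambda>v. a \<cdot> F v) w = a \<cdot> insert_all p q K G F w"
  by (induction p arbitrary: F w) (simp_all add: mul_add_right[OF a] mul_signed_right[OF a] mul_assoc)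

text \<open>Insertions into the first \<open>m\<close> arguments, and insertions into the later ones, for
  which \<open>K\<close> passes \<open>m\<close> letters.\<close>

lemma insert_all_split:
  assumes M: "\<And>v a b. v \<in> words S r \<Longrightarrow> a \<in> S \<Longrightarrow> b \<in> S \<Longrightarrow> M (a + b) v = M a v + M b v"
    and K: "valued (Suc q) K" and Y: "valued m Y" and w: "w \<in> words S (m + r + q)"
  shows "insert_all (m + r) q K G (\<lambda>v. M (Y (take m v)) (drop m v)) w
    = M (insertion m q Y K (take (m + q) w)) (drop (m + q) w)
      + signed (m * q) (insert_all r q K G (M (Y (take m w))) (drop m w))"
  using Y w
proof (induction m arbitrary: Y w)
  case 0
  have v: "drop q w \<in> words S r" using 0 words_drop[of w _ q r] by (simp add: add.commute)
  have "M 0 (drop q w) = 0" using M[OF v zero_in zero_in] by simp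
  moreover have "Y [] \<cdot> 0 = 0" using valuedD[OF 0(1), of "[]"] by (intro mul_0) simp
  ultimately show ?case by (simp only: insert_all.simps take_0 drop_0 add_0 mult_0 signed_zero)
next
  case (Suc m)
  obtain x w' where xw: "w = x # w'" "x \<in> S" "w' \<in> words S (m + r + q)"
    using Suc.prems(2) by (cases w) auto
  note Y' = valued_Cons[OF Suc.prems(1) xw(2)]
  have u: "K (take (Suc q) w) \<in> S"
    using Suc.prems(2) by (intro valuedD[OF K] words_take) auto
  have v: "drop (Suc m + q) w \<in> words S r"
    using Suc.prems(2) words_drop[of w _ "Suc m + q" r] by (simp add: ac_simps)
  have t: "take m (drop (Suc q) w) \<in> words S m"
    using Suc.prems(2) words_drop[of w _ "Suc q" "m + r"] by (intro words_take[of _ _ "m + r"]) (auto simp: ac_simps)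
  have 1: "Y (K (take (Suc q) w) # take m (drop (Suc q) w)) \<in> S"
    using u t by (intro valuedD[OF Suc.prems(1)]) simp
  have 2: "insertion m q (\<lambda>v. Y (x # v)) K (take (m + q) w') \<in> S"
    using xw(3) by (intro valuedD[OF insert_all_in[OF Y' K zero_valued]] words_take) auto
  have Mv: "M (signed k a) (drop (Suc m + q) w) = signed k (M a (drop (Suc m + q) w))" if "a \<in> S" for a k
    by (rule additive_signed[of "\<lambda>a. M a (drop (Suc m + q) w)", OF M[OF v] that])
  have ins: "insertion (Suc m) q Y K (take (Suc m + q) w)
     = Y (K (take (Suc q) w) # take m (drop (Suc q) w)) + signed q (insertion m q (\<lambda>v. Y (x # v)) K (take (m + q) w'))"
    by (simp add: xw min_def drop_take)
  have "insert_all (Suc m + r) q K G (\<lambda>v. M (Y (take (Suc m) v)) (drop (Suc m) v)) w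
    = M (Y (K (take (Suc q) w) # take m (drop (Suc q) w))) (drop (Suc m + q) w)
     + signed q (insert_all (m + r) q K G (\<lambda>v. M (Y (x # take m v)) (drop m v)) w')"
    by (simp add: xw add.commute)
  also have "insert_all (m + r) q K G (\<lambda>v. M (Y (x # take m v)) (drop m v)) w'
     = M (insertion m q (\<lambda>v. Y (x # v)) K (take (m + q) w')) (drop (m + q) w')
      + signed (m * q) (insert_all r q K G (M (Y (x # take m w'))) (drop m w'))"
    by (rule Suc.IH[OF Y' xw(3)])
  finally show ?case
    unfolding ins M[OF v 1 signed_in[OF 2]] Mv[OF 2]
    by (simp add: xw signed_add signed_signed add.assoc)
qed

lemma circ_eq:
  "circ p q F G w = insertion p q F (ad_cochain q G) w + signed (p * q) (F (take p w) \<cdot> G (drop p w))"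
  if "valued p F" "w \<in> words S (p + q)"
proof -
  have "insert_all p q K G F w = insertion p q F K w + signed (p * q) (F (take p w) \<cdot> G (drop p w))" for K
    using that
  proof (induction p arbitrary: F w)
    case 0
    have "F [] \<cdot> 0 = 0" using valuedD[OF 0(1), of "[]"] by (intro mul_0) simp
    then show ?case by (simp only: insert_all.simps take_0 drop_0 add_0 mult_0 signed_zero)
  next
    case (Suc p)
    then obtain x w' where xw: "w = x # w'" "x \<in> S" "w' \<in> words S (p + q)"
      by (cases w) auto
    show ?case
      using Suc.IH[OF valued_Cons[OF Suc.prems(1) xw(2)] xw(3)]
      by (simp add: xw signed_add signed_signed add.assoc)
  qed
  then show ?thesis by (simp add: circ_def)
qed

text \<open>Insertion is a graded derivation of the product, and inserting \<open>K\<close> into a single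
  letter gives \<open>K\<close>.\<close>

lemma insertion_ad_cochain:
  assumes F: "valued p F" and K: "valued (Suc q) K" and w: "w \<in> words S (Suc (p + q))"
  shows "insertion (Suc p) q (ad_cochain p F) K w = ad_cochain (p + q) (insertion p q F K) w
    + signed (p * q) (F (take p w) \<cdot> K (drop p w)) - signed p (K (take (Suc q) w) \<cdot> F (drop (Suc q) w))"
proof -
  have hdw: "hd w \<in> S" using words_tl[OF w] by simp
  have Fw: "F (take p w) \<in> S" using w by (intro valuedD[OF F] words_take) auto
  have "insertion (Suc p) q (\<lambda>v. F (take p v) \<cdot> hd (drop p v)) K w
    = insertion p q F K (take (p + q) w) \<cdot> hd (drop (p + q) w) + signed (p * q) (F (take p w) \<cdot> K (drop p w))"
    using insert_all_split[of 1 "\<lambda>a v. a \<cdot> hd v" q K p F w "\<lambda>_. 0"] K F w Fw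
      words_tl[of "drop p w" S q] words_drop[of w S p "Suc q"]
    by (simp add: mul_add_left mul_0[OF mul_in] take_all words_length)
  moreover have "insertion (Suc p) q (\<lambda>v. hd v \<cdot> F (tl v)) K w
    = K (take (Suc q) w) \<cdot> F (drop (Suc q) w) + signed q (hd w \<cdot> insertion p q F K (tl w))"
    using insert_all_comp[OF hdw] by simp
  moreover have "insertion (Suc p) q (ad_cochain p F) K w = insertion (Suc p) q (\<lambda>v. F (take p v) \<cdot> hd (drop p v)) K w
     - signed p (insertion (Suc p) q (\<lambda>v. hd v \<cdot> F (tl v)) K w)"
  proof -
    have "ad_cochain p F = (\<lambda>v. F (take p v) \<cdot> hd (drop p v) + signed (Suc p) (hd v \<cdot> F (tl v)))"
      by (simp add: fun_eq_iff ad_cochain_def signed_def)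
    then have "insertion (Suc p) q (ad_cochain p F) K w = insertion (Suc p) q (\<lambda>v. F (take p v) \<cdot> hd (drop p v)) K w
     + signed (Suc p) (insertion (Suc p) q (\<lambda>v. hd v \<cdot> F (tl v)) K w)"
      by (simp only: insert_all_add insert_all_signed)
    then show ?thesis by (simp add: signed_def)
  qed
  ultimately show ?thesis
    by (simp add: ad_cochain_def signed_add signed_signed algebra_simps)
qed

text \<open>The failure of \<open>F \<mapsto> [F, x]\<close> to turn \<open>\<circledcirc>\<close> into
  insertion.\<close>

definition defect :: "nat \<Rightarrow> nat \<Rightarrow> ('a list \<Rightarrow> 'a) \<Rightarrow> ('a list \<Rightarrow> 'a) \<Rightarrow> ('a list \<Rightarrow> 'a)" where
  "defect p q F G w = insertion (Suc p) q (ad_cochain p F) (ad_cochain q G) w - ad_cochain (p + q) (circ p q F G) w"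

lemma defect_in:
  assumes "valued p F" "valued q G"
  shows "valued (Suc (p + q)) (defect p q F G)"
  using insert_all_in[OF ad_cochain_in[OF assms(1)] ad_cochain_in[OF assms(2)] zero_valued]
    ad_cochain_in[OF insert_all_in[OF assms(1) ad_cochain_in[OF assms(2)] assms(2)]]
  by (auto simp: defect_def valued_def circ_def intro!: diff_in)

text \<open>The terms with insertions cancel, and so do those in which the single letter comes last.\<close>

lemma defect_eq:
  assumes F: "valued p F" and G: "valued q G" and w: "w \<in> words S (Suc (p + q))"
  shows "defect p q F G w =
      signed (p * q + p + q) (hd w \<cdot> F (take p (tl w)) \<cdot> G (drop (Suc p) w))
    + signed (p + q) (hd w \<cdot> G (take q (tl w)) \<cdot> F (drop (Suc q) w))
    - signed (p * q + q) (F (take p w) \<cdot> hd (drop p w) \<cdot> G (drop (Suc p) w))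
    - signed p (G (take q w) \<cdot> hd (drop q w) \<cdot> F (drop (Suc q) w))"
proof -
  have hdw: "hd w \<in> S" "tl w \<in> words S (p + q)" using words_tl[OF w] by auto
  have Fw: "F (take p w) \<in> S" using w by (intro valuedD[OF F] words_take) auto
  have tp: "take (p + q) w \<in> words S (p + q)" using w by (rule words_take) simp
  have "ad_cochain (p + q) (circ p q F G) w = ad_cochain (p + q) (insertion p q F (ad_cochain q G)) w
     + signed (p * q) (F (take p w) \<cdot> G (take q (drop p w)) \<cdot> hd (drop (p + q) w)
     - signed (p + q) (hd w \<cdot> F (take p (tl w)) \<cdot> G (drop p (tl w))))"
    unfolding ad_cochain_def[of "p + q"] circ_eq[OF F tp] circ_eq[OF F hdw(2)]
    by (simp add: mul_add_left mul_signed_left signed_add signed_diff signed_signed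
        mul_add_right[OF hdw(1)] mul_signed_right[OF hdw(1)] drop_take mul_assoc algebra_simps)
  moreover have "insertion (Suc p) q (ad_cochain p F) (ad_cochain q G) w
     = ad_cochain (p + q) (insertion p q F (ad_cochain q G)) w
      + signed (p * q) (F (take p w) \<cdot> G (take q (drop p w)) \<cdot> hd (drop (p + q) w)
          - signed q (F (take p w) \<cdot> hd (drop p w) \<cdot> G (drop (Suc p) w)))
      - signed p (G (take q w) \<cdot> hd (drop q w) \<cdot> F (drop (Suc q) w)
          - signed q (hd w \<cdot> G (take q (tl w)) \<cdot> F (drop (Suc q) w)))"
  proof -
    have "ad_cochain q G (drop p w) = G (take q (drop p w)) \<cdot> hd (drop (p + q) w) - signed q (hd (drop p w) \<cdot> G (drop (Suc p) w))"
      by (simp add: ad_cochain_def drop_Suc tl_drop add.commute)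
    moreover have "ad_cochain q G (take (Suc q) w) = G (take q w) \<cdot> hd (drop q w) - signed q (hd w \<cdot> G (take q (tl w)))"
    proof -
      have "w \<noteq> []" "q < length w" using w by (auto simp: words_def)
      then show ?thesis by (simp add: ad_cochain_def tl_take hd_drop_conv_nth)
    qed
    ultimately show ?thesis
      unfolding insertion_ad_cochain[OF F ad_cochain_in[OF G] w]
      by (simp add: mul_diff_right[OF Fw] mul_signed_right[OF Fw] mul_diff_left mul_signed_left mul_assoc)
  qed
  ultimately show ?thesis
    by (simp add: defect_def signed_diff signed_signed drop_Suc algebra_simps)
qed

lemma defect_sym:
  assumes F: "valued p F" and G: "valued q G" and w: "w \<in> words S (Suc (p + q))"
  shows "defect p q F G w = signed (p * q) (defect q p G F w)"
proof -
  have w': "w \<in> words S (Suc (q + p))" using w by (simp add: add.commute)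
  show ?thesis
    unfolding defect_eq[OF F G w] defect_eq[OF G F w']
    by (cases "even p"; cases "even q") (simp_all add: signed_def)
qed

lemma circ_Suc:
  "circ (Suc n) q H G w = H (ad_cochain q G (take (Suc q) w) # drop (Suc q) w)
     + signed q (circ n q (\<lambda>v. H (hd w # v)) G (tl w))"
  by (simp add: circ_def)

text \<open>After \<open>F\<close> is applied at the first letter, \<open>G\<close> enters either the
  commutator of \<open>F\<close> or the arguments behind it; if the first letter is passed on
  instead, \<open>G\<close> may be applied there or also later. In the second and third summand
  \<open>F\<close> and \<open>G\<close> occupy disjoint arguments of \<open>H\<close>.\<close>

lemma circ_circ_Suc:
  assumes H: "multiadditive (Suc n) H" and F: "valued p F" and G: "valued q G"
    and w: "w \<in> words S (Suc (n + p + q))"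
  shows "circ (Suc n + p) q (circ (Suc n) p H F) G w =
      H (insertion (Suc p) q (ad_cochain p F) (ad_cochain q G) (take (Suc (p + q)) w) # drop (Suc (p + q)) w)
    + signed (p * q + q) (circ n q (\<lambda>v. H (ad_cochain p F (take (Suc p) w) # v)) G (drop (Suc p) w))
    + signed p (circ n p (\<lambda>v. H (ad_cochain q G (take (Suc q) w) # v)) F (drop (Suc q) w))
    + signed (p + q) (circ (n + p) q (circ n p (\<lambda>v. H (hd w # v)) F) G (tl w))"
proof -
  let ?F = "ad_cochain p F" and ?G = "ad_cochain q G"
  let ?K1 = "\<lambda>v. H (?F (take (Suc p) v) # drop (Suc p) v)"
  let ?K2 = "\<lambda>v. signed p (circ n p (\<lambda>u. H (hd v # u)) F (tl v))"
  have "circ (Suc n) p H F = (\<lambda>v. ?K1 v + ?K2 v)"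
    by (rule ext) (simp add: circ_def)
  then have "circ (Suc n + p) q (circ (Suc n) p H F) G w =
      insert_all (Suc n + p) q ?G G ?K1 w + insert_all (Suc n + p) q ?G G ?K2 w"
    by (simp only: circ_def[of "Suc n + p"] insert_all_add)
  also have "insert_all (Suc n + p) q ?G G ?K1 w =
      H (insertion (Suc p) q ?F ?G (take (Suc (p + q)) w) # drop (Suc (p + q)) w)
    + signed (p * q + q) (circ n q (\<lambda>v. H (?F (take (Suc p) w) # v)) G (drop (Suc p) w))"
    using insert_all_split[of n "\<lambda>a v. H (a # v)" q ?G "Suc p" ?F w G]
      multiadditive_add[OF H] ad_cochain_in[OF F] ad_cochain_in[OF G] w
    by (simp add: circ_def add.commute add.left_commute del: insert_all.simps)
  also have "insert_all (Suc n + p) q ?G G ?K2 w =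
      signed p (circ n p (\<lambda>v. H (?G (take (Suc q) w) # v)) F (drop (Suc q) w))
    + signed (p + q) (circ (n + p) q (circ n p (\<lambda>v. H (hd w # v)) F) G (tl w))"
    by (simp add: insert_all_signed signed_add signed_signed circ_def[of "n + p"] add.commute)
  finally show ?thesis by (simp add: add.assoc)
qed

lemma multiadditive_head_diff:
  assumes H: "multiadditive (Suc n) H" and v: "v \<in> words S n" and "a \<in> S" "b \<in> S"
  shows "H (a # v) = H (b # v) + H ((a - b) # v)"
  using multiadditive_add[OF H v, of b "a - b"] assms(3,4) diff_in by simp

text \<open>Induction on the arity of \<open>H\<close>. The associator at the first letter consists of the defect of
  \<open>F\<close> and \<open>G\<close>, which is graded symmetric by \<open>defect_sym\<close>, of the two summands with disjoint
  insertions, which \<open>F\<close> and \<open>G\<close> exchange, and of the associator for the remaining arguments. In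
  arity \<open>0\<close> the product with \<open>H\<close> is left multiplication and the associator vanishes.\<close>

theorem circ_pre_Lie:
  assumes H: "multiadditive n H" and F: "valued p F" and G: "valued q G"
    and w: "w \<in> words S (n + p + q)"
  shows "circ (n + p) q (circ n p H F) G w - circ n (p + q) H (circ p q F G) w
    = signed (p * q) (circ (n + q) p (circ n q H G) F w - circ n (q + p) H (circ q p G F) w)"
  using H w
proof (induction n arbitrary: H w)
  case 0
  have "H [] \<in> S" using 0(1) by simp
  note c = insert_all_comp[OF this]
  have "insert_all 0 r K F H = (\<lambda>w. H [] \<cdot> F w)" for r K F by (rule ext) simp
  then show ?case by (simp add: circ_def c)
next
  case (Suc n)
  from Suc.prems(2) have w: "w \<in> words S (Suc (n + p + q))" "w \<in> words S (Suc (n + q + p))"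
    by (simp_all add: ac_simps)
  have hdw: "hd w \<in> S" "tl w \<in> words S (n + p + q)" using words_tl[OF w(1)] by auto
  have u: "take (Suc (p + q)) w \<in> words S (Suc (p + q))"
    using w(1) by (rule words_take) simp
  have v: "drop (Suc (p + q)) w \<in> words S n"
    using w(1) words_drop[of w _ "Suc (p + q)" n] by (simp add: ac_simps)
  define u' where "u' = take (Suc (p + q)) w"
  define v' where "v' = drop (Suc (p + q)) w"
  define X where "X = H (ad_cochain (p + q) (circ p q F G) u' # v')"
  define Y where "Y = H (ad_cochain (q + p) (circ q p G F) u' # v')"
  define D where "D = H (defect q p G F u' # v')"
  have split: "H (insertion (Suc p) q (ad_cochain p F) (ad_cochain q G) u' # v') =
      H (ad_cochain (p + q) (circ p q F G) u' # v') + H (defect p q F G u' # v')"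
    if F: "valued p F" and G: "valued q G" and u: "u' \<in> words S (Suc (p + q))" for p q F G
    unfolding defect_def
    using v u insert_all_in[OF ad_cochain_in[OF F] ad_cochain_in[OF G] zero_valued]
      ad_cochain_in[OF insert_all_in[OF F ad_cochain_in[OF G] G]]
    by (intro multiadditive_head_diff[OF Suc.prems(1)]) (auto simp: v'_def circ_def valued_def)
  have Hv: "H ((a + b) # v') = H (a # v') + H (b # v')" if "a \<in> S" "b \<in> S" for a b
    using multiadditive_add[OF Suc.prems(1) v] that by (simp add: v'_def)
  have u1: "u' \<in> words S (Suc (q + p))" using u by (simp add: u'_def add.commute)
  have u2: "u' \<in> words S (Suc (p + q))" using u by (simp add: u'_def)
  have "H (defect p q F G u' # v') = signed (p * q) D"
    unfolding D_def defect_sym[OF F G u2]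
    using valuedD[OF defect_in[OF G F] u1] by (intro additive_signed[of "\<lambda>a. H (a # v')"] Hv)
  then have X: "H (insertion (Suc p) q (ad_cochain p F) (ad_cochain q G) u' # v') = X + signed (p * q) D"
    using split[OF F G u2] by (simp add: X_def)
  have Y: "H (insertion (Suc q) p (ad_cochain q G) (ad_cochain p F) u' # v') = Y + D"
    using split[OF G F u1] by (simp add: Y_def D_def)
  define R R' S S' where "R = circ (n + p) q (circ n p (\<lambda>v. H (hd w # v)) F) G (tl w)"
    and "R' = circ n (p + q) (\<lambda>v. H (hd w # v)) (circ p q F G) (tl w)"
    and "S = circ (n + q) p (circ n q (\<lambda>v. H (hd w # v)) G) F (tl w)"
    and "S' = circ n (q + p) (\<lambda>v. H (hd w # v)) (circ q p G F) (tl w)"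
  have "R - R' = signed (p * q) (S - S')"
    unfolding R_def R'_def S_def S'_def
    by (rule Suc.IH[OF multiadditive_Cons[OF Suc.prems(1) hdw(1)] hdw(2)])
  then have R: "R = R' + signed (p * q) (S - S')" by (simp add: algebra_simps)
  define U V where "U = circ n q (\<lambda>v. H (ad_cochain p F (take (Suc p) w) # v)) G (drop (Suc p) w)"
    and "V = circ n p (\<lambda>v. H (ad_cochain q G (take (Suc q) w) # v)) F (drop (Suc q) w)"
  have 1: "circ (Suc n + p) q (circ (Suc n) p H F) G w
      = X + signed (p * q) D + signed (p * q + q) U + signed p V + signed (p + q) R"
    unfolding circ_circ_Suc[OF Suc.prems(1) F G w(1)] R_def U_def V_def
    using X by (simp add: u'_def v'_def)
  have 2: "circ (Suc n + q) p (circ (Suc n) q H G) F w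
      = Y + D + signed (q * p + p) V + signed q U + signed (q + p) S"
    unfolding circ_circ_Suc[OF Suc.prems(1) G F w(2)] S_def U_def V_def
    using Y by (simp add: u'_def v'_def add.commute)
  have 3: "circ (Suc n) (p + q) H (circ p q F G) w = X + signed (p + q) R'"
    by (simp add: circ_Suc X_def R'_def u'_def v'_def)
  have 4: "circ (Suc n) (q + p) H (circ q p G F) w = Y + signed (q + p) S'"
    by (simp add: circ_Suc Y_def S'_def u'_def v'_def add.commute[of q p])
  show ?case unfolding 1 2 3 4 R
    by (cases "even p"; cases "even q") (simp_all add: signed_def algebra_simps)
qed

section \<open>The Jacobi identity\<close>

lemma ad_cochain_cong:
  assumes "\<And>v. v \<in> words S q \<Longrightarrow> G v = G' v" and w: "w \<in> words S (Suc q)"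
  shows "ad_cochain q G w = ad_cochain q G' w"
  using words_tl[OF w] words_take[OF w, of q] by (simp add: ad_cochain_def assms(1))

lemma inserted_word:
  assumes "valued q G" "w \<in> words S (Suc p + q)"
  shows "ad_cochain q G (take (Suc q) w) \<in> S" "drop (Suc q) w \<in> words S p" "tl w \<in> words S (p + q)" "hd w \<in> S"
  using valuedD[OF ad_cochain_in[OF assms(1)] words_take[OF assms(2)]] words_drop[of w S "Suc q" p]
    words_tl[of w S "p + q"] assms(2) by (auto simp: add.commute)

lemma circ_cong:
  assumes F: "\<And>v. v \<in> words S p \<Longrightarrow> F v = F' v" and G: "\<And>v. v \<in> words S q \<Longrightarrow> G v = G' v"
    and G_in: "valued q G" and w: "w \<in> words S (p + q)"
  shows "circ p q F G w = circ p q F' G' w"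
  using F w
proof (induction p arbitrary: F F' w)
  case 0 then show ?case by (simp add: circ_def G)
next
  case (Suc p)
  note i = inserted_word[OF G_in Suc.prems(2)]
  have "ad_cochain q G (take (Suc q) w) = ad_cochain q G' (take (Suc q) w)"
    using Suc.prems(2) by (intro ad_cochain_cong G words_take) auto
  moreover have "circ p q (\<lambda>v. F (hd w # v)) G (tl w) = circ p q (\<lambda>v. F' (hd w # v)) G' (tl w)"
    using i Suc.prems(1) by (intro Suc.IH) auto
  ultimately show ?case using i Suc.prems(1) by (simp add: circ_Suc)
qed

lemma circ_diff_left: "circ p q (\<lambda>v. F v - signed k (F' v)) G w = circ p q F G w - signed k (circ p q F' G w)"
proof -
  have "(\<lambda>v. F v - signed k (F' v)) = (\<lambda>v. F v + signed (Suc k) (F' v))"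
    by (simp add: fun_eq_iff signed_def)
  then show ?thesis
    by (simp only: circ_def insert_all_add insert_all_signed) (simp add: signed_def)
qed

lemma circ_diff_right:
  assumes F: "multiadditive p F" and G: "valued q G" "valued q G'" and w: "w \<in> words S (p + q)"
  shows "circ p q F (\<lambda>v. G v - signed k (G' v)) w = circ p q F G w - signed k (circ p q F G' w)"
  using F w
proof (induction p arbitrary: F w)
  case 0
  then show ?case by (simp add: circ_def mul_diff_right mul_signed_right)
next
  case (Suc p)
  note i = inserted_word[OF G(1) Suc.prems(2)] and i' = inserted_word[OF G(2) Suc.prems(2)]
  define a b where "a = ad_cochain q G (take (Suc q) w)" and "b = ad_cochain q G' (take (Suc q) w)"
  have "take (Suc q) w \<in> words S (Suc q)" using Suc.prems(2) by (rule words_take) simp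
  then have hd: "hd (take (Suc q) w) \<in> S" using words_tl by blast
  have "ad_cochain q (\<lambda>v. G v - signed k (G' v)) (take (Suc q) w) = a + signed (Suc k) b"
    using mul_diff_right[OF hd] mul_signed_right[OF hd]
    by (simp only: ad_cochain_def a_def b_def mul_diff_left mul_signed_left)
      (cases "even k"; cases "even q"; simp add: signed_def)
  moreover have "F ((a + signed (Suc k) b) # drop (Suc q) w) = F (a # drop (Suc q) w) + F (signed (Suc k) b # drop (Suc q) w)"
    using i i' by (intro multiadditive_add[OF Suc.prems(1)]) (simp_all add: a_def b_def signed_in)
  moreover have "F (signed (Suc k) b # drop (Suc q) w) = signed (Suc k) (F (b # drop (Suc q) w))"
    using i i' by (intro additive_signed[of "\<lambda>x. F (x # drop (Suc q) w)"] multiadditive_add[OF Suc.prems(1)]) (simp_all add: b_def)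
  moreover have "circ p q (\<lambda>v. F (hd w # v)) (\<lambda>v. G v - signed k (G' v)) (tl w)
     = circ p q (\<lambda>v. F (hd w # v)) G (tl w) - signed k (circ p q (\<lambda>v. F (hd w # v)) G' (tl w))"
    using i Suc.prems(1) by (intro Suc.IH multiadditive_Cons) auto
  ultimately show ?case
    unfolding circ_Suc a_def[symmetric] b_def[symmetric]
    by (cases "even k"; cases "even q") (simp_all add: signed_def)
qed

definition bracket :: "nat \<Rightarrow> nat \<Rightarrow> ('a list \<Rightarrow> 'a) \<Rightarrow> ('a list \<Rightarrow> 'a) \<Rightarrow> 'a list \<Rightarrow> 'a" where
  "bracket p q F G w = circ p q F G w - signed (p * q) (circ q p G F w)"

lemma circ_in: "valued p F \<Longrightarrow> valued q G \<Longrightarrow> valued (p + q) (circ p q F G)"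
  using insert_all_in ad_cochain_in by (simp add: circ_def)

lemma bracket_cong:
  assumes "\<And>v. v \<in> words S p \<Longrightarrow> F v = F' v" "\<And>v. v \<in> words S q \<Longrightarrow> G v = G' v"
    and "valued p F" "valued q G" "w \<in> words S (p + q)"
  shows "bracket p q F G w = bracket p q F' G' w"
proof -
  have "circ p q F G w = circ p q F' G' w" by (rule circ_cong) (use assms in auto)
  moreover have "circ q p G F w = circ q p G' F' w" by (rule circ_cong) (use assms in \<open>auto simp: add.commute\<close>)
  ultimately show ?thesis by (simp add: bracket_def)
qed

text \<open>Each double bracket consists of four iterated products. Three instances of
  \<open>circ_pre_Lie\<close> rewrite the products that are nested on the left with third factor
  \<open>H\<close> (twice) or \<open>G\<close> (once); afterwards all terms cancel.\<close>

theorem bracket_Jacobi: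
  assumes F: "multiadditive p F" and G: "multiadditive q G" and H: "multiadditive r H"
    and w: "w \<in> words S (p + q + r)"
  shows "bracket p (q + r) F (bracket q r G H) w =
    bracket (p + q) r (bracket p q F G) H w + signed (p * q) (bracket q (p + r) G (bracket p r F H) w)"
proof -
  note vF = multiadditive_valued[OF F] and vG = multiadditive_valued[OF G] and vH = multiadditive_valued[OF H]
  have ws: "w \<in> words S (p + (q + r))" "w \<in> words S (q + (p + r))" "w \<in> words S (r + (p + q))"
    "w \<in> words S (q + p + r)" "w \<in> words S (r + p + q)"
    using w by (simp_all add: ac_simps)
  have expand: "bracket k (l + m) X (bracket l m Y Z) w
     = (circ k (l + m) X (circ l m Y Z) w - signed (l * m) (circ k (l + m) X (circ m l Z Y) w))
      - signed (k * (l + m)) (circ (l + m) k (circ l m Y Z) X w - signed (l * m) (circ (l + m) k (circ m l Z Y) X w))"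
    if "multiadditive k X" "valued l Y" "valued m Z" "w \<in> words S (k + (l + m))" for k l m X Y Z
    using that circ_in[OF that(2,3)] circ_in[OF that(3,2)]
    unfolding bracket_def by (subst circ_diff_right) (auto simp: circ_diff_left add.commute)
  \<comment> \<open>Antisymmetry brings the bracket nested on the left into the form covered by \<open>expand\<close>.\<close>
  have swap: "bracket (p + q) r (bracket p q F G) H w = - signed (r * (p + q)) (bracket r (p + q) H (bracket p q F G) w)"
    by (simp add: bracket_def[of "p + q"] bracket_def[of r] signed_diff signed_signed mult.commute)
      (simp add: signed_def)
  note 1 = circ_pre_Lie[OF F vG vH w] and 2 = circ_pre_Lie[OF G vF vH ws(4)] and 3 = circ_pre_Lie[OF H vF vG ws(5)]
  have eqs: "circ (p + q) r (circ p q F G) H w = circ p (q + r) F (circ q r G H) w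
      + signed (q * r) (circ (p + r) q (circ p r F H) G w - circ p (q + r) F (circ r q H G) w)"
    "circ (p + q) r (circ q p G F) H w = circ q (p + r) G (circ p r F H) w
      + signed (p * r) (circ (q + r) p (circ q r G H) F w - circ q (p + r) G (circ r p H F) w)"
    "circ (p + r) q (circ r p H F) G w = circ r (p + q) H (circ p q F G) w
      + signed (p * q) (circ (q + r) p (circ r q H G) F w - circ r (p + q) H (circ q p G F) w)"
    using 1 2 3 by (simp_all add: algebra_simps)
  show ?thesis
    unfolding swap expand[OF F vG vH ws(1)] expand[OF G vF vH ws(2)] expand[OF H vF vG ws(3)] eqs
    by (cases "even p"; cases "even q"; cases "even r") (simp_all add: signed_def algebra_simps)
qed

lemma insertion_sum:
  assumes "valued p F" "w \<in> words S (p + q)"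
  shows "insertion p q F K w
    = (\<Sum>i<p. signed (i * q) (F (take i w @ [K (take (Suc q) (drop i w))] @ drop (i + Suc q) w)))"
  using assms
proof (induction p arbitrary: F w)
  case 0
  then show ?case using valuedD[OF 0(1)] by (simp add: mul_0)
next
  case (Suc p)
  obtain x w' where xw: "w = x # w'" "x \<in> S" "w' \<in> words S (p + q)"
    using Suc.prems(2) by (cases w) auto
  show ?case
    using Suc.IH[OF valued_Cons[OF Suc.prems(1) xw(2)] xw(3)]
    unfolding sum.lessThan_Suc_shift by (simp add: xw signed_sum signed_signed)
qed

end

context fd_space begin

section \<open>Graded Lie algebra structures\<close>

sublocale R: additive_product "End scale" "(\<circ>)"
proof
  show "0 \<in> End scale" by (rule A.subspace_0[OF End_subspace])
  show "a + b \<in> End scale" if "a \<in> End scale" "b \<in> End scale" for a b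
    using that by (rule A.subspace_add[OF End_subspace])
  show "- a \<in> End scale" if "a \<in> End scale" for a
    using that by (rule A.subspace_neg[OF End_subspace])
qed (auto simp: End_comp End_add fun_eq_iff)

lemma scale_sign: "pointwise scale ((-1) ^ k) f = signed k f"
  by (auto simp: pointwise_def signed_def fun_eq_iff)

lemma cochain_multiadditive: "F \<in> cochains p \<Longrightarrow> R.multiadditive p F"
proof -
  have "(\<forall>w\<in>ends p. F w \<in> End scale) \<Longrightarrow>
    multilinear_on (pointwise scale) (End scale) p (pointwise scale) F \<Longrightarrow> R.multiadditive p F" for F
  proof (induction p arbitrary: F)
    case (Suc p)
    then show ?case
      using linear_on_add[OF multilinear_on_Cons(1)[OF Suc.prems(2)]] multilinear_on_Cons(2)[OF Suc.prems(2)]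
      by auto
  qed simp
  then show "F \<in> cochains p \<Longrightarrow> R.multiadditive p F" by (simp add: multilin_maps_iff)
qed

text \<open>The sum over the positions of the inserted commutator splits by additivity of \<open>F\<close>
  into the two sums of \<open>F \<circledcirc> G\<close>.\<close>

lemma rb_circ_circ:
  assumes F: "F \<in> cochains p" and G: "G \<in> cochains q" and xs: "xs \<in> ends (p + q)"
  shows "rb_circ scale p q F G xs = R.circ p q F G xs"
proof -
  note vF = R.multiadditive_valued[OF cochain_multiadditive[OF F]]
  have "left_part p q F G xs - right_part p q F G xs =
    (\<Sum>i<p. signed (i * q) (F (take i xs @ [G (take q (drop i xs)) \<circ> (xs ! (i + q))] @ drop (i + Suc q) xs)))
    - (\<Sum>i<p. signed (Suc i * q) (F (take i xs @ [(xs ! i) \<circ> G (take q (drop (Suc i) xs))] @ drop (i + Suc q) xs)))"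
    unfolding left_part_def right_part_def scale_sign
    by (intro arg_cong2[of _ _ _ _ "(-)"] sum.reindex_bij_witness[of _ Suc "\<lambda>i. i - 1"]) auto
  also have "\<dots> = R.insertion p q F (R.ad_cochain q G) xs"
    unfolding R.insertion_sum[OF vF xs] sum_subtractf[symmetric]
  proof (rule sum.cong[OF refl])
    fix i assume i: "i \<in> {..<p}"
    let ?u = "take i xs" and ?v = "drop (i + Suc q) xs"
    let ?a = "G (take q (drop i xs)) \<circ> (xs ! (i + q))" and ?b = "(xs ! i) \<circ> G (take q (drop (Suc i) xs))"
    note len = words_length[OF xs]
    have "set (take q (drop j xs)) \<subseteq> End scale" for j
      using xs by (auto simp: words_def dest!: in_set_takeD in_set_dropD)
    then have "take q (drop j xs) \<in> ends q" if "j \<le> p" for j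
      using that len by (simp add: words_def)
    then have Gj: "G (take q (drop j xs)) \<in> End scale" if "j \<le> p" for j
      using that cochain_in[OF G] by blast
    have xj: "xs ! j \<in> End scale" if "j < p + q" for j
      using xs that by (auto simp: words_def)
    have ab: "?a \<in> End scale" "?b \<in> End scale"
      using i by (auto intro!: End_comp Gj xj)
    have ad: "R.ad_cochain q G (take (Suc q) (drop i xs)) = ?a - signed q ?b"
      using i len by (simp add: R.ad_cochain_def hd_drop_conv_nth tl_take drop_take tl_drop drop_Suc[symmetric] add.commute min_def)
    have uv: "set ?u \<subseteq> End scale" "set ?v \<subseteq> End scale" "Suc (length ?u + length ?v) = p"
      using i len xs by (auto simp: words_def dest!: in_set_takeD in_set_dropD)
    have "F (?u @ (?a - signed q ?b) # ?v) = F (?u @ ?a # ?v) - F (?u @ signed q ?b # ?v)"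
      using ab by (intro cochain_diff[OF F uv] R.signed_in)
    also have "F (?u @ signed q ?b # ?v) = signed q (F (?u @ ?b # ?v))"
    proof -
      have "linear_on (pointwise scale) (End scale) (pointwise scale) (\<lambda>x. F (?u @ x # ?v))"
        using F uv by (intro multilinear_onD) (auto simp: multilin_maps_iff)
      from linear_on_scale[OF this ab(2), of "(-1) ^ q"] show ?thesis by (simp add: scale_sign)
    qed
    finally have E: "F (?u @ (?a - signed q ?b) # ?v) = F (?u @ ?a # ?v) - signed q (F (?u @ ?b # ?v))" .
    show "signed (i * q) (F (?u @ [?a] @ ?v)) - signed (Suc i * q) (F (?u @ [?b] @ ?v))
      = signed (i * q) (F (?u @ [R.ad_cochain q G (take (Suc q) (drop i xs))] @ ?v))"
      unfolding ad append_Cons append_Nil E signed_diff signed_signed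
      by (simp only: mult_Suc add.commute[of q])
  qed
  finally show ?thesis
    by (simp add: rb_circ_eq[OF xs] R.circ_eq[OF vF xs] scale_sign)
qed

lemma rb_bracket_bracket:
  assumes F: "F \<in> cochains p" and G: "G \<in> cochains q" and xs: "xs \<in> ends (p + q)"
  shows "rb_bracket scale p q F G xs = R.bracket p q F G xs"
  using rb_circ_circ[OF F G xs] rb_circ_circ[OF G F] xs
  by (simp add: rb_bracket_eq[OF F G] R.bracket_def pointwise_def[of "pointwise scale"] scale_sign add.commute)

text \<open>Cyclicity of the bracket is inherited from the double Lie side, through \<open>\<Psi>\<close>.\<close>

lemma rb_bracket_in:
  assumes "F \<in> C_rb scale B p" "G \<in> C_rb scale B q"
  shows "rb_bracket scale p q F G \<in> C_rb scale B (p + q)"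
proof -
  obtain P Q where P: "P \<in> C_dL scale p" "F = \<Psi> p P" and Q: "Q \<in> C_dL scale q" "G = \<Psi> q Q"
    using assms Psi_bij unfolding bij_betw_def by blast
  have "rb_bracket scale p q F G = \<Psi> (p + q) (dL_bracket scale p q P Q)"
    using Psi_bracket[OF P(1) Q(1)] by (simp add: P Q)
  also have "\<dots> \<in> C_rb scale B (p + q)"
    using bracket_in[OF P(1) Q(1)] Psi_bij unfolding bij_betw_def by blast
  finally show ?thesis .
qed

lemma rb_Jacobi:
  assumes F: "F \<in> C_rb scale B p" and G: "G \<in> C_rb scale B q" and H: "H \<in> C_rb scale B r"
  shows "rb_bracket scale p (q + r) F (rb_bracket scale q r G H) =
    rb_bracket scale (p + q) r (rb_bracket scale p q F G) H
    + cscale scale ((-1) ^ (p * q)) (rb_bracket scale q (p + r) G (rb_bracket scale p r F H))"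
proof
  fix xs
  note c = C_rb_cochain[OF F] C_rb_cochain[OF G] C_rb_cochain[OF H]
  note b = C_rb_cochain[OF rb_bracket_in[OF G H]] C_rb_cochain[OF rb_bracket_in[OF F G]] C_rb_cochain[OF rb_bracket_in[OF F H]]
  note m = c[THEN cochain_multiadditive]
  have v: "R.valued k X" if "X \<in> cochains k" for k X
    using R.multiadditive_valued cochain_multiadditive that by blast
  show "rb_bracket scale p (q + r) F (rb_bracket scale q r G H) xs =
    (rb_bracket scale (p + q) r (rb_bracket scale p q F G) H
    + cscale scale ((-1) ^ (p * q)) (rb_bracket scale q (p + r) G (rb_bracket scale p r F H))) xs"
  proof (cases "xs \<in> ends (p + q + r)")
    case True
    then have w: "xs \<in> ends (p + (q + r))" "xs \<in> ends (q + (p + r))"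
      by (simp_all add: ac_simps)
    have "rb_bracket scale p (q + r) F (rb_bracket scale q r G H) xs = R.bracket p (q + r) F (R.bracket q r G H) xs"
      unfolding rb_bracket_bracket[OF c(1) b(1) w(1)]
      by (rule R.bracket_cong) (use c b w v in \<open>auto simp: rb_bracket_bracket\<close>)
    moreover have "rb_bracket scale (p + q) r (rb_bracket scale p q F G) H xs = R.bracket (p + q) r (R.bracket p q F G) H xs"
      unfolding rb_bracket_bracket[OF b(2) c(3) True]
      by (rule R.bracket_cong) (use c b True v in \<open>auto simp: rb_bracket_bracket\<close>)
    moreover have "rb_bracket scale q (p + r) G (rb_bracket scale p r F H) xs = R.bracket q (p + r) G (R.bracket p r F H) xs"
      unfolding rb_bracket_bracket[OF c(2) b(3) w(2)]
      by (rule R.bracket_cong) (use c b w v in \<open>auto simp: rb_bracket_bracket\<close>)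
    ultimately show ?thesis
      using R.bracket_Jacobi[OF m True] by (simp add: pointwise_def[of "pointwise scale"] scale_sign)
  next
    case False
    have 0: "rb_bracket scale k l X Y xs = 0"
      if "X \<in> C_rb scale B k" "Y \<in> C_rb scale B l" "k + l = p + q + r" for k l X Y
      using C_rb_cochain[OF rb_bracket_in[OF that(1,2)]] False that(3) by (simp add: multilin_maps_iff)
    show ?thesis
      using 0[OF F rb_bracket_in[OF G H]] 0[OF rb_bracket_in[OF F G] H] 0[OF G rb_bracket_in[OF F H]]
      by (simp add: pointwise_def[of "pointwise scale"] scale_sign add.assoc add.left_commute)
  qed
qed

lemma coef_box:
  assumes P: "P \<in> tensor_end scale (Suc p)" and Q: "Q \<in> tensor_end scale (Suc q)"
    and w: "w \<in> idx (Suc (p + q))"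
  shows "coef (dL_box scale p q P Q) w = rot_sum (p + q) (coef (dL_diamond scale p q P Q)) w"
proof -
  have "coef ((conj_sigma (Suc (p + q)) ^^ s) D) w = coef D (rotate s w)"
    if "D \<in> tensor_end scale (Suc (p + q))" for D s
    using w
  proof (induction s arbitrary: w)
    case (Suc s)
    then show ?case
      using coef_conj_sigma[OF conj_sigma_pow_in[OF that] Suc.prems, of s] by (simp add: rotate1_rotate_swap)
  qed simp
  then show ?thesis
    by (simp add: box_eq coef_sum_scale rot_sum_def diamond_in[OF P Q])
qed

lemma coef_diamond_bilinear:
  assumes w: "w \<in> idx (Suc (p + q))"
    and P: "P \<in> tensor_end scale (Suc p)" "P' \<in> tensor_end scale (Suc p)"
    and Q: "Q \<in> tensor_end scale (Suc q)" "Q' \<in> tensor_end scale (Suc q)"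
  shows "coef (dL_diamond scale p q (P + P') Q) w = coef (dL_diamond scale p q P Q) w + coef (dL_diamond scale p q P' Q) w" (is ?add_left)
    and "coef (dL_diamond scale p q P (Q + Q')) w = coef (dL_diamond scale p q P Q) w + coef (dL_diamond scale p q P Q') w" (is ?add_right)
    and "coef (dL_diamond scale p q (opscale k P) Q) w = k * coef (dL_diamond scale p q P Q) w" (is ?scale_left)
    and "coef (dL_diamond scale p q P (opscale k Q)) w = k * coef (dL_diamond scale p q P Q) w" (is ?scale_right)
proof -
  interpret O: vector_space "opscale :: 'k \<Rightarrow> ('v, 'k) tensor_op \<Rightarrow> _" by (rule vs_op)
  note sb = O.subspace_add[OF tensor_end_subspace] O.subspace_scale[OF tensor_end_subspace]
  define w1 w2 where "w1 = take p w" and "w2 = drop (Suc p) w"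
  obtain a b where ab: "w ! p = (a, b)" by fastforce
  have weq: "w = w1 @ (a, b) # w2"
    using w id_take_nth_drop[of p w] by (simp add: w1_def w2_def ab words_length)
  have w12: "w1 \<in> idx p" "w2 \<in> idx q"
    using words_take[OF w, of p] words_drop[of w "B \<times> B" "Suc p" q] w by (auto simp: w1_def w2_def)
  have "(a, b) \<in> B \<times> B" using w unfolding weq by (auto simp: words_def)
  then have "a \<in> B" "b \<in> B" by auto
  note cd = coef_diamond[OF _ _ w12 this]
  show ?add_left ?add_right ?scale_left ?scale_right
    using P Q by (simp_all add: weq cd sb coef_add coef_scale sum.distrib ring_distribs sum_distrib_left mult.assoc mult.left_commute)
qed

lemma box_bilinear:
  assumes P: "P \<in> tensor_end scale (Suc p)" "P' \<in> tensor_end scale (Suc p)"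
    and Q: "Q \<in> tensor_end scale (Suc q)" "Q' \<in> tensor_end scale (Suc q)"
  shows "dL_box scale p q (P + P') Q = dL_box scale p q P Q + dL_box scale p q P' Q" (is ?add_left)
    and "dL_box scale p q P (Q + Q') = dL_box scale p q P Q + dL_box scale p q P Q'" (is ?add_right)
    and "dL_box scale p q (opscale k P) Q = opscale k (dL_box scale p q P Q)" (is ?scale_left)
    and "dL_box scale p q P (opscale k Q) = opscale k (dL_box scale p q P Q)" (is ?scale_right)
proof -
  interpret O: vector_space "opscale :: 'k \<Rightarrow> ('v, 'k) tensor_op \<Rightarrow> _" by (rule vs_op)
  note sb = O.subspace_add[OF tensor_end_subspace] O.subspace_scale[OF tensor_end_subspace]
  note bl = coef_diamond_bilinear[OF _ P Q]
  show ?add_left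
    by (rule tensor_end_eqI[of _ "Suc (p + q)"])
      (simp_all add: box_in P Q sb coef_box coef_add, rule rot_sum_add, rule bl, simp)
  show ?add_right
    by (rule tensor_end_eqI[of _ "Suc (p + q)"])
      (simp_all add: box_in P Q sb coef_box coef_add, rule rot_sum_add, rule bl, simp)
  show ?scale_left
    by (rule tensor_end_eqI[of _ "Suc (p + q)"])
      (simp_all add: box_in P Q sb coef_box coef_scale, rule rot_sum_scale, rule bl, simp)
  show ?scale_right
    by (rule tensor_end_eqI[of _ "Suc (p + q)"])
      (simp_all add: box_in P Q sb coef_box coef_scale, rule rot_sum_scale, rule bl, simp)
qed

lemma C_dL_subspace: "module.subspace opscale (C_dL scale p)"
proof -
  interpret O: vector_space "opscale :: 'k \<Rightarrow> ('v, 'k) tensor_op \<Rightarrow> _" by (rule vs_op)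
  show ?thesis unfolding O.subspace_def
    using O.subspace_add[OF tensor_end_subspace] O.subspace_scale[OF tensor_end_subspace] O.subspace_0[OF tensor_end_subspace]
    by (auto simp: C_dL_iff coef_add coef_scale ring_distribs) (simp add: coef_def)
qed

end

section \<open>Transport of graded Lie algebra structures\<close>

lemma subspace_image:
  assumes "vector_space s" "vector_space s'" "module.subspace s L" "f ` L = L'"
    and "\<And>x y. x \<in> L \<Longrightarrow> y \<in> L \<Longrightarrow> f (x + y) = f x + f y" "\<And>c x. x \<in> L \<Longrightarrow> f (s c x) = s' c (f x)"
  shows "module.subspace s' L'"
proof -
  interpret s: vector_space s by fact
  interpret s': vector_space s' by fact
  note sb = s.subspace_add[OF assms(3)] s.subspace_scale[OF assms(3)] s.subspace_0[OF assms(3)]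
  have "f 0 = 0" using assms(5)[OF sb(3) sb(3)] by simp
  then show ?thesis
    unfolding s'.subspace_def using sb by (auto simp flip: assms(4) assms(5) assms(6))
qed

text \<open>Images under the bijections carry closure, bilinearity and antisymmetry from the source to the
  target; injectivity carries the Jacobi identity from the target to the source.\<close>

lemma graded_lie_algebra_iso_transport:
  fixes s :: "'k::field_char_0 \<Rightarrow> 'b::ab_group_add \<Rightarrow> 'b" and s' :: "'k \<Rightarrow> 'c::ab_group_add \<Rightarrow> 'c"
  assumes s: "vector_space s" and s': "vector_space s'" and sub: "\<And>p. module.subspace s (L p)"
    and bij: "\<And>p. bij_betw (f p) (L p) (L' p)"
    and f_add: "\<And>p x y. x \<in> L p \<Longrightarrow> y \<in> L p \<Longrightarrow> f p (x + y) = f p x + f p y"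
    and f_scale: "\<And>p c x. x \<in> L p \<Longrightarrow> f p (s c x) = s' c (f p x)"
    and f_br: "\<And>p q x y. x \<in> L p \<Longrightarrow> y \<in> L q \<Longrightarrow> f (p + q) (br p q x y) = br' p q (f p x) (f q y)"
    and closed: "\<And>p q x y. x \<in> L p \<Longrightarrow> y \<in> L q \<Longrightarrow> br p q x y \<in> L (p + q)"
    and add_left: "\<And>p q x x' y. x \<in> L p \<Longrightarrow> x' \<in> L p \<Longrightarrow> y \<in> L q \<Longrightarrow> br p q (x + x') y = br p q x y + br p q x' y"
    and add_right: "\<And>p q x y y'. x \<in> L p \<Longrightarrow> y \<in> L q \<Longrightarrow> y' \<in> L q \<Longrightarrow> br p q x (y + y') = br p q x y + br p q x y'"
    and scale_left: "\<And>p q c x y. x \<in> L p \<Longrightarrow> y \<in> L q \<Longrightarrow> br p q (s c x) y = s c (br p q x y)"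
    and scale_right: "\<And>p q c x y. x \<in> L p \<Longrightarrow> y \<in> L q \<Longrightarrow> br p q x (s c y) = s c (br p q x y)"
    and antisym: "\<And>p q x y. x \<in> L p \<Longrightarrow> y \<in> L q \<Longrightarrow> br p q x y = - s ((-1) ^ (p * q)) (br q p y x)"
    and Jacobi: "\<And>p q r x y z. x \<in> L' p \<Longrightarrow> y \<in> L' q \<Longrightarrow> z \<in> L' r \<Longrightarrow>
        br' p (q + r) x (br' q r y z) =
        br' (p + q) r (br' p q x y) z + s' ((-1) ^ (p * q)) (br' q (p + r) y (br' p r x z))"
  shows "graded_lie_algebra_iso s L br s' L' br' f"
proof -
  interpret s: vector_space s by fact
  interpret s': vector_space s' by fact
  note sb = s.subspace_add[OF sub] s.subspace_scale[OF sub] s.subspace_neg[OF sub]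
  have im: "f p x \<in> L' p" if "x \<in> L p" for p x using bij that by (auto simp: bij_betw_def)
  have pre: "\<exists>x\<in>L p. x' = f p x" if "x' \<in> L' p" for p x' using bij[of p] that by (auto simp: bij_betw_def)
  have inj: "x = y" if "f p x = f p y" "x \<in> L p" "y \<in> L p" for p x y
    using bij[of p] that by (auto simp: bij_betw_def inj_on_def)
  have f_neg: "f p (- x) = - f p x" if "x \<in> L p" for p x
    using f_scale[OF that, of "-1"] by simp
  have Jac: "br p (q + r) x (br q r y z) =
        br (p + q) r (br p q x y) z + s ((-1) ^ (p * q)) (br q (p + r) y (br p r x z))"
    if "x \<in> L p" "y \<in> L q" "z \<in> L r" for p q r x y z
  proof (rule inj[of "p + q + r"])
    have 1: "br p (q + r) x (br q r y z) \<in> L (p + q + r)"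
      using closed[OF that(1) closed[OF that(2,3)]] by (simp add: add.assoc)
    have 2: "br (p + q) r (br p q x y) z \<in> L (p + q + r)"
      using closed[OF closed[OF that(1,2)] that(3)] .
    have 3: "br q (p + r) y (br p r x z) \<in> L (p + q + r)"
      using closed[OF that(2) closed[OF that(1,3)]] by (simp add: ac_simps)
    show "br p (q + r) x (br q r y z) \<in> L (p + q + r)" by (rule 1)
    show "br (p + q) r (br p q x y) z + s ((-1) ^ (p * q)) (br q (p + r) y (br p r x z)) \<in> L (p + q + r)"
      using 2 3 by (intro sb)
    have "f (p + q + r) (br p (q + r) x (br q r y z)) = br' p (q + r) (f p x) (br' q r (f q y) (f r z))"
      using f_br[OF that(1) closed[OF that(2,3)]] f_br[OF that(2,3)] by (simp add: add.assoc)
    also have "\<dots> = br' (p + q) r (br' p q (f p x) (f q y)) (f r z)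
        + s' ((-1) ^ (p * q)) (br' q (p + r) (f q y) (br' p r (f p x) (f r z)))"
      by (rule Jacobi) (use im that in auto)
    also have "br' (p + q) r (br' p q (f p x) (f q y)) (f r z) = f (p + q + r) (br (p + q) r (br p q x y) z)"
      using f_br[OF closed[OF that(1,2)] that(3)] f_br[OF that(1,2)] by simp
    also have "br' q (p + r) (f q y) (br' p r (f p x) (f r z)) = f (p + q + r) (br q (p + r) y (br p r x z))"
      using f_br[OF that(2) closed[OF that(1,3)]] f_br[OF that(1,3)] by (simp add: ac_simps)
    finally show "f (p + q + r) (br p (q + r) x (br q r y z)) =
      f (p + q + r) (br (p + q) r (br p q x y) z + s ((-1) ^ (p * q)) (br q (p + r) y (br p r x z)))"
      by (simp add: f_add[OF 2 sb(2)[OF 3]] f_scale[OF 3])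
  qed
  have "graded_lie_algebra s L br"
    unfolding graded_lie_algebra_def
    by (intro conjI allI ballI; rule s sub closed add_left add_right scale_left scale_right antisym Jac; assumption)
  moreover have "graded_lie_algebra s' L' br'"
    unfolding graded_lie_algebra_def
  proof (intro conjI allI ballI)
    show "vector_space s'" by fact
    show "s'.subspace (L' p)" for p
      using bij[of p] by (intro subspace_image[OF s s' sub, of "f p"] f_add f_scale) (auto simp: bij_betw_def)
  next
    fix p q x y assume "x \<in> L' p" "y \<in> L' q"
    then obtain a b where ab: "a \<in> L p" "x = f p a" "b \<in> L q" "y = f q b" using pre by metis
    have br: "br' p q x y = f (p + q) (br p q a b)" using f_br ab by simp
    show "br' p q x y \<in> L' (p + q)" unfolding br using ab by (intro im closed)
    have "br q p b a \<in> L (p + q)" using closed[OF ab(3,1)] by (simp add: add.commute)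
    then have "br' p q x y = - s' ((-1) ^ (p * q)) (f (p + q) (br q p b a))"
      unfolding br antisym[OF ab(1,3)] by (simp add: f_neg f_scale sb)
    then show "br' p q x y = - s' ((-1) ^ (p * q)) (br' q p y x)"
      using f_br[OF ab(3,1)] by (simp only: ab(2,4) add.commute)
    note ba = closed[OF ab(1,3)]
    show "br' p q (s' c x) y = s' c (br' p q x y)" for c
      using f_br[OF sb(2)[OF ab(1), of c] ab(3)] unfolding br
      by (simp add: ab(2,4) f_scale[OF ab(1)] f_scale[OF ba] scale_left[OF ab(1,3)])
    show "br' p q x (s' c y) = s' c (br' p q x y)" for c
      using f_br[OF ab(1) sb(2)[OF ab(3), of c]] unfolding br
      by (simp add: ab(2,4) f_scale[OF ab(3)] f_scale[OF ba] scale_right[OF ab(1,3)])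
    show "br' p q (x + x') y = br' p q x y + br' p q x' y" if "x' \<in> L' p" for x'
    proof -
      obtain a' where a': "a' \<in> L p" "x' = f p a'" using pre[OF \<open>x' \<in> L' p\<close>] by blast
      show ?thesis
        using f_br[OF sb(1)[OF ab(1) a'(1)] ab(3)] f_br[OF a'(1) ab(3)] unfolding br
        by (simp add: ab(2,4) a'(2) f_add[OF ab(1) a'(1)] f_add[OF ba closed[OF a'(1) ab(3)]] add_left[OF ab(1) a'(1) ab(3)])
    qed
    show "br' p q x (y + y') = br' p q x y + br' p q x y'" if "y' \<in> L' q" for y'
    proof -
      obtain b' where b': "b' \<in> L q" "y' = f q b'" using pre[OF \<open>y' \<in> L' q\<close>] by blast
      show ?thesis
        using f_br[OF ab(1) sb(1)[OF ab(3) b'(1)]] f_br[OF ab(1) b'(1)] unfolding br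
        by (simp add: ab(2,4) b'(2) f_add[OF ab(3) b'(1)] f_add[OF ba closed[OF ab(1) b'(1)]] add_right[OF ab(1,3) b'(1)])
    qed
  qed (rule Jacobi)
  ultimately show ?thesis
    unfolding graded_lie_algebra_iso_def
    by (intro conjI allI ballI) (simp_all add: bij f_add f_scale f_br)
qed

theorem theorem3p8:
  fixes scale :: "'k::field_char_0 \<Rightarrow> 'v::ab_group_add \<Rightarrow> 'v"
    and B :: "'v set"
  assumes "finite_dimensional_vector_space scale B"
  shows "(\<forall>p q. \<forall>P\<in>C_dL scale p. \<forall>Q\<in>C_dL scale q.
            Psi scale B (p + q) (dL_bracket scale p q P Q)
              = rb_bracket scale p q (Psi scale B p P) (Psi scale B q Q))
       \<and> graded_lie_algebra_iso
            opscale (C_dL scale) (dL_bracket scale)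
            (cscale scale) (C_rb scale B) (rb_bracket scale)
            (Psi scale B)"
proof -
  interpret finite_dimensional_vector_space scale B by fact
  interpret fd_space scale B by unfold_locales
  interpret O: vector_space "opscale :: 'k \<Rightarrow> ('v, 'k) tensor_op \<Rightarrow> _" by (rule vs_op)
  have te: "P \<in> tensor_end scale (Suc p)" if "P \<in> C_dL scale p" for P p
    using that by (simp add: C_dL_iff)
  have "graded_lie_algebra_iso opscale (C_dL scale) (dL_bracket scale)
            (cscale scale) (C_rb scale B) (rb_bracket scale) (Psi scale B)"
  proof (rule graded_lie_algebra_iso_transport[OF vs_op vs_cochain C_dL_subspace Psi_bij])
    show "Psi scale B p (P + Q) = Psi scale B p P + Psi scale B p Q"
      if "P \<in> C_dL scale p" "Q \<in> C_dL scale p" for p P Q using that by (intro Psi_add te)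
    show "Psi scale B p (opscale c P) = cscale scale c (Psi scale B p P)"
      if "P \<in> C_dL scale p" for p c P using that by (intro Psi_scale te)
    fix p q P Q assume P: "P \<in> C_dL scale p" and Q: "Q \<in> C_dL scale q"
    show "Psi scale B (p + q) (dL_bracket scale p q P Q) = rb_bracket scale p q (Psi scale B p P) (Psi scale B q Q)"
      using P Q by (rule Psi_bracket)
    show "dL_bracket scale p q P Q \<in> C_dL scale (p + q)" using P Q by (rule bracket_in)
    show "dL_bracket scale p q P Q = - opscale ((-1) ^ (p * q)) (dL_bracket scale q p Q P)"
    proof -
      have "(-1) ^ (p * q) * (-1) ^ (p * q) = (1 :: 'k)" by (simp flip: power_mult_distrib)
      then show ?thesis by (simp add: dL_bracket_def O.scale_right_diff_distrib mult.commute)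
    qed
    show "dL_bracket scale p q (opscale c P) Q = opscale c (dL_bracket scale p q P Q)" for c
      using box_bilinear(3)[OF te[OF P] te[OF P] te[OF Q] te[OF Q]] box_bilinear(4)[OF te[OF Q] te[OF Q] te[OF P] te[OF P]]
      by (simp add: dL_bracket_def O.scale_right_diff_distrib mult.commute)
    show "dL_bracket scale p q P (opscale c Q) = opscale c (dL_bracket scale p q P Q)" for c
      using box_bilinear(4)[OF te[OF P] te[OF P] te[OF Q] te[OF Q]] box_bilinear(3)[OF te[OF Q] te[OF Q] te[OF P] te[OF P]]
      by (simp add: dL_bracket_def O.scale_right_diff_distrib mult.commute)
    show "dL_bracket scale p q (P + P') Q = dL_bracket scale p q P Q + dL_bracket scale p q P' Q"
      if P': "P' \<in> C_dL scale p" for P'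
      using box_bilinear(1)[OF te[OF P] te[OF P'] te[OF Q] te[OF Q]] box_bilinear(2)[OF te[OF Q] te[OF Q] te[OF P] te[OF P']]
      by (simp add: dL_bracket_def O.scale_right_distrib)
    show "dL_bracket scale p q P (Q + Q') = dL_bracket scale p q P Q + dL_bracket scale p q P Q'"
      if Q': "Q' \<in> C_dL scale q" for Q'
      using box_bilinear(2)[OF te[OF P] te[OF P] te[OF Q] te[OF Q']] box_bilinear(1)[OF te[OF Q] te[OF Q'] te[OF P] te[OF P]]
      by (simp add: dL_bracket_def O.scale_right_distrib)
  qed (rule rb_Jacobi)
  then show ?thesis using Psi_bracket by blast
qed

end
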